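(* Let $E=(\Phi,\mathbb G_a^d)$ be a uniformizable $t$-module over $L$, and let $Q=(\Psi,\mathbb G_a^{d+j})$ be the quasi-periodic extension of $E$ associated to $\Phi$-biderivations $\boldsymbol\delta_1,\dots,\boldsymbol\delta_j$. Then the following are equivalent: (a) The biderivations $\boldsymbol\delta_1,\dots,\boldsymbol\delta_j$ represent $L$-linearly independent classes in $H_{sr}(\Phi)$. (b) $Q$ is a minimal extension of $E$ (with respect to the projection $Q\to E$ onto the first $d$ coordinates).
   Context: $q$ is a prime power, $k=\mathbb F_q(\theta)$, $C_\infty$ the completion of an algebraic closure of $\mathbb F_q((1/\theta))$; $L$ is an algebraically closed field with $k\subset L\subset C_\infty$; $\mathsf A=\mathbb F_q[t]$, $\iota:\mathsf A\to\mathbb F_q[\theta]$ the isomorphism $t\mapsto\theta$. $L\{\tau\}$ is the twisted polynomial ring, $\tau c=c^q\tau$; $d(\cdot)$ of a matrix over $L\{\tau\}$ is its coefficient of $\tau^0$. A $t$-module over $L$ is $E=(\Phi,\mathbb G_a^d)$ with $\Phi:\mathsf A\to\mathrm{Mat}_{d\times d}(L\{\tau\})$ an $\mathbb F_q$-algebra homomorphism (determined by $\Phi(t)$) with $d\Phi(t)=\theta I_d+N$, $N$ nilpotent. A sub-$t$-module is a connected algebraic subgroup stable under $\Phi(t)$. $E$ is uniformizable if its exponential $\mathrm{Exp}:C_\infty^d\to C_\infty^d$ (the entire $\mathbb F_q$-linear power series with identity linear part and $\mathrm{Exp}(d\Phi(t)\mathbf z)=\Phi(t)\mathrm{Exp}(\mathbf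 z)$) is surjective. A $\Phi$-biderivation is an $\mathbb F_q$-linear map $\boldsymbol\delta:\mathsf A\to\mathrm{Mat}_{1\times d}(L\{\tau\}\tau)$ with $\boldsymbol\delta(ab)=\iota(a)\boldsymbol\delta(b)+\boldsymbol\delta(a)\Phi(b)$; it is inner if $\boldsymbol\delta(a)=\mathbf U\Phi(a)-\iota(a)\mathbf U$ for some $\mathbf U\in\mathrm{Mat}_{1\times d}(L\{\tau\})$ with $d\mathbf U\cdot N=0$. $H_{sr}(\Phi)$ is the $L$-vector space of $\Phi$-biderivations modulo the inner ones. The quasi-periodic extension associated to $\boldsymbol\delta_1,\dots,\boldsymbol\delta_j$ is the $t$-module $(\Psi,\mathbb G_a^{d+j})$ with $\Psi(t)=\begin{pmatrix}\Phi(t)&0\\ \boldsymbol\delta(t)&\theta I_j\end{pmatrix}$, where $\boldsymbol\delta(t)$ has rows $\boldsymbol\delta_1(t),\dots,\boldsymbol\delta_j(t)$ (it is uniformizable if and only if $E$ is). Given a surjective morphism from a uniformizable $t$-module $Y$ to a uniformizable $t$-module $E$, $Y$ is a minimal extension of $E$ if no proper sub-$t$-module of $Y$ surjects onto $E$ (under this morphism). *)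

theory Defs
  imports
    "HOL-Analysis.Analysis"
    "HOL-Computational_Algebra.Formal_Laurent_Series"
    "HOL-Algebra.Module"
    "HOL-Algebra.Algebraic_Closure_Type"
begin

no_notation fps_nth (infixl \<open>$\<close> 75)

section \<open>The fields\<close>

text \<open>
  The finite field with \<open>q\<close> elements is a type \<open>'f\<close> of sort \<open>{field, finite}\<close>, with
  \<open>q = CARD('f)\<close>; \<open>\<A> = \<F>\<^sub>q[t]\<close> is \<open>'f poly\<close>; and \<open>\<F>\<^sub>q((1/\<theta>))\<close> is \<open>'f fls\<close>, the series
  variable \<open>fls_X\<close> being \<open>1/\<theta>\<close>, so that \<open>\<theta>\<close> is \<open>fls_X_inv\<close>.
\<close>

definition field_embedding :: "('a::field \<Rightarrow> 'b::field) \<Rightarrow> bool" where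
  "field_embedding h \<longleftrightarrow>
     h 1 = 1 \<and> (\<forall>x y. h (x + y) = h x + h y) \<and> (\<forall>x y. h (x * y) = h x * h y)"

text \<open>
  \<open>'c\<close> is a completion of the algebraic closure of \<open>\<F>\<^sub>q((1/\<theta>))\<close>, the embedding being \<open>emb\<close>. Its
  absolute value is \<open>dist x 0\<close>; it is normalised by \<open>\<bar>\<theta>\<bar> = q\<close>. Completeness is part of the sort.
\<close>

definition is_C_infinity ::
  "('f::{field,finite} fls alg_closure \<Rightarrow> 'c::{field,complete_space}) \<Rightarrow> bool" where
  "is_C_infinity emb \<longleftrightarrow>
     field_embedding emb \<and>
     (\<forall>x y::'c. dist x y = dist (x - y) 0) \<and>
     (\<forall>x y::'c. dist (x * y) 0 = dist x 0 * dist y 0) \<and>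
     (\<forall>x y::'c. dist (x + y) 0 \<le> max (dist x 0) (dist y 0)) \<and>
     (\<forall>f. f \<noteq> 0 \<longrightarrow> dist (emb (to_ac f)) 0 = real CARD('f) powi (- fls_subdegree f)) \<and>
     closure (range emb) = UNIV"

text \<open>
  The chain \<open>\<F>\<^sub>q(\<theta>) \<subseteq> L \<subseteq> C\<^sub>\<infinity>\<close>: \<open>L\<close> is a type \<open>'l\<close> (algebraically closed by its sort), \<open>incl\<close> its
  inclusion in \<open>C\<^sub>\<infinity>\<close>, and \<open>\<iota>\<close> is the map \<open>a \<mapsto> a(\<theta>)\<close> from \<open>\<A>\<close> to \<open>L\<close>.
\<close>

definition field_tower ::
  "('f::{field,finite} fls alg_closure \<Rightarrow> 'c::{field,complete_space}) \<Rightarrow>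
   ('l::alg_closed_field \<Rightarrow> 'c) \<Rightarrow> ('f poly \<Rightarrow> 'l) \<Rightarrow> bool" where
  "field_tower emb incl \<iota> \<longleftrightarrow>
     is_C_infinity emb \<and> field_embedding incl \<and>
     (\<forall>a. incl (\<iota> a) = emb (to_ac (poly (map_poly fls_const a) fls_X_inv)))"

abbreviation tvar :: "'f::{field,finite} poly" where
  "tvar \<equiv> [:0, 1:]"


section \<open>Twisted polynomials\<close>

text \<open>
  The twisted polynomial \<open>\<Sum> a\<^sub>i \<tau>\<^sup>i\<close> is represented by the polynomial with coefficients \<open>a\<^sub>i\<close>. Sums,
  left scalar multiples and coefficients are those of the type \<open>'a poly\<close>; products are not:
  they are given by \<open>tmul q\<close>, which implements \<open>\<tau> c = c\<^sup>q \<tau>\<close>, and evaluation at a point is \<open>teval q\<close>.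
\<close>

definition tmul :: "nat \<Rightarrow> 'a::field poly \<Rightarrow> 'a poly \<Rightarrow> 'a poly" where
  "tmul q p r =
     (\<Sum>i\<le>Polynomial.degree p. \<Sum>j\<le>Polynomial.degree r.
        Polynomial.monom (Polynomial.coeff p i * Polynomial.coeff r j ^ (q ^ i)) (i + j))"

definition teval :: "nat \<Rightarrow> 'a::field poly \<Rightarrow> 'a \<Rightarrow> 'a" where
  "teval q p x = (\<Sum>i\<le>Polynomial.degree p. Polynomial.coeff p i * x ^ (q ^ i))"

definition tmat_mul ::
  "nat \<Rightarrow> 'a::field poly^'n^'m \<Rightarrow> 'a poly^'p^'n \<Rightarrow> 'a poly^'p^'m" where
  "tmat_mul q A B = (\<chi> i k. \<Sum>j\<in>UNIV. tmul q (A $ i $ j) (B $ j $ k))"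

definition trow_mul ::
  "nat \<Rightarrow> 'a::field poly^'n \<Rightarrow> 'a poly^'p^'n \<Rightarrow> 'a poly^'p" where
  "trow_mul q v B = (\<chi> k. \<Sum>j\<in>UNIV. tmul q (v $ j) (B $ j $ k))"

definition trow_smult :: "'a::field \<Rightarrow> 'a poly^'n \<Rightarrow> 'a poly^'n" where
  "trow_smult c v = (\<chi> k. Polynomial.smult c (v $ k))"

definition tmat_act :: "nat \<Rightarrow> 'a::field poly^'n^'m \<Rightarrow> 'a^'n \<Rightarrow> 'a^'m" where
  "tmat_act q M z = (\<chi> i. \<Sum>j\<in>UNIV. teval q (M $ i $ j) (z $ j))"

definition d_mat :: "'a::field poly^'n^'m \<Rightarrow> 'a^'n^'m" where
  "d_mat M = (\<chi> i j. Polynomial.coeff (M $ i $ j) 0)"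

definition d_row :: "'a::field poly^'n \<Rightarrow> 'a^'n" where
  "d_row v = (\<chi> j. Polynomial.coeff (v $ j) 0)"


section \<open>\<open>t\<close>-modules and uniformizability\<close>

definition nilpotent_mat :: "'a::field^'n^'n \<Rightarrow> bool" where
  "nilpotent_mat N \<longleftrightarrow> (\<exists>k. (((**) N) ^^ k) (mat 1) = 0)"

definition nil_part ::
  "('f::{field,finite} poly \<Rightarrow> 'l::field) \<Rightarrow> ('f poly \<Rightarrow> 'l poly^'d^'d) \<Rightarrow> 'l^'d^'d" where
  "nil_part \<iota> \<Phi> = d_mat (\<Phi> tvar) - mat (\<iota> tvar)"

definition t_module ::
  "('f::{field,finite} poly \<Rightarrow> 'l::field) \<Rightarrow> ('f poly \<Rightarrow> 'l poly^'d^'d) \<Rightarrow> bool" where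
  "t_module \<iota> \<Phi> \<longleftrightarrow>
     (\<forall>a b. \<Phi> (a + b) = \<Phi> a + \<Phi> b) \<and>
     (\<forall>a b. \<Phi> (a * b) = tmat_mul CARD('f) (\<Phi> a) (\<Phi> b)) \<and>
     (\<forall>c. \<Phi> [:c:] = mat [:\<iota> [:c:]:]) \<and>
     nilpotent_mat (nil_part \<iota> \<Phi>)"

text \<open>
  An \<open>\<F>\<^sub>q\<close>-linear power series in \<open>d\<close> variables is \<open>\<Sum>\<^sub>n Q\<^sub>n z\<^bsup>(n)\<^esup>\<close>, where the entries of \<open>z\<^bsup>(n)\<^esup>\<close> are
  the \<open>q\<^sup>n\<close>-th powers of those of \<open>z\<close>; entire means convergent at every point of \<open>C\<^sub>\<infinity>\<^sup>d\<close>.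
\<close>

definition frob_vec :: "nat \<Rightarrow> nat \<Rightarrow> 'a::field^'n \<Rightarrow> 'a^'n" where
  "frob_vec q n z = (\<chi> i. (z $ i) ^ (q ^ n))"

definition is_exponential ::
  "('l::field \<Rightarrow> 'c::{field,complete_space}) \<Rightarrow> ('f::{field,finite} poly \<Rightarrow> 'l poly^'d^'d) \<Rightarrow>
   ('c^'d \<Rightarrow> 'c^'d) \<Rightarrow> bool" where
  "is_exponential incl \<Phi> E \<longleftrightarrow>
     (let \<Phi>t = (\<chi> i j. map_poly incl (\<Phi> tvar $ i $ j)) :: 'c poly^'d^'d in
      (\<exists>Q :: nat \<Rightarrow> 'c^'d^'d.
         Q 0 = mat 1 \<and> (\<forall>z. (\<lambda>n. Q n *v frob_vec CARD('f) n z) sums E z)) \<and>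
      (\<forall>z. E (d_mat \<Phi>t *v z) = tmat_act CARD('f) \<Phi>t (E z)))"

definition uniformizable ::
  "('l::field \<Rightarrow> 'c::{field,complete_space}) \<Rightarrow> ('f::{field,finite} poly \<Rightarrow> 'l poly^'d^'d) \<Rightarrow> bool"
  where "uniformizable incl \<Phi> \<longleftrightarrow> (\<exists>E. is_exponential incl \<Phi> E \<and> surj E)"

definition t_morphism ::
  "('f::{field,finite} poly \<Rightarrow> 'l::field poly^'e^'e) \<Rightarrow> ('f poly \<Rightarrow> 'l poly^'d^'d) \<Rightarrow>
   'l poly^'e^'d \<Rightarrow> bool" where
  "t_morphism \<Psi> \<Phi> F \<longleftrightarrow> (\<forall>a. tmat_mul CARD('f) F (\<Psi> a) = tmat_mul CARD('f) (\<Phi> a) F)"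


section \<open>Algebraic subgroups of \<open>\<G>\<^sub>a\<^sup>n\<close>\<close>

text \<open>
  As \<open>L\<close> is algebraically closed, a variety over \<open>L\<close> inside affine \<open>n\<close>-space is identified with its
  set of \<open>L\<close>-points, a Zariski closed subset of \<open>L\<^sup>n\<close>.
\<close>

inductive polyfun :: "('a::field^'n \<Rightarrow> 'a) \<Rightarrow> bool" where
  polyfun_const: "polyfun (\<lambda>x. c)"
| polyfun_coord: "polyfun (\<lambda>x. x $ i)"
| polyfun_add: "polyfun f \<Longrightarrow> polyfun g \<Longrightarrow> polyfun (\<lambda>x. f x + g x)"
| polyfun_mult: "polyfun f \<Longrightarrow> polyfun g \<Longrightarrow> polyfun (\<lambda>x. f x * g x)"

definition zariski_open :: "('a::field^'n) set \<Rightarrow> bool" where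
  "zariski_open U \<longleftrightarrow> (\<exists>F. (\<forall>f\<in>F. polyfun f) \<and> - U = {x. \<forall>f\<in>F. f x = 0})"

lemma istopology_zariski: "istopology (zariski_open :: ('a::field^'n) set \<Rightarrow> bool)"
  unfolding istopology_def
proof (intro conjI allI impI)
  fix S T :: "('a^'n) set"
  assume S: "zariski_open S" and T: "zariski_open T"
  from S obtain F where F: "\<forall>f\<in>F. polyfun f" "- S = {x. \<forall>f\<in>F. f x = 0}"
    unfolding zariski_open_def by (elim exE conjE)
  from T obtain G where G: "\<forall>f\<in>G. polyfun f" "- T = {x. \<forall>f\<in>G. f x = 0}"
    unfolding zariski_open_def by (elim exE conjE)
  define H where "H = (\<lambda>(f, g) x. f x * g x) ` (F \<times> G)"
  have "polyfun h" if "h \<in> H" for h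
  proof -
    from that obtain f g where "h = (\<lambda>x. f x * g x)" "f \<in> F" "g \<in> G"
      unfolding H_def by auto
    then show ?thesis
      using F(1) G(1) by (simp add: polyfun_mult)
  qed
  then have pf: "\<forall>h\<in>H. polyfun h" ..
  have eq: "x \<in> - (S \<inter> T) \<longleftrightarrow> (\<forall>h\<in>H. h x = 0)" for x
  proof -
    have "x \<in> - (S \<inter> T) \<longleftrightarrow> x \<in> - S \<or> x \<in> - T"
      by simp
    also have "\<dots> \<longleftrightarrow> (\<forall>f\<in>F. f x = 0) \<or> (\<forall>g\<in>G. g x = 0)"
      unfolding F(2) G(2) by simp
    also have "\<dots> \<longleftrightarrow> (\<forall>f\<in>F. \<forall>g\<in>G. f x = 0 \<or> g x = 0)"
      by meson
    also have "\<dots> \<longleftrightarrow> (\<forall>h\<in>H. h x = 0)"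
      by (simp add: H_def)
    finally show ?thesis .
  qed
  have "- (S \<inter> T) = {x. \<forall>h\<in>H. h x = 0}"
    by (rule Set.set_eqI) (simp only: eq mem_Collect_eq)
  with pf show "zariski_open (S \<inter> T)"
    unfolding zariski_open_def by (intro exI[of _ H] conjI)
next
  fix K :: "('a^'n) set set"
  assume "\<forall>S\<in>K. zariski_open S"
  then have "\<forall>S\<in>K. \<exists>F. (\<forall>f\<in>F. polyfun f) \<and> - S = {x. \<forall>f\<in>F. f x = 0}"
    unfolding zariski_open_def .
  from bchoice[OF this] obtain F
    where F: "\<forall>S\<in>K. (\<forall>f\<in>F S. polyfun f) \<and> - S = {x. \<forall>f\<in>F S. f x = 0}" ..
  have eq: "x \<in> - \<Union>K \<longleftrightarrow> (\<forall>f\<in>(\<Union>S\<in>K. F S). f x = 0)" for x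
  proof -
    have "x \<in> - \<Union>K \<longleftrightarrow> (\<forall>S\<in>K. x \<in> - S)"
      by simp
    also have "\<dots> \<longleftrightarrow> (\<forall>S\<in>K. \<forall>f\<in>F S. f x = 0)"
      using F by (intro ball_cong refl) simp
    also have "\<dots> \<longleftrightarrow> (\<forall>f\<in>(\<Union>S\<in>K. F S). f x = 0)"
      by simp
    finally show ?thesis .
  qed
  have "- \<Union>K = {x. \<forall>f\<in>(\<Union>S\<in>K. F S). f x = 0}"
    by (rule Set.set_eqI) (simp only: eq mem_Collect_eq)
  moreover have "\<forall>f\<in>(\<Union>S\<in>K. F S). polyfun f"
    using F by simp
  ultimately show "zariski_open (\<Union>K)"
    unfolding zariski_open_def by (intro exI[of _ "\<Union>S\<in>K. F S"] conjI)
qed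

definition zariski :: "('a::field^'n) topology" where
  "zariski = topology zariski_open"

lemma openin_zariski: "openin zariski U \<longleftrightarrow> zariski_open U"
  by (simp add: zariski_def topology_inverse'[OF istopology_zariski])

lemma topspace_zariski: "topspace (zariski :: ('a::field^'n) topology) = UNIV"
proof -
  have "zariski_open (UNIV :: ('a^'n) set)"
    unfolding zariski_open_def by (intro exI[of _ "{\<lambda>x. 1}"]) (auto intro: polyfun_const)
  then have "openin zariski (UNIV :: ('a^'n) set)"
    by (simp add: openin_zariski)
  then show ?thesis
    using openin_subset by blast
qed

definition sub_t_module ::
  "('f::{field,finite} poly \<Rightarrow> 'l::field poly^'n^'n) \<Rightarrow> ('l^'n) set \<Rightarrow> bool" where
  "sub_t_module \<Psi> Y \<longleftrightarrow>
     closedin zariski Y \<and> connectedin zariski Y \<and>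
     0 \<in> Y \<and> (\<forall>x\<in>Y. \<forall>y\<in>Y. x + y \<in> Y) \<and> (\<forall>x\<in>Y. - x \<in> Y) \<and>
     (\<forall>x\<in>Y. tmat_act CARD('f) (\<Psi> tvar) x \<in> Y)"

text \<open>Surjectivity can be tested on \<open>L\<close>-points because \<open>L\<close> is algebraically closed.\<close>

definition minimal_extension ::
  "('f::{field,finite} poly \<Rightarrow> 'l::alg_closed_field) \<Rightarrow> ('l \<Rightarrow> 'c::{field,complete_space}) \<Rightarrow>
   ('f poly \<Rightarrow> 'l poly^'e^'e) \<Rightarrow> ('f poly \<Rightarrow> 'l poly^'d^'d) \<Rightarrow> 'l poly^'e^'d \<Rightarrow> bool" where
  "minimal_extension \<iota> incl \<Psi> \<Phi> F \<longleftrightarrow>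
     t_module \<iota> \<Psi> \<and> uniformizable incl \<Psi> \<and> t_module \<iota> \<Phi> \<and> uniformizable incl \<Phi> \<and>
     t_morphism \<Psi> \<Phi> F \<and> surj (tmat_act CARD('f) F) \<and>
     \<not> (\<exists>Y. sub_t_module \<Psi> Y \<and> Y \<noteq> UNIV \<and> tmat_act CARD('f) F ` Y = UNIV)"


section \<open>Biderivations and quasi-periodic extensions\<close>

definition biderivations ::
  "('f::{field,finite} poly \<Rightarrow> 'l::field) \<Rightarrow> ('f poly \<Rightarrow> 'l poly^'d^'d) \<Rightarrow>
   ('f poly \<Rightarrow> 'l poly^'d) set" where
  "biderivations \<iota> \<Phi> =
     {\<delta>. (\<forall>a b. \<delta> (a + b) = \<delta> a + \<delta> b) \<and>
         (\<forall>c a. \<delta> (Polynomial.smult c a) = trow_smult (\<iota> [:c:]) (\<delta> a)) \<and>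
         (\<forall>a. d_row (\<delta> a) = 0) \<and>
         (\<forall>a b. \<delta> (a * b) = trow_smult (\<iota> a) (\<delta> b) + trow_mul CARD('f) (\<delta> a) (\<Phi> b))}"

definition inner_biderivations ::
  "('f::{field,finite} poly \<Rightarrow> 'l::field) \<Rightarrow> ('f poly \<Rightarrow> 'l poly^'d^'d) \<Rightarrow>
   ('f poly \<Rightarrow> 'l poly^'d) set" where
  "inner_biderivations \<iota> \<Phi> =
     {\<delta> \<in> biderivations \<iota> \<Phi>.
        \<exists>U. d_row U v* nil_part \<iota> \<Phi> = 0 \<and>
            (\<forall>a. \<delta> a = trow_mul CARD('f) U (\<Phi> a) - trow_smult (\<iota> a) U)}"

definition H_sr_class ::
  "('f::{field,finite} poly \<Rightarrow> 'l::field) \<Rightarrow> ('f poly \<Rightarrow> 'l poly^'d^'d) \<Rightarrow>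
   ('f poly \<Rightarrow> 'l poly^'d) \<Rightarrow> ('f poly \<Rightarrow> 'l poly^'d) set" where
  "H_sr_class \<iota> \<Phi> \<delta> = {\<lambda>a. \<delta> a + \<eta> a | \<eta>. \<eta> \<in> inner_biderivations \<iota> \<Phi>}"

text \<open>The ring operations of the record type are irrelevant for a module and left undefined.\<close>

definition H_sr ::
  "('f::{field,finite} poly \<Rightarrow> 'l::field) \<Rightarrow> ('f poly \<Rightarrow> 'l poly^'d^'d) \<Rightarrow>
   ('l, ('f poly \<Rightarrow> 'l poly^'d) set) module" where
  "H_sr \<iota> \<Phi> =
     \<lparr>carrier = H_sr_class \<iota> \<Phi> ` biderivations \<iota> \<Phi>,
      monoid.mult = undefined,
      one = undefined,
      zero = H_sr_class \<iota> \<Phi> (\<lambda>a. 0),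
      add = (\<lambda>A B. \<Union>\<xi>\<in>A. \<Union>\<eta>\<in>B. H_sr_class \<iota> \<Phi> (\<lambda>a. \<xi> a + \<eta> a)),
      smult = (\<lambda>c A. \<Union>\<xi>\<in>A. H_sr_class \<iota> \<Phi> (\<lambda>a. trow_smult c (\<xi> a)))\<rparr>"

text \<open>\<open>H_sr \<iota> \<Phi>\<close> is a vector space over \<open>L\<close>, so that \<^const>\<open>finsum\<close> computes its sums.\<close>

lemma tmul_alt:
  assumes "Polynomial.degree p \<le> n"
  shows "tmul q p r =
    (\<Sum>i\<le>n. \<Sum>j\<le>Polynomial.degree r.
        Polynomial.monom (Polynomial.coeff p i * Polynomial.coeff r j ^ (q ^ i)) (i + j))"
  unfolding tmul_def using assms
  by (intro sum.mono_neutral_left) (auto simp: coeff_eq_0)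

lemma smult_sum_right:
  "Polynomial.smult c (\<Sum>i\<in>A. f i) = (\<Sum>i\<in>A. Polynomial.smult c (f i))"
  by (induction A rule: infinite_finite_induct) (simp_all add: smult_add_right)

lemma tmul_add_left: "tmul q (p + p') r = tmul q p r + tmul q p' r"
proof -
  define n where "n = max (Polynomial.degree p) (Polynomial.degree p')"
  have le: "Polynomial.degree p \<le> n" "Polynomial.degree p' \<le> n" "Polynomial.degree (p + p') \<le> n"
    by (auto simp: n_def intro: degree_add_le_max)
  show ?thesis
    unfolding le[THEN tmul_alt]
    by (simp add: sum.distrib[symmetric] add_monom distrib_right)
qed

lemma tmul_smult_left: "tmul q (Polynomial.smult c p) r = Polynomial.smult c (tmul q p r)"
proof -
  have le: "Polynomial.degree (Polynomial.smult c p) \<le> Polynomial.degree p"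
    by (rule degree_smult_le)
  show ?thesis
    unfolding le[THEN tmul_alt] tmul_def
    by (simp add: smult_sum_right smult_monom mult.assoc)
qed

lemma trow_mul_add_left: "trow_mul q (u + v) A = trow_mul q u A + trow_mul q v A"
  by (simp add: trow_mul_def vec_eq_iff tmul_add_left sum.distrib)

lemma trow_mul_smult_left: "trow_mul q (trow_smult c u) A = trow_smult c (trow_mul q u A)"
  by (simp add: trow_mul_def trow_smult_def vec_eq_iff tmul_smult_left smult_sum_right)

lemma trow_smult_add_right: "trow_smult c (u + v) = trow_smult c u + trow_smult c v"
  by (simp add: trow_smult_def vec_eq_iff smult_add_right)

lemma trow_smult_add_left: "trow_smult (c + d) u = trow_smult c u + trow_smult d u"
  by (simp add: trow_smult_def vec_eq_iff smult_add_left)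

lemma trow_smult_diff_right: "trow_smult c (u - v) = trow_smult c u - trow_smult c v"
  by (simp add: trow_smult_def vec_eq_iff smult_diff_right)

lemma trow_smult_smult: "trow_smult c (trow_smult d u) = trow_smult (c * d) u"
  by (simp add: trow_smult_def vec_eq_iff)

lemma trow_smult_0 [simp]: "trow_smult 0 u = 0" "trow_smult c 0 = 0"
  by (simp_all add: trow_smult_def vec_eq_iff)

lemma trow_smult_1 [simp]: "trow_smult 1 u = u"
  by (simp add: trow_smult_def vec_eq_iff)

lemma trow_mul_0 [simp]: "trow_mul q 0 A = 0"
  by (simp add: trow_mul_def tmul_def vec_eq_iff)

lemma d_row_add: "d_row (u + v) = d_row u + d_row v"
  by (simp add: d_row_def vec_eq_iff)

lemma d_row_smult: "d_row (trow_smult c u) = c *s d_row u"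
  by (simp add: d_row_def trow_smult_def vec_eq_iff)

lemma d_row_0 [simp]: "d_row 0 = 0"
  by (simp add: d_row_def vec_eq_iff)

lemma biderivations_add:
  assumes "\<delta> \<in> biderivations \<iota> \<Phi>" "\<eta> \<in> biderivations \<iota> \<Phi>"
  shows "(\<lambda>a. \<delta> a + \<eta> a) \<in> biderivations \<iota> \<Phi>"
  using assms
  by (simp add: biderivations_def trow_smult_add_right trow_mul_add_left d_row_add algebra_simps)

lemma biderivations_smult:
  assumes "\<delta> \<in> biderivations \<iota> \<Phi>"
  shows "(\<lambda>a. trow_smult c (\<delta> a)) \<in> biderivations \<iota> \<Phi>"
  using assms
  by (simp add: biderivations_def trow_smult_add_right trow_mul_smult_left d_row_smult
      trow_smult_smult mult.commute)

lemma biderivations_0: "(\<lambda>a. 0) \<in> biderivations \<iota> \<Phi>"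
  by (simp add: biderivations_def)

lemma inner_biderivations_add:
  fixes \<iota> :: "'f::{field,finite} poly \<Rightarrow> 'l::field"
  assumes "\<delta> \<in> inner_biderivations \<iota> \<Phi>" "\<eta> \<in> inner_biderivations \<iota> \<Phi>"
  shows "(\<lambda>a. \<delta> a + \<eta> a) \<in> inner_biderivations \<iota> \<Phi>"
proof -
  obtain U where U: "d_row U v* nil_part \<iota> \<Phi> = 0"
      "\<And>a. \<delta> a = trow_mul CARD('f) U (\<Phi> a) - trow_smult (\<iota> a) U"
    using assms(1) by (auto simp: inner_biderivations_def)
  obtain V where V: "d_row V v* nil_part \<iota> \<Phi> = 0"
      "\<And>a. \<eta> a = trow_mul CARD('f) V (\<Phi> a) - trow_smult (\<iota> a) V"
    using assms(2) by (auto simp: inner_biderivations_def)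
  have "d_row (U + V) v* nil_part \<iota> \<Phi> = 0"
    using U(1) V(1) by (simp add: d_row_add vector_matrix_left_distrib)
  moreover have "\<delta> a + \<eta> a = trow_mul CARD('f) (U + V) (\<Phi> a) - trow_smult (\<iota> a) (U + V)" for a
    unfolding U(2) V(2) by (simp add: trow_mul_add_left trow_smult_add_right)
  ultimately show ?thesis
    using assms biderivations_add[of \<delta> \<iota> \<Phi> \<eta>] unfolding inner_biderivations_def
    by (auto intro!: exI[of _ "U + V"])
qed

lemma inner_biderivations_smult:
  fixes \<iota> :: "'f::{field,finite} poly \<Rightarrow> 'l::field"
  assumes "\<delta> \<in> inner_biderivations \<iota> \<Phi>"
  shows "(\<lambda>a. trow_smult c (\<delta> a)) \<in> inner_biderivations \<iota> \<Phi>"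
proof -
  obtain U where U: "d_row U v* nil_part \<iota> \<Phi> = 0"
      "\<And>a. \<delta> a = trow_mul CARD('f) U (\<Phi> a) - trow_smult (\<iota> a) U"
    using assms(1) by (auto simp: inner_biderivations_def)
  have "d_row (trow_smult c U) v* nil_part \<iota> \<Phi> = c *s (d_row U v* nil_part \<iota> \<Phi>)"
    by (simp add: d_row_smult vector_matrix_mult_def vec_eq_iff sum_distrib_left mult_ac)
  then have "d_row (trow_smult c U) v* nil_part \<iota> \<Phi> = 0"
    using U(1) by (simp add: vec_eq_iff)
  moreover have "trow_smult c (\<delta> a) =
      trow_mul CARD('f) (trow_smult c U) (\<Phi> a) - trow_smult (\<iota> a) (trow_smult c U)" for a
    unfolding U(2)
    by (simp add: trow_mul_smult_left trow_smult_diff_right trow_smult_smult mult.commute)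
  ultimately show ?thesis
    using assms biderivations_smult[of \<delta> \<iota> \<Phi> c] unfolding inner_biderivations_def
    by (auto intro!: exI[of _ "trow_smult c U"])
qed

lemma inner_biderivations_0: "(\<lambda>a. 0) \<in> inner_biderivations \<iota> \<Phi>"
  by (auto simp: inner_biderivations_def biderivations_0 intro!: exI[of _ 0])

lemma inner_biderivations_uminus:
  assumes "\<delta> \<in> inner_biderivations \<iota> \<Phi>"
  shows "(\<lambda>a. - \<delta> a) \<in> inner_biderivations \<iota> \<Phi>"
proof -
  have "(\<lambda>a. trow_smult (-1) (\<delta> a)) = (\<lambda>a. - \<delta> a)"
    by (simp add: trow_smult_def fun_eq_iff vec_eq_iff)
  then show ?thesis
    using inner_biderivations_smult[OF assms, of "-1"] by simp
qed

lemma H_sr_class_mem: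
  "\<xi> \<in> H_sr_class \<iota> \<Phi> \<delta> \<longleftrightarrow> (\<lambda>a. \<xi> a - \<delta> a) \<in> inner_biderivations \<iota> \<Phi>"
proof
  assume "\<xi> \<in> H_sr_class \<iota> \<Phi> \<delta>"
  then obtain \<eta> where "\<eta> \<in> inner_biderivations \<iota> \<Phi>" "\<xi> = (\<lambda>a. \<delta> a + \<eta> a)"
    by (auto simp: H_sr_class_def)
  then show "(\<lambda>a. \<xi> a - \<delta> a) \<in> inner_biderivations \<iota> \<Phi>"
    by simp
next
  assume *: "(\<lambda>a. \<xi> a - \<delta> a) \<in> inner_biderivations \<iota> \<Phi>"
  have "\<xi> = (\<lambda>a. \<delta> a + (\<xi> a - \<delta> a))"
    by simp
  then show "\<xi> \<in> H_sr_class \<iota> \<Phi> \<delta>"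
    unfolding H_sr_class_def using * by (intro CollectI exI conjI)
qed

lemma H_sr_class_eq_iff:
  "H_sr_class \<iota> \<Phi> \<delta> = H_sr_class \<iota> \<Phi> \<epsilon> \<longleftrightarrow> (\<lambda>a. \<delta> a - \<epsilon> a) \<in> inner_biderivations \<iota> \<Phi>"
proof
  assume "H_sr_class \<iota> \<Phi> \<delta> = H_sr_class \<iota> \<Phi> \<epsilon>"
  moreover have "\<delta> \<in> H_sr_class \<iota> \<Phi> \<delta>"
    by (simp add: H_sr_class_mem inner_biderivations_0)
  ultimately show "(\<lambda>a. \<delta> a - \<epsilon> a) \<in> inner_biderivations \<iota> \<Phi>"
    by (simp add: H_sr_class_mem)
next
  assume *: "(\<lambda>a. \<delta> a - \<epsilon> a) \<in> inner_biderivations \<iota> \<Phi>"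
  have "\<xi> \<in> H_sr_class \<iota> \<Phi> \<delta> \<longleftrightarrow> \<xi> \<in> H_sr_class \<iota> \<Phi> \<epsilon>" for \<xi>
  proof
    assume "\<xi> \<in> H_sr_class \<iota> \<Phi> \<delta>"
    then have "(\<lambda>a. \<xi> a - \<delta> a) \<in> inner_biderivations \<iota> \<Phi>"
      by (simp add: H_sr_class_mem)
    from inner_biderivations_add[OF this *] show "\<xi> \<in> H_sr_class \<iota> \<Phi> \<epsilon>"
      by (simp add: H_sr_class_mem)
  next
    assume "\<xi> \<in> H_sr_class \<iota> \<Phi> \<epsilon>"
    then have "(\<lambda>a. \<xi> a - \<epsilon> a) \<in> inner_biderivations \<iota> \<Phi>"
      by (simp add: H_sr_class_mem)
    from inner_biderivations_add[OF this inner_biderivations_uminus[OF *]]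
    show "\<xi> \<in> H_sr_class \<iota> \<Phi> \<delta>"
      by (simp add: H_sr_class_mem)
  qed
  then show "H_sr_class \<iota> \<Phi> \<delta> = H_sr_class \<iota> \<Phi> \<epsilon>"
    by (intro Set.set_eqI)
qed

lemma H_sr_simps:
  shows H_sr_carrier: "carrier (H_sr \<iota> \<Phi>) = H_sr_class \<iota> \<Phi> ` biderivations \<iota> \<Phi>"
    and H_sr_zero: "\<zero>\<^bsub>H_sr \<iota> \<Phi>\<^esub> = H_sr_class \<iota> \<Phi> (\<lambda>a. 0)"
    and H_sr_add: "H_sr_class \<iota> \<Phi> \<delta> \<oplus>\<^bsub>H_sr \<iota> \<Phi>\<^esub> H_sr_class \<iota> \<Phi> \<epsilon> =
                     H_sr_class \<iota> \<Phi> (\<lambda>a. \<delta> a + \<epsilon> a)"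
    and H_sr_smult: "c \<odot>\<^bsub>H_sr \<iota> \<Phi>\<^esub> H_sr_class \<iota> \<Phi> \<delta> =
                       H_sr_class \<iota> \<Phi> (\<lambda>a. trow_smult c (\<delta> a))"
proof -
  show "carrier (H_sr \<iota> \<Phi>) = H_sr_class \<iota> \<Phi> ` biderivations \<iota> \<Phi>"
    and "\<zero>\<^bsub>H_sr \<iota> \<Phi>\<^esub> = H_sr_class \<iota> \<Phi> (\<lambda>a. 0)"
    by (simp_all add: H_sr_def)
  have self: "\<delta> \<in> H_sr_class \<iota> \<Phi> \<delta>" for \<delta>
    by (simp add: H_sr_class_mem inner_biderivations_0)
  have *: "H_sr_class \<iota> \<Phi> (\<lambda>a. \<xi> a + \<eta> a) = H_sr_class \<iota> \<Phi> (\<lambda>a. \<delta> a + \<epsilon> a)"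
    if "\<xi> \<in> H_sr_class \<iota> \<Phi> \<delta>" "\<eta> \<in> H_sr_class \<iota> \<Phi> \<epsilon>" for \<xi> \<eta>
    using inner_biderivations_add[OF that[unfolded H_sr_class_mem]]
    by (simp add: H_sr_class_eq_iff algebra_simps)
  have "H_sr_class \<iota> \<Phi> \<delta> \<oplus>\<^bsub>H_sr \<iota> \<Phi>\<^esub> H_sr_class \<iota> \<Phi> \<epsilon> =
      (\<Union>\<xi>\<in>H_sr_class \<iota> \<Phi> \<delta>. \<Union>\<eta>\<in>H_sr_class \<iota> \<Phi> \<epsilon>. H_sr_class \<iota> \<Phi> (\<lambda>a. \<xi> a + \<eta> a))"
    by (simp add: H_sr_def)
  also have "\<dots> = (\<Union>\<xi>\<in>H_sr_class \<iota> \<Phi> \<delta>. \<Union>\<eta>\<in>H_sr_class \<iota> \<Phi> \<epsilon>.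
                      H_sr_class \<iota> \<Phi> (\<lambda>a. \<delta> a + \<epsilon> a))"
    by (intro SUP_cong refl *)
  also have "\<dots> = H_sr_class \<iota> \<Phi> (\<lambda>a. \<delta> a + \<epsilon> a)"
    using self[of \<delta>] self[of \<epsilon>] by auto
  finally show "H_sr_class \<iota> \<Phi> \<delta> \<oplus>\<^bsub>H_sr \<iota> \<Phi>\<^esub> H_sr_class \<iota> \<Phi> \<epsilon> =
                  H_sr_class \<iota> \<Phi> (\<lambda>a. \<delta> a + \<epsilon> a)" .
  have **: "H_sr_class \<iota> \<Phi> (\<lambda>a. trow_smult c (\<xi> a)) = H_sr_class \<iota> \<Phi> (\<lambda>a. trow_smult c (\<delta> a))"
    if "\<xi> \<in> H_sr_class \<iota> \<Phi> \<delta>" for \<xi>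
    using inner_biderivations_smult[OF that[unfolded H_sr_class_mem], of c]
    by (simp add: H_sr_class_eq_iff trow_smult_diff_right)
  have "c \<odot>\<^bsub>H_sr \<iota> \<Phi>\<^esub> H_sr_class \<iota> \<Phi> \<delta> =
      (\<Union>\<xi>\<in>H_sr_class \<iota> \<Phi> \<delta>. H_sr_class \<iota> \<Phi> (\<lambda>a. trow_smult c (\<xi> a)))"
    by (simp add: H_sr_def)
  also have "\<dots> = (\<Union>\<xi>\<in>H_sr_class \<iota> \<Phi> \<delta>. H_sr_class \<iota> \<Phi> (\<lambda>a. trow_smult c (\<delta> a)))"
    by (intro SUP_cong refl **)
  also have "\<dots> = H_sr_class \<iota> \<Phi> (\<lambda>a. trow_smult c (\<delta> a))"
    using self[of \<delta>] by auto
  finally show "c \<odot>\<^bsub>H_sr \<iota> \<Phi>\<^esub> H_sr_class \<iota> \<Phi> \<delta> =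
                  H_sr_class \<iota> \<Phi> (\<lambda>a. trow_smult c (\<delta> a))" .
qed

lemma module_H_sr:
  fixes \<iota> :: "'f::{field,finite} poly \<Rightarrow> 'l::field"
  shows "module ring_of_type_algebra (H_sr \<iota> \<Phi>)"
proof (rule moduleI)
  show "cring (ring_of_type_algebra :: 'l ring)"
    by (rule cring_from_type_algebra)
  show "abelian_group (H_sr \<iota> \<Phi>)"
  proof (rule abelian_groupI)
    fix x assume "x \<in> carrier (H_sr \<iota> \<Phi>)"
    then obtain \<delta> where \<delta>: "\<delta> \<in> biderivations \<iota> \<Phi>" "x = H_sr_class \<iota> \<Phi> \<delta>"
      by (auto simp: H_sr_simps)
    have "H_sr_class \<iota> \<Phi> (\<lambda>a. trow_smult (-1) (\<delta> a)) \<oplus>\<^bsub>H_sr \<iota> \<Phi>\<^esub> x = \<zero>\<^bsub>H_sr \<iota> \<Phi>\<^esub>"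
      unfolding \<delta>(2) H_sr_simps
      by (rule arg_cong[of _ _ "H_sr_class \<iota> \<Phi>"]) (simp add: trow_smult_def fun_eq_iff vec_eq_iff)
    then show "\<exists>y\<in>carrier (H_sr \<iota> \<Phi>). y \<oplus>\<^bsub>H_sr \<iota> \<Phi>\<^esub> x = \<zero>\<^bsub>H_sr \<iota> \<Phi>\<^esub>"
      using biderivations_smult[OF \<delta>(1), of "-1"] by (auto simp: H_sr_carrier)
  qed (auto simp: H_sr_simps biderivations_add biderivations_0 algebra_simps)
qed (auto simp: H_sr_simps biderivations_smult ring_of_type_algebra_def trow_smult_add_left
      trow_smult_add_right trow_smult_smult)

text \<open>Independence of an indexed family, so that repeated members make the family dependent.\<close>

definition lin_indep_family ::
  "('l::field, 'm) module \<Rightarrow> ('j::finite \<Rightarrow> 'm) \<Rightarrow> bool" where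
  "lin_indep_family M v \<longleftrightarrow>
     (\<forall>c. finsum M (\<lambda>i. c i \<odot>\<^bsub>M\<^esub> v i) UNIV = \<zero>\<^bsub>M\<^esub> \<longrightarrow> (\<forall>i. c i = 0))"

text \<open>The first \<open>d\<close> coordinates are indexed by \<open>Inl\<close>, the last \<open>j\<close> by \<open>Inr\<close>.\<close>

definition quasi_periodic_extension ::
  "('f::{field,finite} poly \<Rightarrow> 'l::field) \<Rightarrow> ('f poly \<Rightarrow> 'l poly^'d^'d) \<Rightarrow>
   ('j::finite \<Rightarrow> 'f poly \<Rightarrow> 'l poly^'d) \<Rightarrow> ('f poly \<Rightarrow> 'l poly^('d + 'j)^('d + 'j)) \<Rightarrow> bool" where
  "quasi_periodic_extension \<iota> \<Phi> \<delta> \<Psi> \<longleftrightarrow>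
     t_module \<iota> \<Psi> \<and>
     (\<forall>i k. \<Psi> tvar $ Inl i $ Inl k = \<Phi> tvar $ i $ k) \<and>
     (\<forall>i k. \<Psi> tvar $ Inl i $ Inr k = 0) \<and>
     (\<forall>i k. \<Psi> tvar $ Inr i $ Inl k = \<delta> i tvar $ k) \<and>
     (\<forall>i k. \<Psi> tvar $ Inr i $ Inr k = (if i = k then [:\<iota> tvar:] else 0))"

definition proj_mat :: "'l::field poly^('d::finite + 'j::finite)^'d" where
  "proj_mat = (\<chi> i s. case s of Inl k \<Rightarrow> if i = k then 1 else 0 | Inr k \<Rightarrow> 0)"

end

theory Submission
  imports Defs "HOL-Algebra.Sylow"
begin

text \<open>
  Let \<open>v = (x, u)\<close> be the coordinates on \<open>Q\<close>, with \<open>x \<in> L\<^sup>d\<close> and \<open>u \<in> L\<^sup>j\<close>. Both conditions fail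
  together, because a relation \<open>\<Sum> c\<^sub>i \<delta>\<^sub>i = (a \<mapsto> V \<Phi>(a) - \<iota>(a) V)\<close> with \<open>c \<noteq> 0\<close> and a proper sub-\<open>t\<close>-module \<open>Y\<close>
  of \<open>Q\<close> that surjects onto \<open>E\<close> give rise to each other.

  A relation gives the subgroup \<open>Y\<close> with the equation \<open>\<Sum> c\<^sub>i u\<^sub>i = V(x)\<close>. The relation at \<open>a = t\<close> says
  exactly that the defect \<open>\<Sum> c\<^sub>i u\<^sub>i - V(x)\<close> is multiplied by \<open>\<theta>\<close> under \<open>\<Psi>(t)\<close>, so \<open>Y\<close> is stable;
  it is connected as a polynomial image of an affine space (\<open>relation_proper_submodule\<close>).

  Conversely let \<open>Y\<close> be given. A nonzero polynomial vanishing on \<open>Y\<close> whose degree with respect to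
  iterated differences is minimal is automatically additive
  (\<open>proper_closed_subgroup_additive_equation\<close>), hence of the form \<open>\<Sum>\<^sub>s P\<^sub>s(v\<^sub>s)\<close> with additive
  one-variable polynomials \<open>P\<^sub>s\<close>. Among all nonzero additive equations choose one whose degree \<open>M\<close> in
  the variables \<open>u\<close> is least. Its pull-back along \<open>\<Psi>(t)\<close> minus \<open>\<theta>\<^sup>M\<close> times itself is again an
  equation and has smaller degree in \<open>u\<close>, since \<open>\<Psi>(t)\<close> acts on \<open>u\<close> by \<open>\<theta>\<close>. So it vanishes, the part
  in \<open>u\<close> is \<open>\<Sum> c\<^sub>i u\<^sub>i\<^sup>M\<close>, and the equation is an eigenvector with eigenvalue \<open>\<theta>\<^sup>M\<close>. If \<open>M > 1\<close>, then
  the nilpotency of \<open>d\<Phi>(t) - \<theta>\<close> makes the linear terms vanish, the equation is a \<open>p\<close>-th power, and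
  its \<open>p\<close>-th root contradicts the choice of \<open>M\<close>. So \<open>M = 1\<close>, and the eigenvector equation is the wanted
  relation at \<open>t\<close> (\<open>proper_submodule_relation\<close>); a biderivation is determined by its value at \<open>t\<close>
  (\<open>inner_biderivation_at_t\<close>). The equations of \<open>Y\<close> are only additive, not \<open>\<F>\<^sub>q\<close>-linear, because
  a sub-\<open>t\<close>-module is only required to be stable under \<open>\<Psi>(t)\<close>; the \<open>\<F>\<^sub>q\<close>-linear part is extracted at
  the end.

  Minimality also asserts that \<open>Q\<close> is uniformizable. Its exponential is \<open>(z, u) \<mapsto> (Exp z, u + F(z))\<close>,
  where the coefficients of \<open>F\<close> solve a linear system with the invertible matrices
  \<open>d\<Phi>(t)\<^bsup>(n)\<^esup> - \<theta>\<close> for \<open>n > 0\<close>, and this map is onto as soon as \<open>Exp\<close> is (\<open>quasi_periodic_row\<close>,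
  \<open>uniformizable_quasi_periodic_extension\<close>).
\<close>

section \<open>Finite fields and Frobenius powers\<close>

lemma power_card_finite_field: "(x::'f::{field,finite}) ^ CARD('f) = x"
proof (cases "x = 0")
  case False
  have "x * (\<Prod>y\<in>UNIV-{0}. x * y) = x * x ^ (CARD('f) - 1) * \<Prod>(UNIV-{0})"
    by (simp add: prod.distrib mult_ac)
  also have "x * x ^ (CARD('f) - 1) = x ^ CARD('f)"
    by (metis Suc_pred' power_Suc zero_less_card_finite)
  also have "(\<Prod>y\<in>UNIV-{0}. x * y) = (\<Prod>y\<in>UNIV-{0}. y)"
    by (rule prod.reindex_bij_witness[of _ "\<lambda>y. y / x" "\<lambda>y. x * y"]) (use False in auto)
  finally show ?thesis
    by simp
qed (simp add: zero_power)

lemma prime_CHAR_finite_field: "Factorial_Ring.prime CHAR('f::{field,finite})"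
  by (simp add: finite_imp_CHAR_pos prime_CHAR_semidom)

text \<open>
  A prime \<open>r \<noteq> p\<close> dividing \<open>q\<close> would give a nontrivial subgroup \<open>H\<close> of order \<open>r\<close> of the additive
  group. Translation by an element \<open>x \<noteq> 0\<close> of \<open>H\<close> permutes \<open>H\<close>, so the sum over \<open>H\<close> shows \<open>r x = 0\<close>,
  which is impossible in characteristic \<open>p\<close>.
\<close>

lemma card_finite_field_power_CHAR: "\<exists>e>0. CARD('f::{field,finite}) = CHAR('f) ^ e"
proof -
  define p where "p = CHAR('f)"
  define G :: "'f monoid" where "G = \<lparr>carrier = UNIV, mult = (+), one = 0\<rparr>"
  have grp: "group G"
    by (rule groupI) (auto simp: G_def add.assoc intro: exI[of _ "- _"])
  have only_p: "r = p" if r: "Factorial_Ring.prime r" "r dvd CARD('f)" for r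
  proof (rule ccontr)
    assume "r \<noteq> p"
    obtain m where m: "CARD('f) = r ^ 1 * m"
      using r(2) by auto
    obtain H where H: "subgroup H G" "card H = r ^ 1"
      using sylow_thm[OF r(1) grp, of 1 m] m by (auto simp: G_def order_def)
    then have "1 < card H"
      using prime_gt_1_nat[OF r(1)] by simp
    moreover have "0 \<in> H"
      using subgroup.one_closed[OF H(1)] by (simp add: G_def)
    ultimately obtain x where x: "x \<in> H" "x \<noteq> 0"
      by (metis card_1_singleton_iff is_singletonI' is_singleton_def less_irrefl_nat One_nat_def empty_iff)
    have closed: "x + y \<in> H" if "y \<in> H" for y
      using subgroup.m_closed[OF H(1) x(1) that] by (simp add: G_def)
    have "(\<Sum>y\<in>H. y) = (\<Sum>y\<in>(\<lambda>y. x + y) ` H. y)"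
    proof -
      have "(\<lambda>y. x + y) ` H = H"
        by (rule card_subset_eq) (auto simp: closed card_image)
      then show ?thesis by simp
    qed
    also have "\<dots> = of_nat (card H) * x + (\<Sum>y\<in>H. y)"
      by (subst sum.reindex) (simp_all add: sum.distrib)
    finally have "of_nat r = (0::'f)"
      using x(2) H(2) by simp
    then have "p dvd r"
      by (simp add: p_def of_nat_eq_0_iff_char_dvd)
    with \<open>r \<noteq> p\<close> r(1) prime_CHAR_finite_field[where 'f = 'f] show False
      using primes_dvd_imp_eq p_def by blast
  qed
  obtain k m where km: "CARD('f) = p ^ k * m" "\<not> p dvd m"
    using prime_power_canonical[OF prime_CHAR_finite_field[where 'f = 'f] zero_less_card_finite[where 'a = 'f]]
    by (metis p_def mult.commute)
  have "m = 1"
  proof (rule ccontr)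
    assume "m \<noteq> 1"
    then obtain r where "Factorial_Ring.prime r" "r dvd m"
      using prime_factor_nat by blast
    with only_p[of r] km show False
      by auto
  qed
  moreover have "1 < CARD('f)"
    using card_mono[of UNIV "{0::'f, 1}"] by simp
  ultimately have "CARD('f) = p ^ k" "k > 0"
    using km by (auto intro: gr0I)
  then show ?thesis
    by (auto simp: p_def)
qed

lemma infinite_alg_closed_field: "infinite (UNIV :: 'a::alg_closed_field set)"
proof
  assume fin: "finite (UNIV :: 'a set)"
  define P :: "'a poly" where "P = (\<Prod>a\<in>UNIV. [:- a, 1:])"
  have "Polynomial.degree P = CARD('a)"
    by (simp add: P_def degree_prod_sum_eq)
  then have "Polynomial.degree (P + 1) = CARD('a)"
    using fin by (subst degree_add_eq_left) (auto simp: card_gt_0_iff)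
  then obtain x where "poly (P + 1) x = 0"
    using alg_closed_imp_poly_has_root[of "P + 1"] fin by (auto simp: card_gt_0_iff)
  moreover have "poly P x = 0"
    using fin by (auto simp: P_def poly_prod)
  ultimately show False
    by simp
qed

lemma poly_eqI_infinite:
  assumes "infinite (UNIV :: 'a::field set)" and "\<And>x::'a. poly P x = poly R x"
  shows "P = R"
proof (rule ccontr)
  assume "P \<noteq> R"
  then have "finite {x. poly (P - R) x = 0}"
    by (intro poly_roots_finite) simp
  with assms show False
    by simp
qed

text \<open>
  The argument \<open>K\<close> only names the field whose characteristic is meant. The fact used throughout is
  that \<open>x \<mapsto> x\<^sup>q\<close> is additive.
\<close>

locale char_power =
  fixes q :: nat and K :: "'a::field itself"
  assumes prime_char: "Factorial_Ring.prime CHAR('a)"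
    and q_power: "\<exists>e>0. q = CHAR('a) ^ e"
begin

lemma q_gt_1: "1 < q"
  using q_power prime_gt_1_nat[OF prime_char] by (auto intro!: one_less_power[of "CHAR('a)", unfolded One_nat_def])

lemma power_q_eq: "\<exists>e. q ^ n = CHAR('a) ^ e"
  using q_power by (metis power_mult)

lemma frob_add: "(x + y :: 'a) ^ (q ^ n) = x ^ (q ^ n) + y ^ (q ^ n)"
  using power_q_eq[of n] freshmans_dream'[OF prime_char] by blast

lemma frob_sum: "(sum f A :: 'a) ^ (q ^ n) = (\<Sum>i\<in>A. f i ^ (q ^ n))"
  using power_q_eq[of n] freshmans_dream_sum'[OF prime_char] by blast

lemma frob_minus: "(- x :: 'a) ^ (q ^ n) = - (x ^ (q ^ n))"
  using frob_add[of x "- x" n] q_gt_1 by (simp add: zero_power eq_neg_iff_add_eq_0 add.commute)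

lemma frob_diff: "(x - y :: 'a) ^ (q ^ n) = x ^ (q ^ n) - y ^ (q ^ n)"
  using frob_add[of x "- y" n] by (simp add: frob_minus)

lemma zero_frob [simp]: "(0::'a) ^ (q ^ n) = 0"
  using q_gt_1 by (simp add: zero_power)

end

section \<open>Twisted polynomials as additive functions\<close>

text \<open>
  The ordinary polynomial with the same values as the twisted polynomial \<open>r\<close>, obtained from
  \<open>\<tau>\<^sup>i \<mapsto> X\<^bsup>q^i\<^esup>\<close>. It gives access to root counting and to comparison of coefficients.
\<close>

definition lin_poly :: "nat \<Rightarrow> 'a::field poly \<Rightarrow> 'a poly" where
  "lin_poly q r = (\<Sum>i\<le>Polynomial.degree r. Polynomial.monom (Polynomial.coeff r i) (q ^ i))"

lemma poly_lin_poly: "poly (lin_poly q r) x = teval q r x"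
  by (simp add: lin_poly_def teval_def poly_sum poly_monom)

lemma teval_alt:
  assumes "Polynomial.degree p \<le> n"
  shows "teval q p x = (\<Sum>i\<le>n. Polynomial.coeff p i * x ^ (q ^ i))"
  unfolding teval_def using assms by (intro sum.mono_neutral_left) (auto simp: coeff_eq_0)

lemma teval_0 [simp]: "teval q 0 x = 0"
  by (simp add: teval_def)

lemma teval_const [simp]: "teval q [:c:] x = c * x"
  by (simp add: teval_def)

lemma teval_add_poly: "teval q (p + r) x = teval q p x + teval q r x"
proof -
  define n where "n = max (Polynomial.degree p) (Polynomial.degree r)"
  have le: "Polynomial.degree p \<le> n" "Polynomial.degree r \<le> n" "Polynomial.degree (p + r) \<le> n"
    by (auto simp: n_def intro: degree_add_le_max)
  show ?thesis
    unfolding le[THEN teval_alt] by (simp add: sum.distrib distrib_right)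
qed

lemma teval_sum_poly: "teval q (\<Sum>i\<in>A. f i) x = (\<Sum>i\<in>A. teval q (f i) x)"
  by (induction A rule: infinite_finite_induct) (simp_all add: teval_add_poly)

lemma teval_smult: "teval q (Polynomial.smult c p) x = c * teval q p x"
  using teval_alt[OF degree_smult_le, of q c p x]
  by (simp add: teval_def sum_distrib_left mult.assoc)

lemma teval_monom: "teval q (Polynomial.monom c n) x = c * x ^ (q ^ n)"
proof -
  have "teval q (Polynomial.monom c n) x =
      (\<Sum>i\<le>n. Polynomial.coeff (Polynomial.monom c n) i * x ^ (q ^ i))"
    by (rule teval_alt) (simp add: degree_monom_le)
  also have "\<dots> = (\<Sum>i\<le>n. if i = n then c * x ^ (q ^ n) else 0)"
    by (rule sum.cong) auto
  finally show ?thesis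
    by simp
qed

context char_power
begin

lemma teval_add: "teval q p (x + y :: 'a) = teval q p x + teval q p y"
  by (simp add: teval_def frob_add distrib_left sum.distrib)

lemma teval_zero_right [simp]: "teval q p (0::'a) = 0"
  by (simp add: teval_def)

lemma teval_minus: "teval q p (- x :: 'a) = - teval q p x"
  by (simp add: teval_def frob_minus sum_negf)

lemma teval_sum: "teval q p (\<Sum>i\<in>A. f i :: 'a) = (\<Sum>i\<in>A. teval q p (f i))"
  by (induction A rule: infinite_finite_induct) (simp_all add: teval_add)

text \<open>
  The product of twisted polynomials is composition of functions. Together with
  \<open>teval_inject\<close> this reduces the ring axioms for \<^const>\<open>tmul\<close> to facts on functions.
\<close>

lemma teval_tmul: "teval q (tmul q p r) (x::'a) = teval q p (teval q r x)"
  by (simp add: tmul_def teval_sum_poly teval_monom teval_def[of q p] teval_def[of q r]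
      frob_sum sum_distrib_left power_mult_distrib power_add mult.assoc flip: power_mult)
    (simp add: mult_ac)

lemma coeff_lin_poly:
  "Polynomial.coeff (lin_poly q r) (q ^ n) = Polynomial.coeff r n"
proof -
  have "Polynomial.coeff (lin_poly q r) (q ^ n) =
      (\<Sum>i\<le>Polynomial.degree r. if i = n then Polynomial.coeff r i else 0)"
    unfolding lin_poly_def coeff_sum using q_gt_1 by (intro sum.cong) auto
  also have "\<dots> = Polynomial.coeff r n"
    by (auto simp: coeff_eq_0)
  finally show ?thesis .
qed

lemma teval_inject:
  assumes "infinite (UNIV :: 'a set)" and "\<And>x::'a. teval q p x = teval q r x"
  shows "p = r"
proof -
  have "lin_poly q p = lin_poly q r"
    using assms by (intro poly_eqI_infinite) (simp_all add: poly_lin_poly)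
  then show ?thesis
    by (metis coeff_lin_poly poly_eqI)
qed

lemma tmul_assoc:
  assumes "infinite (UNIV :: 'a set)"
  shows "tmul q (tmul q a b) (c :: 'a poly) = tmul q a (tmul q b c)"
  by (rule teval_inject[OF assms]) (simp add: teval_tmul)

lemma tmul_sum_right:
  assumes "infinite (UNIV :: 'a set)"
  shows "tmul q a (\<Sum>i\<in>A. f i :: 'a poly) = (\<Sum>i\<in>A. tmul q a (f i))"
  by (rule teval_inject[OF assms]) (simp add: teval_tmul teval_sum teval_sum_poly)

end

lemma tmul_0_left [simp]: "tmul q 0 r = 0"
  by (simp add: tmul_def)

lemma tmul_0_right [simp]: "q > 0 \<Longrightarrow> tmul q p 0 = 0"
  by (simp add: tmul_def zero_power)

lemma tmul_sum_left: "tmul q (\<Sum>i\<in>A. f i) r = (\<Sum>i\<in>A. tmul q (f i) r)"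
  by (induction A rule: infinite_finite_induct) (simp_all add: tmul_add_left)

section \<open>Additive polynomials in one variable\<close>

definition additive_poly :: "'a::field poly \<Rightarrow> bool" where
  "additive_poly P \<longleftrightarrow> (\<forall>x y. poly P (x + y) = poly P x + poly P y)"

lemma additive_poly_0 [simp]: "additive_poly 0"
  by (simp add: additive_poly_def)

lemma additive_poly_add: "additive_poly P \<Longrightarrow> additive_poly R \<Longrightarrow> additive_poly (P + R)"
  by (simp add: additive_poly_def)

lemma additive_poly_smult: "additive_poly P \<Longrightarrow> additive_poly (Polynomial.smult c P)"
  by (simp add: additive_poly_def distrib_left)

lemma additive_poly_diff: "additive_poly P \<Longrightarrow> additive_poly R \<Longrightarrow> additive_poly (P - R)"
  by (simp add: additive_poly_def)

lemma additive_poly_sum: "(\<And>i. i \<in> A \<Longrightarrow> additive_poly (f i)) \<Longrightarrow> additive_poly (\<Sum>i\<in>A. f i)"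
  by (induction A rule: infinite_finite_induct) (simp_all add: additive_poly_add)

lemma additive_poly_pcompose:
  "additive_poly P \<Longrightarrow> additive_poly R \<Longrightarrow> additive_poly (pcompose P R)"
  by (simp add: additive_poly_def poly_pcompose)

lemma (in char_power) additive_lin_poly: "additive_poly (lin_poly q (r :: 'a poly))"
  by (simp add: additive_poly_def poly_lin_poly teval_add)

lemma poly_additive_zero: "additive_poly P \<Longrightarrow> poly P 0 = 0"
  unfolding additive_poly_def by (metis add.right_neutral add_cancel_left_right)

lemma coeff_0_additive: "additive_poly P \<Longrightarrow> Polynomial.coeff P 0 = 0"
  using poly_additive_zero[of P] by (simp add: poly_0_coeff_0)

lemma poly_additive_sum:
  "additive_poly P \<Longrightarrow> poly P (\<Sum>i\<in>A. f i) = (\<Sum>i\<in>A. poly P (f i))"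
  by (induction A rule: infinite_finite_induct) (simp_all add: poly_additive_zero additive_poly_def)

text \<open>
  The derivative of an additive polynomial is invariant under all translations, hence constant;
  so \<open>k\<close> times the coefficient at \<open>k\<close> is zero for \<open>k > 1\<close>.
\<close>

lemma additive_poly_exponent:
  fixes P :: "'a::field poly"
  assumes inf: "infinite (UNIV :: 'a set)" and P: "additive_poly P"
    and k: "Polynomial.coeff P k \<noteq> 0" "k \<noteq> 1"
  shows "CHAR('a) dvd k"
proof (cases k)
  case (Suc l)
  have const: "poly (pderiv P) a = poly (pderiv P) 0" for a
  proof -
    have "pcompose P [:a, 1:] = P + [:poly P a:]"
      using P by (intro poly_eqI_infinite[OF inf])
        (simp add: poly_pcompose additive_poly_def add.commute)
    then have "pderiv (pcompose P [:a, 1:]) = pderiv (P + [:poly P a:])"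
      by simp
    then have "pcompose (pderiv P) [:a, 1:] = pderiv P"
      by (simp add: pderiv_pcompose pderiv_add pderiv_pCons)
    then show ?thesis
      by (metis poly_pcompose add.right_neutral mult_zero_left mult_zero_right poly_pCons poly_0)
  qed
  have "pderiv P = [:poly (pderiv P) 0:]"
    using const by (intro poly_eqI_infinite[OF inf]) simp
  then have "Polynomial.coeff (pderiv P) l = Polynomial.coeff [:poly (pderiv P) 0:] l"
    by simp
  also have "\<dots> = 0"
    using k(2) Suc by (simp add: coeff_pCons split: nat.split)
  finally have "of_nat k = (0::'a)"
    using k(1) Suc by (simp add: coeff_pderiv)
  then show ?thesis
    by (simp add: of_nat_eq_0_iff_char_dvd)
qed simp

text \<open>
  In a perfect field of characteristic \<open>p\<close> a polynomial in \<open>X\<^sup>p\<close> is the \<open>p\<close>-th power of the polynomial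
  whose coefficients are the \<open>p\<close>-th roots.
\<close>

lemma poly_char_root:
  fixes P :: "'a::alg_closed_field poly"
  assumes p: "Factorial_Ring.prime CHAR('a)" and dvd: "\<And>k. Polynomial.coeff P k \<noteq> 0 \<Longrightarrow> CHAR('a) dvd k"
  obtains R where "\<And>x. poly P x = poly R x ^ CHAR('a)"
    and "\<And>k. Polynomial.coeff R k ^ CHAR('a) = Polynomial.coeff P (CHAR('a) * k)"
proof -
  define p where "p = CHAR('a)"
  have p0: "p > 0"
    using p by (simp add: p_def prime_gt_0_nat)
  obtain r :: "'a \<Rightarrow> 'a" where r: "\<And>c. r c ^ p = c"
    using nth_root_exists[OF p0] by metis
  have r0: "r 0 = 0"
    using r[of 0] p0 by (simp)
  define n where "n = Polynomial.degree P"
  define R where "R = (\<Sum>k\<le>n. Polynomial.monom (r (Polynomial.coeff P (p * k))) k)"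
  have "Polynomial.coeff R k = r (Polynomial.coeff P (p * k))" for k
  proof (cases "k \<le> n")
    case True
    have "Polynomial.coeff R k = (\<Sum>i\<le>n. if i = k then r (Polynomial.coeff P (p * i)) else 0)"
      unfolding R_def coeff_sum by (intro sum.cong) auto
    with True show ?thesis
      by simp
  next
    case False
    then have "n < p * k"
      using p0 by (metis less_le_trans mult_le_mono1 nat_mult_1 not_le Suc_leI One_nat_def)
    then have "r (Polynomial.coeff P (p * k)) = 0"
      by (simp add: n_def coeff_eq_0 r0)
    moreover have "Polynomial.coeff R k = 0"
      unfolding R_def coeff_sum using False by (intro sum.neutral) auto
    ultimately show ?thesis
      by simp
  qed
  then have coeff: "Polynomial.coeff R k ^ p = Polynomial.coeff P (p * k)" for k
    by (simp add: r)
  have "poly P x = poly R x ^ p" for x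
  proof -
    have "poly P x = (\<Sum>i\<le>p * n. Polynomial.coeff P i * x ^ i)"
      unfolding poly_altdef using p0
      by (intro sum.mono_neutral_left) (auto simp: n_def coeff_eq_0)
    also have "\<dots> = (\<Sum>i\<in>(*) p ` {..n}. Polynomial.coeff P i * x ^ i)"
    proof (intro sum.mono_neutral_right ballI)
      fix i assume i: "i \<in> {..p * n} - (*) p ` {..n}"
      have "\<not> p dvd i"
        using i p0 by (auto elim!: dvdE)
      then show "Polynomial.coeff P i * x ^ i = 0"
        using dvd[of i] by (auto simp: p_def)
    qed auto
    also have "\<dots> = (\<Sum>k\<le>n. (r (Polynomial.coeff P (p * k)) * x ^ k) ^ p)"
      using p0 by (subst sum.reindex)
        (auto simp: inj_on_def r power_mult_distrib mult.commute[of p] simp flip: power_mult)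
    also have "\<dots> = poly R x ^ p"
      unfolding R_def poly_sum poly_monom p_def by (rule freshmans_dream_sum[OF p refl, symmetric])
    finally show ?thesis .
  qed
  with coeff show ?thesis
    using that[of R] by (simp add: p_def)
qed

lemma frob_inject:
  assumes "Factorial_Ring.prime CHAR('a::field)" and "(x::'a) ^ CHAR('a) = y ^ CHAR('a)"
  shows "x = y"
proof -
  have "(x - y) ^ CHAR('a) + y ^ CHAR('a) = x ^ CHAR('a)"
    using freshmans_dream[OF assms(1) refl, of "x - y" y] by simp
  with assms(2) show ?thesis
    by simp
qed

lemma additive_poly_root:
  fixes P :: "'a::alg_closed_field poly"
  assumes p: "Factorial_Ring.prime CHAR('a)" and P: "additive_poly P" "Polynomial.coeff P 1 = 0"
  obtains R where "additive_poly R" and "\<And>x. poly P x = poly R x ^ CHAR('a)"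
    and "\<And>k. Polynomial.coeff R k ^ CHAR('a) = Polynomial.coeff P (CHAR('a) * k)"
proof -
  have "CHAR('a) dvd k" if "Polynomial.coeff P k \<noteq> 0" for k
    using additive_poly_exponent[OF infinite_alg_closed_field P(1) that] P(2) that by metis
  then obtain R where R: "\<And>x. poly P x = poly R x ^ CHAR('a)"
    "\<And>k. Polynomial.coeff R k ^ CHAR('a) = Polynomial.coeff P (CHAR('a) * k)"
    using poly_char_root[OF p] by blast
  have "additive_poly R"
    unfolding additive_poly_def
  proof (intro allI)
    fix x y
    have "poly R (x + y) ^ CHAR('a) = (poly R x + poly R y) ^ CHAR('a)"
      using P(1) by (simp add: additive_poly_def freshmans_dream[OF p refl] flip: R(1))
    then show "poly R (x + y) = poly R x + poly R y"
      by (rule frob_inject[OF p])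
  qed
  with R show ?thesis
    using that by blast
qed

text \<open>
  Remove the linear term: by \<open>additive_poly_root\<close> what remains is the \<open>p\<close>-th power of an additive
  polynomial of smaller degree.
\<close>

lemma additive_poly_exponent_power:
  fixes P :: "'a::alg_closed_field poly"
  assumes p: "Factorial_Ring.prime CHAR('a)" and P: "additive_poly P" and k: "Polynomial.coeff P k \<noteq> 0"
  shows "\<exists>i. k = CHAR('a) ^ i"
  using P k
proof (induction k arbitrary: P rule: less_induct)
  case (less k)
  show ?case
  proof (cases "k = 1")
    case True
    then show ?thesis
      by (intro exI[of _ 0]) simp
  next
    case False
    obtain l where l: "k = CHAR('a) * l"
      using additive_poly_exponent[OF infinite_alg_closed_field less.prems False] by auto
    define S where "S = P - Polynomial.monom (Polynomial.coeff P 1) 1"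
    have "additive_poly S" "Polynomial.coeff S 1 = 0"
      using less.prems(1) by (simp_all add: S_def additive_poly_def poly_monom algebra_simps)
    then obtain R where R: "additive_poly R"
      "\<And>k. Polynomial.coeff R k ^ CHAR('a) = Polynomial.coeff S (CHAR('a) * k)"
      using additive_poly_root[OF p] by metis
    have "Polynomial.coeff S k \<noteq> 0"
      using less.prems(2) False by (simp add: S_def)
    then have "Polynomial.coeff R l \<noteq> 0"
      using R(2)[of l] p by (auto simp: l power_0_left)
    moreover have "k \<noteq> 0"
      using less.prems coeff_0_additive by metis
    then have "l < k"
      using l prime_gt_1_nat[OF p] by simp
    ultimately obtain i where "l = CHAR('a) ^ i"
      using less.IH R(1) by blast
    then show ?thesis
      using l by (intro exI[of _ "Suc i"]) simp
  qed
qed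

text \<open>
  An additive polynomial may contain all exponents \<open>p\<^sup>i\<close>. This keeps those that are powers of \<open>q\<close> and
  reads the result as a twisted polynomial, so it is a left inverse of \<^const>\<open>lin_poly\<close>.
\<close>

definition q_part :: "nat \<Rightarrow> 'a::field poly \<Rightarrow> 'a poly" where
  "q_part q P = (\<Sum>n\<le>Polynomial.degree P. Polynomial.monom (Polynomial.coeff P (q ^ n)) n)"

lemma coeff_q_part:
  assumes "1 < q"
  shows "Polynomial.coeff (q_part q P) n = Polynomial.coeff P (q ^ n)"
proof -
  have "Polynomial.coeff (q_part q P) n =
      (\<Sum>i\<le>Polynomial.degree P. if i = n then Polynomial.coeff P (q ^ i) else 0)"
    unfolding q_part_def coeff_sum by (intro sum.cong) auto
  also have "\<dots> = Polynomial.coeff P (q ^ n)"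
    using less_trans[OF _ power_gt_expt[of q n]] assms
    by (auto intro!: coeff_eq_0 simp: not_le)
  finally show ?thesis .
qed

section \<open>Zariski closed subgroups of affine space\<close>

lemma polyfun_translate: "polyfun f \<Longrightarrow> polyfun (\<lambda>x. f (x + a))"
proof (induction rule: polyfun.induct)
  case (polyfun_coord i)
  have "polyfun (\<lambda>x. x $ i + a $ i)"
    by (intro polyfun.intros)
  then show ?case
    by simp
qed (auto intro: polyfun.intros)

lemma polyfun_diff:
  assumes "polyfun f" "polyfun g"
  shows "polyfun (\<lambda>x. f x - g x)"
proof -
  have "polyfun (\<lambda>x. f x + (- 1) * g x)"
    by (intro polyfun_add polyfun_mult polyfun_const assms)
  then show ?thesis
    by simp
qed

lemma polyfun_sum: "(\<And>i. i \<in> A \<Longrightarrow> polyfun (f i)) \<Longrightarrow> polyfun (\<lambda>x. \<Sum>i\<in>A. f i x)"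
  by (induction A rule: infinite_finite_induct) (auto intro: polyfun.intros)

lemma polyfun_power: "polyfun f \<Longrightarrow> polyfun (\<lambda>x. f x ^ n)"
  by (induction n) (auto intro: polyfun.intros)

lemma polyfun_teval: "polyfun (\<lambda>x. teval q p (x $ i))"
  unfolding teval_def by (intro polyfun_sum polyfun_mult polyfun_const polyfun_power polyfun_coord)

lemma polyfun_on_line:
  fixes a b :: "'a::field^'n"
  assumes "polyfun f"
  shows "\<exists>P. \<forall>s. f (a + s *s b) = poly P s"
  using assms
proof (induction rule: polyfun.induct)
  case (polyfun_const c)
  show ?case
    by (rule exI[of _ "[:c:]"]) simp
next
  case (polyfun_coord i)
  show ?case
    by (rule exI[of _ "[:a $ i, b $ i:]"]) simp
next
  case (polyfun_add f g)
  then show ?case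
    by (metis poly_add)
next
  case (polyfun_mult f g)
  then show ?case
    by (metis poly_mult)
qed

text \<open>
  Degree measured by iterated differences instead of monomials. Additive functions have degree at
  most one here whatever their degree as polynomials, which is why this is the degree to minimise when
  looking for additive equations.
\<close>

primrec diff_degree :: "nat \<Rightarrow> ('v::ab_group_add \<Rightarrow> 'a::comm_ring_1) \<Rightarrow> bool" where
  "diff_degree 0 f \<longleftrightarrow> (\<forall>x y. f x = f y)"
| "diff_degree (Suc k) f \<longleftrightarrow> (\<forall>a. diff_degree k (\<lambda>x. f (x + a) - f x))"

lemma diff_degree_const: "diff_degree k (\<lambda>x. c)"
  by (induction k arbitrary: c) auto

lemma diff_degree_Suc: "diff_degree k f \<Longrightarrow> diff_degree (Suc k) f"
proof (induction k arbitrary: f)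
  case 0
  then have "(\<lambda>x. f (x + a) - f x) = (\<lambda>x. 0)" for a
    by (metis cancel_comm_monoid_add_class.diff_cancel diff_degree.simps(1))
  then show ?case
    by simp
next
  case (Suc k)
  then show ?case
    by (metis diff_degree.simps(2))
qed

lemma diff_degree_mono: "k \<le> l \<Longrightarrow> diff_degree k f \<Longrightarrow> diff_degree l f"
  by (induction l rule: dec_induct) (auto simp: diff_degree_Suc simp del: diff_degree.simps)

lemma diff_degree_translate: "diff_degree k f \<Longrightarrow> diff_degree k (\<lambda>x. f (x + b))"
proof (induction k arbitrary: f)
  case (Suc k)
  have "diff_degree k (\<lambda>x. f (x + b + a) - f (x + b))" for a
    using Suc.IH[of "\<lambda>x. f (x + a) - f x"] Suc.prems by simp
  then show ?case
    by (simp add: add_ac)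
qed simp

lemma diff_degree_add:
  "diff_degree k f \<Longrightarrow> diff_degree k g \<Longrightarrow> diff_degree k (\<lambda>x. f x + g x)"
proof (induction k arbitrary: f g)
  case (Suc k)
  have "diff_degree k (\<lambda>x. (f (x + a) - f x) + (g (x + a) - g x))" for a
    using Suc.prems by (intro Suc.IH) simp_all
  then show ?case
    by (simp add: algebra_simps)
next
  case 0
  then have "f x + g x = f y + g y" for x y
    unfolding diff_degree.simps by (intro arg_cong2[where f = "(+)"]) (rule spec, erule spec)+
  then show ?case
    by simp
qed

text \<open>
  The discrete Leibniz rule
  \<open>(fg)(x + a) - (fg)(x) = (f(x + a) - f(x)) g(x + a) + f(x) (g(x + a) - g(x))\<close>.
\<close>

lemma diff_degree_mult:
  "diff_degree k f \<Longrightarrow> diff_degree l g \<Longrightarrow> diff_degree (k + l) (\<lambda>x. f x * g x)"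
proof (induction "k + l" arbitrary: k l f g)
  case 0
  then show ?case
    by simp metis
next
  case (Suc n)
  have "diff_degree n (\<lambda>x. f (x + a) * g (x + a) - f x * g x)" for a
  proof -
    have "diff_degree n (\<lambda>x. (f (x + a) - f x) * g (x + a))"
    proof (cases k)
      case 0
      then have "(\<lambda>x. (f (x + a) - f x) * g (x + a)) = (\<lambda>x. 0)"
        using Suc.prems(1) by (auto simp: fun_eq_iff) (metis right_minus_eq mult_zero_left)
      then show ?thesis
        by (simp add: diff_degree_const)
    next
      case (Suc k')
      then show ?thesis
        using Suc.prems \<open>Suc n = k + l\<close> Suc.hyps(1)[of k' l]
        by (auto intro!: Suc.hyps(1)[of k' l, simplified] diff_degree_translate)
    qed
    moreover have "diff_degree n (\<lambda>x. f x * (g (x + a) - g x))"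
    proof (cases l)
      case 0
      then have "(\<lambda>x. f x * (g (x + a) - g x)) = (\<lambda>x. 0)"
        using Suc.prems(2) by (auto simp: fun_eq_iff) (metis right_minus_eq mult_zero_right)
      then show ?thesis
        by (simp add: diff_degree_const)
    next
      case (Suc l')
      then show ?thesis
        using Suc.prems \<open>Suc n = k + l\<close>
        by (auto intro!: Suc.hyps(1)[of k l', simplified])
    qed
    ultimately have "diff_degree n
        (\<lambda>x. (f (x + a) - f x) * g (x + a) + f x * (g (x + a) - g x))"
      by (rule diff_degree_add)
    then show ?thesis
      by (simp add: algebra_simps)
  qed
  then show ?case
    by (simp flip: Suc.hyps(2))
qed

lemma polyfun_diff_degree: "polyfun f \<Longrightarrow> \<exists>k. diff_degree k f"
proof (induction rule: polyfun.induct)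
  case (polyfun_const c)
  show ?case
    by (rule exI[of _ 0]) simp
next
  case (polyfun_coord i)
  show ?case
    by (rule exI[of _ 1]) simp
next
  case (polyfun_add f g)
  then obtain k l where kl: "diff_degree k f" "diff_degree l g"
    by blast
  have "diff_degree (max k l) f" "diff_degree (max k l) g"
    by (rule diff_degree_mono[OF _ kl(1)], simp) (rule diff_degree_mono[OF _ kl(2)], simp)
  then show ?case
    by (intro exI[of _ "max k l"] diff_degree_add)
next
  case (polyfun_mult f g)
  then obtain k l where "diff_degree k f" "diff_degree l g"
    by blast
  then show ?case
    by (intro exI[of _ "k + l"] diff_degree_mult)
qed

lemma closedin_zariski_iff:
  "closedin zariski (Y :: ('a::field^'n) set) \<longleftrightarrow>
     (\<exists>F. (\<forall>f\<in>F. polyfun f) \<and> Y = {x. \<forall>f\<in>F. f x = 0})"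
proof -
  have "closedin zariski Y \<longleftrightarrow> zariski_open (- Y)"
    by (simp add: closedin_def topspace_zariski openin_zariski Compl_eq_Diff_UNIV)
  then show ?thesis
    by (simp add: zariski_open_def)
qed

text \<open>
  Take an equation \<open>f \<noteq> 0\<close> of \<open>Y\<close> of minimal difference degree. For \<open>y \<in> Y\<close> the difference
  \<open>f(x + y) - f(x)\<close> is an equation of smaller degree, hence zero; so \<open>f\<close> is invariant under \<open>Y\<close>. Then,
  for any \<open>a\<close>, the function \<open>f(x + a) - f(x) - f(a)\<close> of \<open>x\<close> vanishes on \<open>Y\<close> and has smaller degree,
  so it is zero as well.
\<close>

lemma proper_closed_subgroup_additive_equation:
  fixes Y :: "('a::field^'n) set"
  assumes closed: "closedin zariski Y" and proper: "Y \<noteq> UNIV"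
    and zero: "0 \<in> Y" and add: "\<And>x y. x \<in> Y \<Longrightarrow> y \<in> Y \<Longrightarrow> x + y \<in> Y"
  obtains f where "polyfun f" and "\<And>x y. f (x + y) = f x + f y"
    and "\<And>y. y \<in> Y \<Longrightarrow> f y = 0" and "\<exists>x. f x \<noteq> 0"
proof -
  define eqn where "eqn f \<longleftrightarrow> polyfun f \<and> (\<forall>y\<in>Y. f y = 0) \<and> (\<exists>x. f x \<noteq> 0)" for f
  define Q where "Q k \<longleftrightarrow> (\<exists>f. eqn f \<and> diff_degree k f)" for k
  obtain F where F: "\<forall>f\<in>F. polyfun f" "Y = {x. \<forall>f\<in>F. f x = 0}"
    using closed by (auto simp: closedin_zariski_iff)
  then obtain f0 where "eqn f0"
    using proper by (auto simp: eqn_def)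
  moreover from this obtain k0 where "diff_degree k0 f0"
    using polyfun_diff_degree unfolding eqn_def by blast
  ultimately have "Q k0"
    by (auto simp: Q_def)
  define k where "k = (LEAST k. Q k)"
  have "Q k"
    unfolding k_def using \<open>Q k0\<close> by (rule LeastI)
  then obtain f where f: "polyfun f" "\<And>y. y \<in> Y \<Longrightarrow> f y = 0" "\<exists>x. f x \<noteq> 0" "diff_degree k f"
    by (auto simp: Q_def eqn_def)
  have "k \<noteq> 0"
  proof
    assume "k = 0"
    then have "f x = f 0" for x
      using f(4) by simp
    then show False
      using f(2)[OF zero] f(3) by simp
  qed
  then obtain m where m: "k = Suc m"
    by (cases k) auto
  have minimal: "g x = 0" if "polyfun g" "\<And>y. y \<in> Y \<Longrightarrow> g y = 0" "diff_degree m g" for g x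
  proof (rule ccontr)
    assume "g x \<noteq> 0"
    with that have "Q m"
      by (auto simp: Q_def eqn_def)
    then have "k \<le> m"
      unfolding k_def by (rule Least_le)
    with m show False
      by simp
  qed
  have diff: "diff_degree m (\<lambda>x. f (x + a) - f x)" for a
    using f(4) m by simp
  have translate: "polyfun (\<lambda>x. f (x + a))" for a
    by (rule polyfun_translate[OF f(1)])
  have periodic: "f (x + y) = f x" if "y \<in> Y" for x y
  proof -
    have "f (x + y) - f x = 0"
    proof (rule minimal[of "\<lambda>x. f (x + y) - f x"])
      show "polyfun (\<lambda>x. f (x + y) - f x)"
        by (rule polyfun_diff[OF translate f(1)])
      show "f (z + y) - f z = 0" if "z \<in> Y" for z
        using f(2) add[OF that \<open>y \<in> Y\<close>] that by simp
    qed (rule diff)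
    then show ?thesis
      by simp
  qed
  have "f (x + a) = f x + f a" for x a
  proof -
    have "f (x + a) - f x - f a = 0"
    proof (rule minimal[of "\<lambda>x. f (x + a) - f x - f a"])
      show "polyfun (\<lambda>x. f (x + a) - f x - f a)"
        by (rule polyfun_diff[OF polyfun_diff[OF translate f(1)] polyfun_const])
      show "f (y + a) - f y - f a = 0" if "y \<in> Y" for y
        using periodic[OF that, of a] f(2)[OF that] by (simp add: add.commute)
      have "diff_degree m (\<lambda>x. (f (x + a) - f x) + (- f a))"
        by (rule diff_degree_add[OF diff diff_degree_const])
      then show "diff_degree m (\<lambda>x. f (x + a) - f x - f a)"
        by simp
    qed
    then show ?thesis
      by (simp add: algebra_simps)
  qed
  with f show ?thesis
    using that[of f] by blast
qed

lemma additive_polyfun_split: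
  fixes f :: "'a::field^'n \<Rightarrow> 'a"
  assumes "polyfun f" and add: "\<And>x y. f (x + y) = f x + f y"
  obtains P :: "'n \<Rightarrow> 'a poly" where "\<And>s. additive_poly (P s)"
    and "\<And>x. f x = (\<Sum>s\<in>UNIV. poly (P s) (x $ s))"
proof -
  have "\<forall>s. \<exists>P. \<forall>x. f (0 + x *s axis s 1) = poly P x"
    using polyfun_on_line[OF assms(1)] by blast
  then obtain P where P: "\<And>s x. f (x *s axis s 1) = poly (P s) x"
    by (metis add_0)
  have f0: "f 0 = 0"
    using add[of 0 0] by (metis add.right_neutral add_cancel_left_right)
  have sum: "f (\<Sum>s\<in>A. g s) = (\<Sum>s\<in>A. f (g s))" for A :: "'n set" and g
    by (induction A rule: infinite_finite_induct) (simp_all add: f0 add)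
  have "additive_poly (P s)" for s
    unfolding additive_poly_def by (simp add: vector_sadd_rdistrib add flip: P)
  moreover have "f x = (\<Sum>s\<in>UNIV. poly (P s) (x $ s))" for x
  proof -
    have "f (\<Sum>s\<in>UNIV. (x $ s) *s axis s 1) = (\<Sum>s\<in>UNIV. poly (P s) (x $ s))"
      by (simp add: sum P)
    then show ?thesis
      by (simp add: basis_expansion)
  qed
  ultimately show ?thesis
    using that by blast
qed

section \<open>Nilpotent matrices acting on rows\<close>

lemma sum_UNIV_Plus:
  "(\<Sum>s\<in>(UNIV :: ('d::finite + 'j::finite) set). f s) = (\<Sum>k\<in>UNIV. f (Inl k)) + (\<Sum>i\<in>UNIV. f (Inr i))"
  by (subst UNIV_Plus_UNIV[symmetric], subst sum.Plus) simp_all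

lemma vector_matrix_mult_diff_mat:
  fixes v :: "'a::field^'n"
  shows "v v* (N - mat \<mu>) = (v v* N) - (\<mu> *s v)"
proof -
  have "(\<Sum>i\<in>UNIV. v $ i * (N - mat \<mu>) $ i $ k) =
      (\<Sum>i\<in>UNIV. v $ i * N $ i $ k - (if i = k then \<mu> * v $ i else 0))" for k
    by (rule sum.cong) (auto simp: mat_def algebra_simps)
  then show ?thesis
    by (simp add: vec_eq_iff vector_matrix_mult_def sum_subtractf)
qed

lemma nilpotent_rows:
  fixes N :: "'a::field^'d^'d"
  assumes "(((**) N) ^^ m) (mat 1) = 0"
  shows "((\<lambda>v. v v* N) ^^ m) v = 0"
proof -
  have "v v* ((((**) N) ^^ k) (mat 1)) = ((\<lambda>v. v v* N) ^^ k) v" for k v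
  proof (induction k arbitrary: v)
    case (Suc k)
    have "v v* (N ** (((**) N) ^^ k) (mat 1)) = ((\<lambda>v. v v* N) ^^ k) (v v* N)"
      by (simp only: Suc flip: vector_matrix_mul_assoc)
    then show ?case
      by (simp add: funpow_swap1[of "\<lambda>v. v v* N"])
  qed simp
  from this[of v m] show ?thesis
    by (simp add: assms)
qed

lemma nilpotent_mat_eigenrow:
  fixes v :: "'a::field^'n"
  assumes "nilpotent_mat N" and "v v* N = c *s v" and "c \<noteq> 0"
  shows "v = 0"
proof -
  obtain m where "((\<lambda>v. v v* N) ^^ m) v = 0"
    using assms(1) nilpotent_rows unfolding nilpotent_mat_def by blast
  moreover have "((\<lambda>v. v v* N) ^^ k) v = c ^ k *s v" for k
    by (induction k) (simp_all add: assms(2) scalar_vector_matrix_assoc)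
  ultimately show ?thesis
    using assms(3) by simp
qed

text \<open>
  Used for a field embedding followed by a power of Frobenius: the exponent that annihilates a
  nilpotent matrix also annihilates all its Frobenius twists.
\<close>

lemma map_matrix_power:
  fixes N :: "'a::field^'d^'d" and h :: "'a \<Rightarrow> 'b::field"
  assumes h: "h 0 = 0" "h 1 = 1" "\<And>x y. h (x + y) = h x + h y" "\<And>x y. h (x * y) = h x * h y"
  shows "(((**) (\<chi> k l. h (N $ k $ l))) ^^ m) (mat 1) = (\<chi> k l. h ((((**) N) ^^ m) (mat 1) $ k $ l))"
proof (induction m)
  case 0
  show ?case
    by (simp add: mat_def vec_eq_iff h)
next
  case (Suc m)
  have h_sum: "h (sum f S) = (\<Sum>i\<in>S. h (f i))" for f :: "'d \<Rightarrow> 'a" and S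
    by (induction S rule: infinite_finite_induct) (simp_all add: h)
  have "(\<chi> k l. h (N $ k $ l)) ** (\<chi> k l. h (R $ k $ l)) = (\<chi> k l. h ((N ** R) $ k $ l))" for R :: "'a^'d^'d"
    by (simp add: matrix_matrix_mult_def vec_eq_iff h_sum h)
  then show ?case
    by (simp only: funpow.simps o_apply Suc)
qed

text \<open>
  A truncated Neumann series. When the \<open>m\<close>-th iterate of \<open>b\<close> under a nilpotent \<open>M\<close> vanishes, it
  solves \<open>c (s + M) = b\<close>.
\<close>

lemma row_resolvent:
  fixes b :: "'a::field^'n" and M :: "'a^'n^'n"
  assumes "s \<noteq> 0"
  defines "it \<equiv> \<lambda>k. ((\<lambda>v. v v* M) ^^ k) b"
  defines "C \<equiv> \<lambda>m. \<Sum>k<m. ((- 1) ^ k * inverse s ^ Suc k) *s it k"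
  shows "(s *s C m) + (C m v* M) = b - ((- 1) ^ m * inverse s ^ m) *s it m"
proof (induction m)
  case 0
  show ?case
    by (simp add: C_def it_def)
next
  case (Suc m)
  define r where "r = (- 1) ^ m * inverse s ^ Suc m"
  have "(s *s C (Suc m)) + (C (Suc m) v* M) = ((s *s C m) + (C m v* M)) + ((s *s (r *s it m)) + ((r *s it m) v* M))"
    by (simp add: C_def r_def vector_matrix_left_distrib vector_add_ldistrib)
  also have "(r *s it m) v* M = r *s it (Suc m)"
    by (simp add: it_def scalar_vector_matrix_assoc)
  also have "s *s (r *s it m) = ((- 1) ^ m * inverse s ^ m) *s it m"
    using assms(1) by (simp add: r_def vector_smult_assoc)
  also have "r = - ((- 1) ^ Suc m * inverse s ^ Suc m)"
    by (simp add: r_def)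
  finally show ?case
    unfolding Suc by (simp add: vec_eq_iff)
qed

section \<open>A proper sub-module gives a relation between biderivations\<close>

lemma (in char_power) coeff_tmul:
  "Polynomial.coeff (tmul q U (r :: 'a poly)) n =
     (\<Sum>j\<le>Polynomial.degree r.
        if j \<le> n then Polynomial.coeff U (n - j) * Polynomial.coeff r j ^ (q ^ (n - j)) else 0)"
proof -
  let ?f = "\<lambda>i j. Polynomial.coeff U i * Polynomial.coeff r j ^ (q ^ i)"
  have "Polynomial.coeff (tmul q U r) n =
      (\<Sum>i\<le>Polynomial.degree U. \<Sum>j\<le>Polynomial.degree r. if i + j = n then ?f i j else 0)"
    unfolding tmul_def coeff_sum coeff_monom ..
  also have "\<dots> = (\<Sum>j\<le>Polynomial.degree r. \<Sum>i\<le>Polynomial.degree U. if i + j = n then ?f i j else 0)"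
    by (rule sum.swap)
  also have "\<dots> = (\<Sum>j\<le>Polynomial.degree r. if j \<le> n then ?f (n - j) j else 0)"
  proof (rule sum.cong[OF refl])
    fix j
    have "(\<Sum>i\<le>Polynomial.degree U. if i + j = n then ?f i j else 0) =
        (\<Sum>i\<le>Polynomial.degree U. if i = n - j then (if j \<le> n then ?f i j else 0) else 0)"
      by (rule sum.cong) auto
    also have "\<dots> = (if j \<le> n then ?f (n - j) j else 0)"
      by (auto simp: coeff_eq_0)
    finally show "(\<Sum>i\<le>Polynomial.degree U. if i + j = n then ?f i j else 0) =
        (if j \<le> n then ?f (n - j) j else 0)" .
  qed
  finally show ?thesis .
qed

text \<open>
  An exponent \<open>k = p\<^sup>i\<close> of \<open>P\<close> and an exponent \<open>q\<^sup>j\<close> of \<open>lin_poly q r\<close> contribute to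
  \<open>X\<^bsup>k q^j\<^esup>\<close>. This is a power \<open>q\<^sup>n\<close> only if \<open>k\<close> is itself a power of \<open>q\<close>, so the terms of \<open>P\<close>
  outside its \<open>q\<close>-part do not interfere.
\<close>

lemma coeff_pcompose_lin_poly:
  fixes P r :: "'a::alg_closed_field poly"
  assumes "char_power TYPE('a) q" and P: "additive_poly P"
  shows "Polynomial.coeff (pcompose P (lin_poly q r)) (q ^ n) =
    Polynomial.coeff (tmul q (q_part q P) r) n"
proof -
  interpret char_power q "TYPE('a)" by fact
  define c where "c = Polynomial.coeff P"
  define b where "b = Polynomial.coeff r"
  define W where "W = (\<Sum>k\<le>Polynomial.degree P. \<Sum>j\<le>Polynomial.degree r.
      Polynomial.monom (c k * b j ^ k) (k * q ^ j))"
  have "pcompose P (lin_poly q r) = W"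
  proof (rule poly_eqI_infinite[OF infinite_alg_closed_field])
    fix x
    have mon: "c k * b j ^ k * x ^ (k * q ^ j) = c k * (b j * x ^ (q ^ j)) ^ k" for k j
      by (metis mult.assoc mult.commute power_mult power_mult_distrib)
    have "poly W x = (\<Sum>k\<le>Polynomial.degree P. c k * (\<Sum>j\<le>Polynomial.degree r. (b j * x ^ (q ^ j)) ^ k))"
      unfolding W_def poly_sum poly_monom sum_distrib_left mon ..
    also have "\<dots> = (\<Sum>k\<le>Polynomial.degree P. c k * (\<Sum>j\<le>Polynomial.degree r. b j * x ^ (q ^ j)) ^ k)"
    proof (rule sum.cong[OF refl])
      fix k
      show "c k * (\<Sum>j\<le>Polynomial.degree r. (b j * x ^ (q ^ j)) ^ k) =
          c k * (\<Sum>j\<le>Polynomial.degree r. b j * x ^ (q ^ j)) ^ k"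
      proof (cases "c k = 0")
        case False
        then obtain i where "k = CHAR('a) ^ i"
          using additive_poly_exponent_power[OF prime_char P] by (auto simp: c_def)
        then show ?thesis
          by (simp add: freshmans_dream_sum'[OF prime_char])
      qed simp
    qed
    also have "\<dots> = poly (pcompose P (lin_poly q r)) x"
      by (simp add: poly_pcompose poly_lin_poly teval_def poly_altdef[of P] c_def b_def)
    finally show "poly (pcompose P (lin_poly q r)) x = poly W x"
      by simp
  qed
  then have "Polynomial.coeff (pcompose P (lin_poly q r)) (q ^ n) =
      (\<Sum>k\<le>Polynomial.degree P. \<Sum>j\<le>Polynomial.degree r.
         if k * q ^ j = q ^ n then c k * b j ^ k else 0)"
    by (simp add: W_def coeff_sum)
  also have "\<dots> = (\<Sum>j\<le>Polynomial.degree r. \<Sum>k\<le>Polynomial.degree P.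
         if k * q ^ j = q ^ n then c k * b j ^ k else 0)"
    by (rule sum.swap)
  also have "\<dots> = (\<Sum>j\<le>Polynomial.degree r.
         if j \<le> n then c (q ^ (n - j)) * b j ^ (q ^ (n - j)) else 0)"
  proof (rule sum.cong[OF refl])
    fix j
    have iff: "k * q ^ j = q ^ n \<longleftrightarrow> j \<le> n \<and> k = q ^ (n - j)" for k
    proof
      assume k: "k * q ^ j = q ^ n"
      then have "q ^ j dvd q ^ n"
        by (metis dvd_triv_right)
      then have "j \<le> n"
        using q_gt_1 by (metis dvd_imp_le power_increasing_iff zero_less_power gr_implies_not0 not_gr_zero)
      moreover from this have "q ^ n = q ^ (n - j) * q ^ j"
        by (simp flip: power_add)
      ultimately show "j \<le> n \<and> k = q ^ (n - j)"
        using k q_gt_1 by simp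
    qed (simp flip: power_add)
    have "(\<Sum>k\<le>Polynomial.degree P. if k * q ^ j = q ^ n then c k * b j ^ k else 0) =
        (\<Sum>k\<le>Polynomial.degree P. if k = q ^ (n - j) then (if j \<le> n then c k * b j ^ k else 0) else 0)"
      by (rule sum.cong) (auto simp: iff)
    also have "\<dots> = (if j \<le> n then c (q ^ (n - j)) * b j ^ (q ^ (n - j)) else 0)"
      by (auto simp: c_def coeff_eq_0)
    finally show "(\<Sum>k\<le>Polynomial.degree P. if k * q ^ j = q ^ n then c k * b j ^ k else 0) =
        (if j \<le> n then c (q ^ (n - j)) * b j ^ (q ^ (n - j)) else 0)" .
  qed
  also have "\<dots> = Polynomial.coeff (tmul q (q_part q P) r) n"
    unfolding coeff_tmul coeff_q_part[OF q_gt_1] c_def b_def ..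
  finally show ?thesis .
qed

lemma coeff_1_pcompose:
  fixes P R :: "'a::field poly"
  shows "Polynomial.coeff R 0 = 0 \<Longrightarrow>
     Polynomial.coeff (pcompose P R) 1 = Polynomial.coeff P 1 * Polynomial.coeff R (1 :: nat)"
proof -
  have *: "Polynomial.coeff p 1 = poly (pderiv p) 0" for p :: "'a poly"
    by (simp add: poly_0_coeff_0 coeff_pderiv)
  assume "Polynomial.coeff R 0 = 0"
  then have "poly R 0 = 0"
    by (simp add: poly_0_coeff_0)
  then show ?thesis
    unfolding * pderiv_pcompose poly_mult poly_pcompose by simp
qed

text \<open>
  A family of one-variable polynomials, one for each coordinate, stands for the function
  \<open>v \<mapsto> \<Sum>\<^sub>s P\<^sub>s(v\<^sub>s)\<close>; every additive polynomial function has this form by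
  \<open>additive_polyfun_split\<close>.
\<close>

definition eval_row :: "('n::finite \<Rightarrow> 'a::field poly) \<Rightarrow> 'a^'n \<Rightarrow> 'a" where
  "eval_row P v = (\<Sum>s\<in>UNIV. poly (P s) (v $ s))"

definition pull_back ::
  "nat \<Rightarrow> 'a::field poly^'n^'m \<Rightarrow> ('m::finite \<Rightarrow> 'a poly) \<Rightarrow> 'n \<Rightarrow> 'a poly" where
  "pull_back q M P s = (\<Sum>r\<in>UNIV. pcompose (P r) (lin_poly q (M $ r $ s)))"

lemma eval_pull_back:
  assumes "\<And>r. additive_poly (P r)"
  shows "eval_row (pull_back q M P) v = eval_row P (tmat_act q M v)"
proof -
  have "eval_row (pull_back q M P) v =
      (\<Sum>s\<in>UNIV. \<Sum>r\<in>UNIV. poly (P r) (teval q (M $ r $ s) (v $ s)))"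
    by (simp add: eval_row_def pull_back_def poly_sum poly_pcompose poly_lin_poly)
  also have "\<dots> = (\<Sum>r\<in>UNIV. \<Sum>s\<in>UNIV. poly (P r) (teval q (M $ r $ s) (v $ s)))"
    by (rule sum.swap)
  also have "\<dots> = eval_row P (tmat_act q M v)"
    by (simp add: eval_row_def tmat_act_def poly_additive_sum assms)
  finally show ?thesis .
qed

lemma (in char_power) additive_pull_back:
  "(\<And>r. additive_poly (P r)) \<Longrightarrow> additive_poly (pull_back q (M :: 'a poly^'n^'m) P s)"
  unfolding pull_back_def by (intro additive_poly_sum additive_poly_pcompose additive_lin_poly) simp

text \<open>
  Here \<open>A\<close>, \<open>D\<close>, \<open>B\<close> are \<open>\<Phi>(t)\<close>, \<open>\<delta>(t)\<close>, \<open>\<Psi>(t)\<close>. The families in \<open>ann\<close> are the additive equations of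
  \<open>Y\<close>, and \<open>M\<close> is the least degree in the last \<open>j\<close> coordinates that a nonzero one can have.
\<close>

lemma proper_submodule_relation:
  fixes \<theta> :: "'a::alg_closed_field"
    and A :: "'a poly^'d^'d" and D :: "'j::finite \<Rightarrow> 'a poly^'d" and B :: "'a poly^('d + 'j)^('d + 'j)"
  assumes q: "char_power TYPE('a) q"
    and \<theta>: "\<And>m n. \<theta> ^ m = \<theta> ^ n \<Longrightarrow> m = n"
    and nil: "nilpotent_mat (d_mat A - mat \<theta>)"
    and D0: "\<And>i. d_row (D i) = 0"
    and B: "\<And>i k. B $ Inl i $ Inl k = A $ i $ k" "\<And>i k. B $ Inl i $ Inr k = 0"
      "\<And>i k. B $ Inr i $ Inl k = D i $ k"
      "\<And>i k. B $ Inr i $ Inr k = (if i = k then [:\<theta>:] else 0)"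
    and Y: "closedin zariski Y" "Y \<noteq> UNIV" "0 \<in> Y" "\<And>x y. x \<in> Y \<Longrightarrow> y \<in> Y \<Longrightarrow> x + y \<in> Y"
      "\<And>x. x \<in> Y \<Longrightarrow> tmat_act q B x \<in> Y"
    and onto: "\<And>x :: 'a^'d. \<exists>v\<in>Y. \<forall>k. v $ Inl k = x $ k"
  obtains c V where "\<exists>i. c i \<noteq> 0"
    and "trow_mul q V A - trow_smult \<theta> V = (\<Sum>i\<in>UNIV. trow_smult (c i) (D i))"
proof -
  interpret char_power q "TYPE('a)" by fact
  define p where "p = CHAR('a)"
  note inf = infinite_alg_closed_field[where 'a = 'a]
  have p: "Factorial_Ring.prime p" "1 < p"
    using prime_char prime_gt_1_nat by (auto simp: p_def)
  define ann where "ann P \<longleftrightarrow> (\<forall>s. additive_poly (P s)) \<and> (\<forall>v\<in>Y. eval_row P v = 0)"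
    for P :: "'d + 'j \<Rightarrow> 'a poly"
  have annD: "additive_poly (P s)" "v \<in> Y \<Longrightarrow> eval_row P v = 0" if "ann P" for P s v
    using that by (auto simp: ann_def)
  \<comment> \<open>As \<open>Y\<close> surjects onto the first \<open>d\<close> coordinates, no equation involves these alone.\<close>
  have only_x: "P s = 0" if "ann P" "\<And>i. P (Inr i) = 0" for P s
  proof (cases s)
    case (Inl k)
    have "poly (P (Inl k)) a = 0" for a
    proof -
      obtain v where v: "v \<in> Y" "\<And>l. v $ Inl l = axis k a $ l"
        using onto by blast
      have "eval_row P v = (\<Sum>l\<in>UNIV. poly (P (Inl l)) (axis k a $ l))"
        by (simp add: eval_row_def sum_UNIV_Plus that(2) v(2))
      also have "\<dots> = (\<Sum>l\<in>UNIV. if l = k then poly (P (Inl k)) a else 0)"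
        by (rule sum.cong) (auto simp: axis_def poly_additive_zero annD(1)[OF that(1)])
      finally show ?thesis
        using annD(2)[OF that(1) v(1)] by simp
    qed
    then show ?thesis
      using Inl by (intro poly_eqI_infinite[OF inf]) simp
  qed (simp add: that(2))
  define bounded where "bounded M \<longleftrightarrow>
      (\<exists>P. ann P \<and> (\<exists>s. P s \<noteq> 0) \<and> (\<forall>i. Polynomial.degree (P (Inr i)) \<le> M))" for M
  have "\<exists>M. bounded M"
  proof -
    obtain f where f: "polyfun f" "\<And>x y. f (x + y) = f x + f y" "\<And>y. y \<in> Y \<Longrightarrow> f y = 0"
      "\<exists>x. f x \<noteq> 0"
      using proper_closed_subgroup_additive_equation[OF Y(1-4)] by blast
    obtain P where P: "\<And>s. additive_poly (P s)" "\<And>x. f x = (\<Sum>s\<in>UNIV. poly (P s) (x $ s))"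
      using additive_polyfun_split[OF f(1,2)] by blast
    have "ann P"
      using P f(3) by (simp add: ann_def eval_row_def)
    moreover have "\<exists>s. P s \<noteq> 0"
    proof (rule ccontr)
      assume "\<not> (\<exists>s. P s \<noteq> 0)"
      with f(4) P(2) show False
        by simp
    qed
    moreover have "Polynomial.degree (P (Inr i)) \<le> Max (range (\<lambda>i. Polynomial.degree (P (Inr i))))" for i
      by (rule Max_ge) auto
    ultimately show ?thesis
      unfolding bounded_def by blast
  qed
  define M where "M = (LEAST M. bounded M)"
  have "bounded M"
    unfolding M_def using \<open>\<exists>M. bounded M\<close> by (rule LeastI_ex)
  have minimal: "P s = 0" if "ann P" "\<And>i. Polynomial.degree (P (Inr i)) \<le> m" "m < M" for P s m
  proof (rule ccontr)
    assume "P s \<noteq> 0"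
    with that(1,2) have "bounded m"
      unfolding bounded_def by blast
    then have "M \<le> m"
      unfolding M_def by (rule Least_le)
    with that(3) show False
      by simp
  qed
  obtain P s0 where P: "ann P" "P s0 \<noteq> 0" and deg: "\<And>i. Polynomial.degree (P (Inr i)) \<le> M"
    using \<open>bounded M\<close> unfolding bounded_def by blast
  obtain i0 where i0: "P (Inr i0) \<noteq> 0"
    using only_x[OF P(1)] P(2) by blast
  note add = annD(1)[OF P(1)]
  have "M \<noteq> 0"
  proof
    assume "M = 0"
    then have "Polynomial.degree (P (Inr i0)) = 0"
      using deg[of i0] by simp
    then show False
      using i0 coeff_0_additive[OF add[of "Inr i0"]] by (metis leading_coeff_0_iff)
  qed
  have lin_0: "lin_poly q 0 = 0"
    by (simp add: lin_poly_def)
  have lin_\<theta>: "lin_poly q [:\<theta>:] = [:0, \<theta>:]"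
    by (simp add: lin_poly_def monom_Suc monom_0)
  have pc0: "pcompose (P s) 0 = 0" for s
    using coeff_0_additive[OF add[of s]] by (simp add: pcompose_0')
  \<comment> \<open>An equation of smaller degree in the last coordinates, hence zero by the choice of \<open>M\<close>.\<close>
  define P' where "P' s = pull_back q B P s - Polynomial.smult (\<theta> ^ M) (P s)" for s
  have pull_Inr: "pull_back q B P (Inr i) = pcompose (P (Inr i)) [:0, \<theta>:]" for i
  proof -
    have "pull_back q B P (Inr i) =
        (\<Sum>j\<in>UNIV. if j = i then pcompose (P (Inr i)) [:0, \<theta>:] else 0)"
      unfolding pull_back_def sum_UNIV_Plus B lin_0 pc0
      by (simp add: if_distrib[of "lin_poly q"] if_distrib[of "pcompose _"] lin_0 lin_\<theta> pc0 cong: if_cong)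
    then show ?thesis
      by simp
  qed
  have pull_Inl: "pull_back q B P (Inl k) = (\<Sum>l\<in>UNIV. pcompose (P (Inl l)) (lin_poly q (A $ l $ k)))
      + (\<Sum>i\<in>UNIV. pcompose (P (Inr i)) (lin_poly q (D i $ k)))" for k
    by (simp add: pull_back_def sum_UNIV_Plus B)
  have coeff_P': "Polynomial.coeff (P' (Inr i)) k = (\<theta> ^ k - \<theta> ^ M) * Polynomial.coeff (P (Inr i)) k" for i k
    by (simp add: P'_def pull_Inr coeff_pcompose_linear algebra_simps)
  have "ann P'"
    unfolding ann_def
  proof (intro conjI allI ballI)
    show "additive_poly (P' s)" for s
      unfolding P'_def by (intro additive_poly_diff additive_poly_smult additive_pull_back add)
    fix v assume "v \<in> Y"
    have "eval_row P' v = eval_row (pull_back q B P) v - \<theta> ^ M * eval_row P v"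
      by (simp add: eval_row_def P'_def sum_subtractf sum_distrib_left)
    also have "\<dots> = 0"
      by (simp add: eval_pull_back add annD(2)[OF P(1)] Y(5) \<open>v \<in> Y\<close>)
    finally show "eval_row P' v = 0" .
  qed
  moreover have "Polynomial.degree (P' (Inr i)) \<le> M - 1" for i
  proof (rule degree_le, intro allI impI)
    fix k assume "M - 1 < k"
    then have "k = M \<or> Polynomial.degree (P (Inr i)) < k"
      using deg[of i] \<open>M \<noteq> 0\<close> by linarith
    then show "Polynomial.coeff (P' (Inr i)) k = 0"
      by (auto simp: coeff_P' coeff_eq_0)
  qed
  ultimately have P'0: "P' s = 0" for s
    using minimal[of P' "M - 1"] \<open>M \<noteq> 0\<close> by simp
  have eigen: "pull_back q B P s = Polynomial.smult (\<theta> ^ M) (P s)" for s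
    using P'0[of s] by (simp add: P'_def)
  have single: "Polynomial.coeff (P (Inr i)) k = 0" if "k \<noteq> M" for i k
    using coeff_P'[of i k] P'0[of "Inr i"] \<theta>[of k M] that by auto
  have "M = 1"
  proof (rule ccontr)
    assume "M \<noteq> 1"
    \<comment> \<open>The linear terms in \<open>x\<close> form an eigenrow of \<open>d\<Phi>(t) - \<theta>\<close> with eigenvalue \<open>\<theta>\<^sup>M - \<theta> \<noteq> 0\<close>, so they
      vanish, and then the whole equation is a \<open>p\<close>-th power.\<close>
    define b :: "'a^'d" where "b = (\<chi> k. Polynomial.coeff (P (Inl k)) 1)"
    have c1: "Polynomial.coeff (pcompose (P s) (lin_poly q r)) 1 =
        Polynomial.coeff (P s) 1 * Polynomial.coeff r 0" for s r
      using coeff_1_pcompose[OF coeff_0_additive[OF additive_lin_poly[of r]], of "P s"]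
        coeff_lin_poly[of r 0] by simp
    have D0': "Polynomial.coeff (D i $ k) 0 = 0" for i k
      using D0[of i] by (simp add: d_row_def vec_eq_iff)
    have "(b v* d_mat A) $ k = \<theta> ^ M * b $ k" for k
    proof -
      have "(b v* d_mat A) $ k = Polynomial.coeff (pull_back q B P (Inl k)) 1"
        by (simp add: pull_Inl coeff_sum c1 D0' vector_matrix_mult_def d_mat_def b_def mult.commute del: One_nat_def)
      then show ?thesis
        by (simp add: eigen b_def)
    qed
    then have "b v* (d_mat A - mat \<theta>) = (\<theta> ^ M - \<theta>) *s b"
      by (simp add: vector_matrix_mult_diff_mat vec_eq_iff left_diff_distrib)
    moreover have "\<theta> ^ M - \<theta> \<noteq> 0"
      using \<theta>[of M 1] \<open>M \<noteq> 1\<close> by auto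
    ultimately have "b = 0"
      using nilpotent_mat_eigenrow[OF nil] by blast
    then have "Polynomial.coeff (P s) 1 = 0" for s
      using single[of 1] \<open>M \<noteq> 1\<close> by (cases s) (auto simp: b_def vec_eq_iff)
    then have "\<exists>R. additive_poly R \<and> (\<forall>x. poly (P s) x = poly R x ^ p) \<and>
        (\<forall>k. Polynomial.coeff R k ^ p = Polynomial.coeff (P s) (p * k))" for s
      using additive_poly_root[OF prime_char add[of s]] unfolding p_def by metis
    then obtain R where R: "\<And>s. additive_poly (R s)" "\<And>s x. poly (P s) x = poly (R s) x ^ p"
      "\<And>s k. Polynomial.coeff (R s) k ^ p = Polynomial.coeff (P s) (p * k)"
      by metis
    have "eval_row R v = 0" if "v \<in> Y" for v
    proof -
      have "eval_row R v ^ p = eval_row P v"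
        unfolding eval_row_def R(2) p_def by (rule freshmans_dream_sum[OF prime_char refl])
      then show ?thesis
        using annD(2)[OF P(1) that] p(2) by simp
    qed
    then have "ann R"
      using R(1) by (simp add: ann_def)
    moreover have "Polynomial.degree (R (Inr i)) \<le> M - 1" for i
    proof (rule degree_le, intro allI impI)
      fix k assume "M - 1 < k"
      then have "M < p * k"
        using p(2) \<open>M \<noteq> 0\<close> n_less_m_mult_n[of k p] by linarith
      then have "Polynomial.coeff (R (Inr i)) k ^ p = 0"
        by (simp add: R(3) single)
      then show "Polynomial.coeff (R (Inr i)) k = 0"
        by simp
    qed
    ultimately have "R s0 = 0"
      using minimal[of R "M - 1"] \<open>M \<noteq> 0\<close> by simp
    then have "poly (P s0) x = 0" for x
      using p(2) by (simp add: R(2))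
    then show False
      using P(2) poly_eqI_infinite[OF inf, of "P s0" 0] by simp
  qed
  define c where "c i = Polynomial.coeff (P (Inr i)) 1" for i
  have Pc: "P (Inr i) = [:0, c i:]" for i
    using single[of _ i] \<open>M = 1\<close>
    by (intro poly_eqI) (auto simp: c_def coeff_pCons split: nat.split)
  \<comment> \<open>The coefficients at \<open>q\<^sup>n\<close> of the eigenvector equation form an equation of twisted polynomials.\<close>
  define U :: "'a poly^'d" where "U = (\<chi> k. q_part q (P (Inl k)))"
  have "trow_mul q U A + (\<Sum>i\<in>UNIV. trow_smult (c i) (D i)) = trow_smult \<theta> U"
  proof -
    have "Polynomial.coeff ((trow_mul q U A + (\<Sum>i\<in>UNIV. trow_smult (c i) (D i))) $ k) n =
        Polynomial.coeff (pull_back q B P (Inl k)) (q ^ n)" for k n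
      by (simp add: pull_Inl Pc coeff_sum coeff_pcompose_lin_poly[OF q add] trow_mul_def U_def
          trow_smult_def pcompose_pCons coeff_lin_poly)
    also have "Polynomial.coeff (pull_back q B P (Inl k)) (q ^ n) =
        Polynomial.coeff (trow_smult \<theta> U $ k) n" for k n
      by (simp add: eigen \<open>M = 1\<close> U_def trow_smult_def coeff_q_part[OF q_gt_1])
    finally show ?thesis
      by (simp add: vec_eq_iff poly_eq_iff)
  qed
  then have "trow_mul q (trow_smult (- 1) U) A - trow_smult \<theta> (trow_smult (- 1) U) =
      (\<Sum>i\<in>UNIV. trow_smult (c i) (D i))"
    unfolding trow_mul_smult_left by (simp add: trow_smult_def vec_eq_iff algebra_simps)
  moreover have "\<exists>i. c i \<noteq> 0"
    using i0 Pc by auto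
  ultimately show ?thesis
    using that by blast
qed

section \<open>A relation between biderivations gives a proper sub-module\<close>

lemma polyfun_compose:
  assumes "polyfun f" and "\<And>s. polyfun (\<lambda>x. h x $ s)"
  shows "polyfun (\<lambda>x. f (h x))"
  using assms(1) by (induction rule: polyfun.induct) (auto intro: polyfun.intros assms(2))

text \<open>
  Restrict to the line through a point where \<open>f\<close> is nonzero and a point where \<open>g\<close> is nonzero.
\<close>

lemma polyfun_no_zero_divisors:
  fixes f g :: "'a::field^'n \<Rightarrow> 'a"
  assumes inf: "infinite (UNIV :: 'a set)" and "polyfun f" "polyfun g" and zero: "\<And>x. f x * g x = 0"
  shows "(\<forall>x. f x = 0) \<or> (\<forall>x. g x = 0)"
proof (rule ccontr)
  assume "\<not> ?thesis"
  then obtain x y where x: "f x \<noteq> 0" and y: "g y \<noteq> 0"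
    by blast
  obtain P where P: "\<And>s. f (x + s *s (y - x)) = poly P s"
    using polyfun_on_line[OF assms(2)] by metis
  obtain R where R: "\<And>s. g (x + s *s (y - x)) = poly R s"
    using polyfun_on_line[OF assms(3)] by metis
  have "poly (P * R) s = poly 0 s" for s
    using zero[of "x + s *s (y - x)"] unfolding P R by simp
  then have "P * R = 0"
    by (rule poly_eqI_infinite[OF inf])
  moreover have "P \<noteq> 0"
    using x P[of 0] by auto
  moreover have "R \<noteq> 0"
    using y R[of 1] by auto
  ultimately show False
    by simp
qed

text \<open>
  The image of an affine space is even irreducible: if it lies in the union of two closed sets, it lies
  in one of them, because the product of two functions that vanish on one set each vanishes on it.
\<close>

lemma connectedin_zariski_range:
  fixes h :: "'a::field^'n \<Rightarrow> 'a^'m"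
  assumes inf: "infinite (UNIV :: 'a set)" and h: "\<And>s. polyfun (\<lambda>x. h x $ s)"
  shows "connectedin zariski (range h)"
proof -
  have irreducible: "range h \<subseteq> S \<or> range h \<subseteq> T"
    if cl: "closedin zariski S" "closedin zariski T" "range h \<subseteq> S \<union> T" for S T
  proof (rule ccontr)
    obtain F where "(\<forall>f\<in>F. polyfun f) \<and> S = {x. \<forall>f\<in>F. f x = 0}"
      using cl(1) unfolding closedin_zariski_iff ..
    then have F: "\<forall>f\<in>F. polyfun f" "S = {x. \<forall>f\<in>F. f x = 0}"
      by simp_all
    obtain G where "(\<forall>f\<in>G. polyfun f) \<and> T = {x. \<forall>f\<in>G. f x = 0}"
      using cl(2) unfolding closedin_zariski_iff ..
    then have G: "\<forall>f\<in>G. polyfun f" "T = {x. \<forall>f\<in>G. f x = 0}"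
      by simp_all
    assume "\<not> (range h \<subseteq> S \<or> range h \<subseteq> T)"
    then obtain x f y g where fg: "f \<in> F" "f (h x) \<noteq> 0" "g \<in> G" "g (h y) \<noteq> 0"
      unfolding F(2) G(2) by auto
    have "f (h z) * g (h z) = 0" for z
      using cl(3) fg(1,3) unfolding F(2) G(2) by auto
    moreover have "polyfun (\<lambda>z. f (h z))" "polyfun (\<lambda>z. g (h z))"
      using polyfun_compose[OF bspec[OF F(1) fg(1)] h] polyfun_compose[OF bspec[OF G(1) fg(3)] h] .
    ultimately have "(\<forall>z. f (h z) = 0) \<or> (\<forall>z. g (h z) = 0)"
      using polyfun_no_zero_divisors[OF inf, of "\<lambda>z. f (h z)" "\<lambda>z. g (h z)"] by blast
    with fg show False
      by auto
  qed
  show ?thesis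
    unfolding connectedin_closedin
  proof (intro conjI notI)
    assume "\<exists>E1 E2. closedin zariski E1 \<and> closedin zariski E2 \<and> range h \<subseteq> E1 \<union> E2 \<and>
      E1 \<inter> E2 \<inter> range h = {} \<and> E1 \<inter> range h \<noteq> {} \<and> E2 \<inter> range h \<noteq> {}"
    then obtain S T where ST: "closedin zariski S" "closedin zariski T" "range h \<subseteq> S \<union> T"
      "S \<inter> T \<inter> range h = {}" "S \<inter> range h \<noteq> {}" "T \<inter> range h \<noteq> {}"
      by blast
    from irreducible[OF ST(1-3)] ST(4-6) show False
      by blast
  qed (simp add: topspace_zariski)
qed

text \<open>
  The subgroup is the kernel of \<open>g(x, u) = \<Sum> c\<^sub>i u\<^sub>i - V(x)\<close>, and the relation says \<open>g \<circ> \<Psi>(t) = \<theta> g\<close>.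
  As \<open>c i\<^sub>0 \<noteq> 0\<close>, the coordinate \<open>u\<^sub>i\<^sub>0\<close> can be corrected so that a given vector satisfies
  \<open>g = 0\<close>; the correction map \<open>h\<close> parametrises the kernel polynomially.
\<close>

lemma relation_proper_submodule:
  fixes \<theta> :: "'a::field"
    and A :: "'a poly^'d^'d" and D :: "'j::finite \<Rightarrow> 'a poly^'d" and B :: "'a poly^('d + 'j)^('d + 'j)"
  assumes q: "char_power TYPE('a) q" and inf: "infinite (UNIV :: 'a set)"
    and B: "\<And>i k. B $ Inl i $ Inl k = A $ i $ k" "\<And>i k. B $ Inl i $ Inr k = 0"
      "\<And>i k. B $ Inr i $ Inl k = D i $ k"
      "\<And>i k. B $ Inr i $ Inr k = (if i = k then [:\<theta>:] else 0)"
    and c: "c i\<^sub>0 \<noteq> 0"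
    and V: "trow_mul q V A - trow_smult \<theta> V = (\<Sum>i\<in>UNIV. trow_smult (c i) (D i))"
  obtains Y where "closedin zariski Y" "connectedin zariski Y" "0 \<in> Y" "Y \<noteq> UNIV"
    "\<And>x y. x \<in> Y \<Longrightarrow> y \<in> Y \<Longrightarrow> x + y \<in> Y" "\<And>x. x \<in> Y \<Longrightarrow> - x \<in> Y"
    "\<And>x. x \<in> Y \<Longrightarrow> tmat_act q B x \<in> Y"
    "\<And>x :: 'a^'d. \<exists>v\<in>Y. \<forall>k. v $ Inl k = x $ k"
proof -
  interpret char_power q "TYPE('a)" by fact
  define g :: "'a^('d + 'j) \<Rightarrow> 'a" where
    "g v = (\<Sum>i\<in>UNIV. c i * v $ Inr i) - (\<Sum>k\<in>UNIV. teval q (V $ k) (v $ Inl k))" for v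
  define Y where "Y = {v. g v = 0}"
  define h where "h v = v + axis (Inr i\<^sub>0) (- g v / c i\<^sub>0)" for v
  have g_add: "g (v + w) = g v + g w" for v w
    by (simp add: g_def teval_add distrib_left sum.distrib)
  have g_minus: "g (- v) = - g v" for v
    by (simp add: g_def teval_minus sum_negf)
  have g_zero: "g 0 = 0"
    by (simp add: g_def)
  have g_axis: "g (axis (Inr i\<^sub>0) s) = c i\<^sub>0 * s" for s
  proof -
    have "(\<Sum>i\<in>UNIV. c i * axis (Inr i\<^sub>0) s $ (Inr i :: 'd + 'j)) = (\<Sum>i\<in>UNIV. if i = i\<^sub>0 then c i\<^sub>0 * s else 0)"
      by (rule sum.cong) (auto simp: axis_def)
    moreover have "teval q (V $ k) (axis (Inr i\<^sub>0) s $ (Inl k :: 'd + 'j)) = 0" for k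
      by (simp add: axis_def)
    ultimately show ?thesis
      by (simp add: g_def)
  qed
  have g_poly: "polyfun g"
    unfolding g_def
    by (rule polyfun_diff; rule polyfun_sum)
      (rule polyfun_mult[OF polyfun_const polyfun_coord] polyfun_teval)+
  have "g (h v) = 0" for v
    using c by (simp add: h_def g_add g_axis)
  then have h_Y: "h v \<in> Y" for v
    by (simp add: Y_def)
  have "h v = v" if "v \<in> Y" for v
    using that by (simp add: Y_def h_def axis_def vec_eq_iff)
  then have range_h: "Y = range h"
    using h_Y by (auto intro: range_eqI[OF sym])
  have g_stable: "g (tmat_act q B v) = \<theta> * g v" for v
  proof -
    have Inl: "tmat_act q B v $ Inl k = (\<Sum>l\<in>UNIV. teval q (A $ k $ l) (v $ Inl l))" for k
      by (simp add: tmat_act_def sum_UNIV_Plus B)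
    have theta: "(\<Sum>j\<in>UNIV. teval q (if i = j then [:\<theta>:] else 0) (v $ Inr j)) = \<theta> * v $ Inr i" for i
    proof -
      have "(\<Sum>j\<in>UNIV. teval q (if i = j then [:\<theta>:] else 0) (v $ Inr j)) =
          (\<Sum>j\<in>UNIV. if i = j then \<theta> * v $ Inr i else 0)"
        by (rule sum.cong) auto
      then show ?thesis
        by simp
    qed
    have Inr: "tmat_act q B v $ Inr i = (\<Sum>l\<in>UNIV. teval q (D i $ l) (v $ Inl l)) + \<theta> * v $ Inr i" for i
      by (simp add: tmat_act_def sum_UNIV_Plus B theta)
    have V': "(\<Sum>k\<in>UNIV. tmul q (V $ k) (A $ k $ l)) =
        Polynomial.smult \<theta> (V $ l) + (\<Sum>i\<in>UNIV. Polynomial.smult (c i) (D i $ l))" for l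
      using arg_cong[OF V, of "\<lambda>w. w $ l"] by (simp add: trow_mul_def trow_smult_def algebra_simps)
    have "(\<Sum>k\<in>UNIV. teval q (V $ k) (tmat_act q B v $ Inl k)) =
        (\<Sum>k\<in>UNIV. \<Sum>l\<in>UNIV. teval q (tmul q (V $ k) (A $ k $ l)) (v $ Inl l))"
      by (simp add: Inl teval_sum teval_tmul)
    also have "\<dots> = (\<Sum>l\<in>UNIV. \<Sum>k\<in>UNIV. teval q (tmul q (V $ k) (A $ k $ l)) (v $ Inl l))"
      by (rule sum.swap)
    also have "\<dots> = (\<Sum>l\<in>UNIV. \<theta> * teval q (V $ l) (v $ Inl l)) +
        (\<Sum>l\<in>UNIV. \<Sum>i\<in>UNIV. c i * teval q (D i $ l) (v $ Inl l))"
      by (simp add: V' teval_add_poly teval_smult sum.distrib flip: teval_sum_poly)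
        (simp add: teval_sum_poly teval_smult)
    also have "(\<Sum>l\<in>UNIV. \<Sum>i\<in>UNIV. c i * teval q (D i $ l) (v $ Inl l)) =
        (\<Sum>i\<in>UNIV. \<Sum>l\<in>UNIV. c i * teval q (D i $ l) (v $ Inl l))"
      by (rule sum.swap)
    finally show ?thesis
      by (simp add: g_def Inr distrib_left sum.distrib sum_distrib_left right_diff_distrib mult_ac)
  qed
  show ?thesis
  proof (rule that[of Y])
    show "closedin zariski Y"
      unfolding closedin_zariski_iff Y_def using g_poly by (intro exI[of _ "{g}"]) simp
    have "polyfun (\<lambda>v. h v $ s)" for s
    proof -
      have "(\<lambda>v. h v $ s) = (\<lambda>v. v $ s + (if s = Inr i\<^sub>0 then - 1 / c i\<^sub>0 else 0) * g v)"
        by (simp add: h_def axis_def fun_eq_iff)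
      then show ?thesis
        by (simp only:) (intro polyfun_add polyfun_mult polyfun_const polyfun_coord g_poly)
    qed
    then show "connectedin zariski Y"
      unfolding range_h by (rule connectedin_zariski_range[OF inf])
    have "axis (Inr i\<^sub>0) 1 \<notin> Y"
      using c by (simp add: Y_def g_axis)
    then show "Y \<noteq> UNIV"
      by blast
    show "\<exists>v\<in>Y. \<forall>k. v $ Inl k = x $ k" for x :: "'a^'d"
    proof (intro bexI[OF _ h_Y] allI)
      fix k
      show "h (\<chi> s. case s of Inl k \<Rightarrow> x $ k | Inr i \<Rightarrow> 0) $ Inl k = x $ k"
        by (simp add: h_def axis_def)
    qed
  qed (simp_all add: Y_def g_add g_minus g_zero g_stable)
qed

section \<open>Biderivations are determined by their value at \<open>t\<close>\<close>

lemma (in char_power) tmul_add_right: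
  assumes "infinite (UNIV :: 'a set)"
  shows "tmul q a (b + c :: 'a poly) = tmul q a b + tmul q a c"
  by (rule teval_inject[OF assms]) (simp add: teval_tmul teval_add teval_add_poly)

lemma power_power_fixed: "(e::'a::monoid_mult) ^ q = e \<Longrightarrow> e ^ (q ^ n) = e"
  by (induction n) (simp_all add: power_mult)

lemma (in char_power) tmul_fixed_const:
  assumes "infinite (UNIV :: 'a set)" and e: "(e::'a) ^ q = e"
  shows "tmul q p [:e:] = Polynomial.smult e p"
proof (rule teval_inject[OF assms(1)])
  fix x
  show "teval q (tmul q p [:e:]) x = teval q (Polynomial.smult e p) x"
    by (simp add: teval_tmul teval_smult teval_def[of q p] power_mult_distrib power_power_fixed[OF e]
        sum_distrib_left mult.left_commute)
qed

lemma (in char_power) trow_mul_mult: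
  assumes "infinite (UNIV :: 'a set)"
  shows "trow_mul q U (tmat_mul q A B) = trow_mul q (trow_mul q (U :: 'a poly^'n) A) B"
proof -
  have "(\<Sum>j\<in>UNIV. tmul q (U $ j) (\<Sum>l\<in>UNIV. tmul q (A $ j $ l) (B $ l $ k))) =
      (\<Sum>l\<in>UNIV. tmul q (\<Sum>j\<in>UNIV. tmul q (U $ j) (A $ j $ l)) (B $ l $ k))" for k
  proof -
    have "(\<Sum>j\<in>UNIV. tmul q (U $ j) (\<Sum>l\<in>UNIV. tmul q (A $ j $ l) (B $ l $ k))) =
        (\<Sum>j\<in>UNIV. \<Sum>l\<in>UNIV. tmul q (tmul q (U $ j) (A $ j $ l)) (B $ l $ k))"
      by (simp add: tmul_sum_right[OF assms] tmul_assoc[OF assms])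
    also have "\<dots> = (\<Sum>l\<in>UNIV. \<Sum>j\<in>UNIV. tmul q (tmul q (U $ j) (A $ j $ l)) (B $ l $ k))"
      by (rule sum.swap)
    finally show ?thesis
      by (simp add: tmul_sum_left)
  qed
  then show ?thesis
    by (simp add: trow_mul_def tmat_mul_def vec_eq_iff)
qed

lemma (in char_power) d_row_trow_mul: "d_row (trow_mul q (U :: 'a poly^'n) A) = d_row U v* d_mat A"
proof -
  have "Polynomial.coeff (tmul q p r) 0 = Polynomial.coeff p 0 * Polynomial.coeff r 0" for p r :: "'a poly"
  proof -
    have "Polynomial.coeff (tmul q p r) 0 = (\<Sum>i\<le>Polynomial.degree p. \<Sum>j\<le>Polynomial.degree r.
        if j = 0 then (if i = 0 then Polynomial.coeff p 0 * Polynomial.coeff r 0 else 0) else 0)"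
      unfolding tmul_def coeff_sum coeff_monom by (intro sum.cong) auto
    then show ?thesis
      by simp
  qed
  then show ?thesis
    by (simp add: vec_eq_iff d_row_def d_mat_def trow_mul_def coeff_sum vector_matrix_mult_def mult.commute)
qed

lemma pCons_eq_const_plus: "pCons c a = [:c:] + tvar * a"
  by simp

text \<open>
  Both \<open>\<eta>\<close> and \<open>a \<mapsto> U \<Phi>(a) - \<iota>(a) U\<close> obey the product rule and vanish on constants, so they agree
  everywhere once they agree at \<open>t\<close>. The condition on \<open>d U\<close> is the constant term of the equation at
  \<open>t\<close>, where \<open>\<eta>\<close> contributes nothing.
\<close>

lemma inner_biderivation_at_t:
  fixes \<iota> :: "'f::{field,finite} poly \<Rightarrow> 'l::field" and \<Phi> :: "'f poly \<Rightarrow> 'l poly^'d^'d"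
  assumes q: "char_power TYPE('l) CARD('f)" and inf: "infinite (UNIV :: 'l set)"
    and \<Phi>: "t_module \<iota> \<Phi>"
    and \<iota>_zero: "\<iota> 0 = 0" and \<iota>_pCons: "\<And>c a. \<iota> (pCons c a) = \<iota> [:c:] + \<iota> tvar * \<iota> a"
    and \<iota>_const: "\<And>c. \<iota> [:c:] ^ CARD('f) = \<iota> [:c:]"
    and \<eta>: "\<eta> \<in> biderivations \<iota> \<Phi>"
    and U: "\<eta> tvar = trow_mul CARD('f) U (\<Phi> tvar) - trow_smult (\<iota> tvar) U"
  shows "\<eta> \<in> inner_biderivations \<iota> \<Phi>"
proof -
  interpret char_power "CARD('f)" "TYPE('l)" by fact
  let ?q = "CARD('f)"
  have \<eta>_add: "\<eta> (a + b) = \<eta> a + \<eta> b" and \<eta>_smult: "\<eta> (Polynomial.smult c a) = trow_smult (\<iota> [:c:]) (\<eta> a)"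
    and \<eta>_d: "d_row (\<eta> a) = 0" and \<eta>_mult: "\<eta> (a * b) = trow_smult (\<iota> a) (\<eta> b) + trow_mul ?q (\<eta> a) (\<Phi> b)"
    for a b c
    using \<eta> by (auto simp: biderivations_def)
  have \<Phi>_add: "\<Phi> (a + b) = \<Phi> a + \<Phi> b" and \<Phi>_mult: "\<Phi> (a * b) = tmat_mul ?q (\<Phi> a) (\<Phi> b)"
    and \<Phi>_const: "\<Phi> [:c:] = mat [:\<iota> [:c:]:]" for a b c
    using \<Phi> by (auto simp: t_module_def)
  have mul_add: "trow_mul ?q W (A + B) = trow_mul ?q W A + trow_mul ?q W B" for W and A B :: "'l poly^'d^'d"
    by (simp add: trow_mul_def vec_eq_iff tmul_add_right[OF inf] sum.distrib)
  have mul_diff: "trow_mul ?q (W - W') A = trow_mul ?q W A - trow_mul ?q W' A"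
    for W W' :: "'l poly^'d" and A :: "'l poly^'d^'d"
    using trow_mul_add_left[of ?q "W - W'" W' A] by simp
  have mul_const: "trow_mul ?q W (mat [:\<iota> [:c:]:]) = trow_smult (\<iota> [:c:]) W" for c and W :: "'l poly^'d"
  proof -
    have "(\<Sum>j\<in>UNIV. tmul ?q (W $ j) (mat [:\<iota> [:c:]:] $ j $ k)) =
        (\<Sum>j\<in>UNIV. if j = k then Polynomial.smult (\<iota> [:c:]) (W $ k) else 0)" for k
      by (rule sum.cong) (auto simp: mat_def tmul_fixed_const[OF inf \<iota>_const])
    then show ?thesis
      by (simp add: trow_mul_def trow_smult_def vec_eq_iff)
  qed
  have \<eta>_const: "\<eta> [:c:] = 0" for c
  proof -
    \<comment> \<open>The product rule for \<open>1 = 1 \<cdot> 1\<close> reads \<open>\<eta> 1 = \<eta> 1 + \<eta> 1\<close>.\<close>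
    have "trow_smult (\<iota> [:1:]) (\<eta> 1) = \<eta> 1"
      by (metis \<eta>_smult smult_1_left)
    then have "\<eta> 1 = \<eta> 1 + \<eta> 1"
      using \<eta>_mult[of 1 1] \<Phi>_const[of 1] mul_const[of "\<eta> 1" 1] by (simp flip: one_pCons)
    then show ?thesis
      using \<eta>_smult[of c 1] by (simp flip: one_pCons)
  qed
  have "\<eta> a = trow_mul ?q U (\<Phi> a) - trow_smult (\<iota> a) U" for a
  proof (induction a rule: pCons_induct)
    case 0
    have "\<eta> 0 = 0" "\<Phi> 0 = 0"
      using \<eta>_add[of 0 0] \<Phi>_add[of 0 0] by simp_all
    moreover have "trow_mul ?q U (0 :: 'l poly^'d^'d) = 0"
      using mul_add[of U 0 0] by simp
    ultimately show ?case
      by (simp add: \<iota>_zero)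
  next
    case (pCons c a)
    have "\<eta> (pCons c a) = trow_smult (\<iota> tvar) (\<eta> a) + trow_mul ?q (\<eta> tvar) (\<Phi> a)"
      by (subst pCons_eq_const_plus) (simp only: \<eta>_add \<eta>_mult \<eta>_const add_0)
    also have "\<dots> = trow_mul ?q (trow_mul ?q U (\<Phi> tvar)) (\<Phi> a) - trow_smult (\<iota> tvar * \<iota> a) U"
      by (simp add: U pCons.IH mul_diff trow_mul_smult_left trow_smult_diff_right trow_smult_smult)
    also have "\<dots> = trow_mul ?q U (mat [:\<iota> [:c:]:] + tmat_mul ?q (\<Phi> tvar) (\<Phi> a)) -
        trow_smult (\<iota> [:c:] + \<iota> tvar * \<iota> a) U"
      by (simp add: mul_add mul_const trow_mul_mult[OF inf] trow_smult_add_left)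
    also have "mat [:\<iota> [:c:]:] + tmat_mul ?q (\<Phi> tvar) (\<Phi> a) = \<Phi> (pCons c a)"
      by (subst (2) pCons_eq_const_plus) (simp only: \<Phi>_add \<Phi>_mult \<Phi>_const)
    finally show ?case
      by (simp add: \<iota>_pCons[of c a])
  qed
  moreover have "d_row U v* nil_part \<iota> \<Phi> = 0"
  proof -
    have "d_row (\<eta> tvar) = d_row U v* d_mat (\<Phi> tvar) - \<iota> tvar *s d_row U"
      unfolding U using d_row_trow_mul[of U "\<Phi> tvar"]
      by (simp add: d_row_def trow_smult_def vec_eq_iff)
    then show ?thesis
      by (simp add: \<eta>_d nil_part_def vector_matrix_mult_diff_mat)
  qed
  ultimately show ?thesis
    using \<eta> unfolding inner_biderivations_def by blast
qed

section \<open>The projection is a morphism\<close>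

lemma tmul_1_right: "tmul q p 1 = p"
proof -
  have "tmul q p 1 = (\<Sum>i\<le>Polynomial.degree p. Polynomial.monom (Polynomial.coeff p i) i)"
    by (simp add: tmul_def)
  then show ?thesis
    by (simp add: poly_as_sum_of_monoms)
qed

lemma tmul_1_left: "tmul q 1 p = p"
proof -
  have "tmul q 1 p = (\<Sum>i\<le>Polynomial.degree p. Polynomial.monom (Polynomial.coeff p i) i)"
    by (simp add: tmul_def)
  then show ?thesis
    by (simp add: poly_as_sum_of_monoms)
qed

text \<open>
  \<open>\<Psi>(t)\<close> is block lower triangular with \<open>\<Phi>(t)\<close> in the upper left corner, and products of such matrices
  have the same shape.
\<close>

lemma quasi_periodic_extension_top:
  fixes \<iota> :: "'f::{field,finite} poly \<Rightarrow> 'l::field"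
  assumes "quasi_periodic_extension \<iota> \<Phi> \<delta> \<Psi>" and "t_module \<iota> \<Phi>"
  shows "\<Psi> a $ Inl i $ Inl k = \<Phi> a $ i $ k \<and> \<Psi> a $ Inl i $ Inr j = 0"
proof (induction a arbitrary: i k j rule: pCons_induct)
  case 0
  have "\<Psi> (0 + 0) = \<Psi> 0 + \<Psi> 0" "\<Phi> (0 + 0) = \<Phi> 0 + \<Phi> 0"
    using assms unfolding quasi_periodic_extension_def t_module_def by blast+
  then show ?case
    by simp
next
  case (pCons c a)
  have \<Psi>: "\<Psi> (pCons c a) = mat [:\<iota> [:c:]:] + tmat_mul CARD('f) (\<Psi> tvar) (\<Psi> a)"
    using assms(1) unfolding quasi_periodic_extension_def t_module_def
    by (subst pCons_eq_const_plus) metis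
  have \<Phi>: "\<Phi> (pCons c a) = mat [:\<iota> [:c:]:] + tmat_mul CARD('f) (\<Phi> tvar) (\<Phi> a)"
    using assms(2) unfolding t_module_def by (subst pCons_eq_const_plus) metis
  have B: "\<Psi> tvar $ Inl i $ Inl k = \<Phi> tvar $ i $ k" "\<Psi> tvar $ Inl i $ Inr j = 0" for i k j
    using assms(1) by (auto simp: quasi_periodic_extension_def)
  show ?case
    unfolding \<Psi> \<Phi> by (simp add: tmat_mul_def sum_UNIV_Plus B pCons.IH mat_def)
qed

lemma t_morphism_proj_mat:
  fixes \<iota> :: "'f::{field,finite} poly \<Rightarrow> 'l::field" and \<Phi> :: "'f poly \<Rightarrow> 'l poly^'d^'d"
  assumes "quasi_periodic_extension \<iota> \<Phi> \<delta> \<Psi>" and "t_module \<iota> \<Phi>"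
  shows "t_morphism \<Psi> \<Phi> proj_mat"
  unfolding t_morphism_def
proof
  fix a
  have left: "tmul CARD('f) (if i = k then 1 else 0) p = (if i = k then p else 0)"
    and right: "tmul CARD('f) p (if i = k then 1 else 0) = (if i = k then p else 0)"
    for i k :: 'd and p :: "'l poly"
    by (simp_all add: tmul_1_left tmul_1_right)
  have "tmat_mul CARD('f) proj_mat (\<Psi> a) $ i $ s = \<Psi> a $ Inl i $ s" for i s
    by (simp add: tmat_mul_def proj_mat_def sum_UNIV_Plus left)
  moreover have "tmat_mul CARD('f) (\<Phi> a) proj_mat $ i $ s = \<Psi> a $ Inl i $ s" for i s
    by (cases s) (simp_all add: tmat_mul_def proj_mat_def right quasi_periodic_extension_top[OF assms])
  ultimately show "tmat_mul CARD('f) proj_mat (\<Psi> a) = tmat_mul CARD('f) (\<Phi> a) proj_mat"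
    by (simp add: vec_eq_iff)
qed

lemma tmat_act_proj_mat:
  fixes v :: "'a::field^('d::finite + 'j::finite)"
  shows "tmat_act q proj_mat v $ i = v $ Inl i"
proof -
  have "teval q (if i = k then 1 else 0) x = (if i = k then x else 0)" for k :: 'd and x :: 'a
    by (simp add: teval_def)
  then show ?thesis
    by (simp add: tmat_act_def proj_mat_def sum_UNIV_Plus)
qed

section \<open>Linear independence in \<open>H_sr\<close>\<close>

lemma finsum_H_sr:
  fixes \<delta> :: "'j \<Rightarrow> 'f::{field,finite} poly \<Rightarrow> 'l::field poly^'d"
  assumes "finite A" and \<delta>: "\<And>i. \<delta> i \<in> biderivations \<iota> \<Phi>"
  shows "(\<lambda>a. \<Sum>i\<in>A. trow_smult (c i) (\<delta> i a)) \<in> biderivations \<iota> \<Phi>"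
    and "finsum (H_sr \<iota> \<Phi>) (\<lambda>i. c i \<odot>\<^bsub>H_sr \<iota> \<Phi>\<^esub> H_sr_class \<iota> \<Phi> (\<delta> i)) A =
      H_sr_class \<iota> \<Phi> (\<lambda>a. \<Sum>i\<in>A. trow_smult (c i) (\<delta> i a))"
proof -
  interpret module ring_of_type_algebra "H_sr \<iota> \<Phi>"
    by (rule module_H_sr)
  have carrier: "c i \<odot>\<^bsub>H_sr \<iota> \<Phi>\<^esub> H_sr_class \<iota> \<Phi> (\<delta> i) \<in> carrier (H_sr \<iota> \<Phi>)" for i
    using biderivations_smult[OF \<delta>] by (simp add: H_sr_smult H_sr_carrier)
  have "(\<lambda>a. \<Sum>i\<in>A. trow_smult (c i) (\<delta> i a)) \<in> biderivations \<iota> \<Phi> \<and>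
    finsum (H_sr \<iota> \<Phi>) (\<lambda>i. c i \<odot>\<^bsub>H_sr \<iota> \<Phi>\<^esub> H_sr_class \<iota> \<Phi> (\<delta> i)) A =
      H_sr_class \<iota> \<Phi> (\<lambda>a. \<Sum>i\<in>A. trow_smult (c i) (\<delta> i a))"
    using assms(1)
  proof induction
    case empty
    then show ?case
      by (simp add: biderivations_0 H_sr_zero)
  next
    case (insert i A)
    then show ?case
      using carrier biderivations_add[OF biderivations_smult[OF \<delta>]]
      by (simp add: M.finsum_insert Pi_def H_sr_smult H_sr_add)
  qed
  then show "(\<lambda>a. \<Sum>i\<in>A. trow_smult (c i) (\<delta> i a)) \<in> biderivations \<iota> \<Phi>"
    and "finsum (H_sr \<iota> \<Phi>) (\<lambda>i. c i \<odot>\<^bsub>H_sr \<iota> \<Phi>\<^esub> H_sr_class \<iota> \<Phi> (\<delta> i)) A =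
      H_sr_class \<iota> \<Phi> (\<lambda>a. \<Sum>i\<in>A. trow_smult (c i) (\<delta> i a))"
    by simp_all
qed

lemma lin_indep_family_H_sr:
  fixes \<delta> :: "'j::finite \<Rightarrow> 'f::{field,finite} poly \<Rightarrow> 'l::field poly^'d"
  assumes "\<And>i. \<delta> i \<in> biderivations \<iota> \<Phi>"
  shows "lin_indep_family (H_sr \<iota> \<Phi>) (\<lambda>i. H_sr_class \<iota> \<Phi> (\<delta> i)) \<longleftrightarrow>
    (\<forall>c. (\<lambda>a. \<Sum>i\<in>UNIV. trow_smult (c i) (\<delta> i a)) \<in> inner_biderivations \<iota> \<Phi> \<longrightarrow> (\<forall>i. c i = 0))"
  unfolding lin_indep_family_def finsum_H_sr(2)[where A = UNIV and \<delta> = \<delta>, OF finite assms]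
    H_sr_zero H_sr_class_eq_iff by simp

section \<open>Series over an ultrametric field\<close>

text \<open>
  The sort of \<open>C\<^sub>\<infinity>\<close> provides the field operations and a complete metric, but no relation between them;
  so the limit laws for sums and products are derived from the absolute value.
\<close>

locale ultrametric = char_power q K for q :: nat and K :: "'c::{field,complete_space} itself" +
  assumes dist_diff: "dist x y = dist (x - y) (0::'c)"
    and dist_mult: "dist (x * y) 0 = dist x 0 * dist y (0::'c)"
    and dist_add: "dist (x + y) 0 \<le> max (dist x 0) (dist y (0::'c))"
begin

abbreviation absval :: "'c \<Rightarrow> real" (\<open>\<bar>_\<bar>\<^sub>C\<close>) where
  "\<bar>x\<bar>\<^sub>C \<equiv> dist x 0"

lemma absval_1 [simp]: "\<bar>1\<bar>\<^sub>C = 1"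
  using dist_mult[of 1 1] by simp

lemma absval_minus [simp]: "\<bar>- x\<bar>\<^sub>C = \<bar>x\<bar>\<^sub>C"
  by (metis diff_0 dist_commute dist_diff)

lemma absval_power: "\<bar>x ^ n\<bar>\<^sub>C = \<bar>x\<bar>\<^sub>C ^ n"
  by (induction n) (simp_all add: dist_mult)

lemma absval_inverse: "\<bar>inverse x\<bar>\<^sub>C = inverse \<bar>x\<bar>\<^sub>C"
proof (cases "x = 0")
  case False
  then have "\<bar>x\<bar>\<^sub>C * \<bar>inverse x\<bar>\<^sub>C = 1"
    by (simp flip: dist_mult)
  then show ?thesis
    by (simp add: inverse_unique)
qed simp

lemma absval_triangle: "\<bar>x + y\<bar>\<^sub>C \<le> \<bar>x\<bar>\<^sub>C + \<bar>y\<bar>\<^sub>C"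
  using dist_add[of x y] by (smt (verit) zero_le_dist)

lemma absval_sum_less:
  assumes "0 < e" "\<And>i. i \<in> A \<Longrightarrow> \<bar>f i\<bar>\<^sub>C < e"
  shows "\<bar>\<Sum>i\<in>A. f i\<bar>\<^sub>C < e"
  using assms
proof (induction A rule: infinite_finite_induct)
  case (insert i A)
  then have "max \<bar>f i\<bar>\<^sub>C \<bar>\<Sum>i\<in>A. f i\<bar>\<^sub>C < e"
    by simp
  from le_less_trans[OF dist_add this] insert.hyps show ?case
    by simp
qed simp_all

lemma tendsto_absval: "f \<longlonglongrightarrow> l \<longleftrightarrow> (\<lambda>n. \<bar>f n - l\<bar>\<^sub>C) \<longlonglongrightarrow> 0"
  by (subst tendsto_dist_iff) (simp flip: dist_diff)

lemma tendsto_plus: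
  assumes "f \<longlonglongrightarrow> a" "g \<longlonglongrightarrow> (b::'c)"
  shows "(\<lambda>n. f n + g n) \<longlonglongrightarrow> a + b"
  unfolding tendsto_absval
proof (rule tendsto_sandwich[OF always_eventually always_eventually tendsto_const])
  show "(\<lambda>n. \<bar>f n - a\<bar>\<^sub>C + \<bar>g n - b\<bar>\<^sub>C) \<longlonglongrightarrow> 0"
    using tendsto_add[OF assms[unfolded tendsto_absval]] by simp
  show "\<forall>n. \<bar>f n + g n - (a + b)\<bar>\<^sub>C \<le> \<bar>f n - a\<bar>\<^sub>C + \<bar>g n - b\<bar>\<^sub>C"
    using absval_triangle by (metis add_diff_add)
qed simp

lemma tendsto_times:
  assumes "f \<longlonglongrightarrow> (a::'c)"
  shows "(\<lambda>n. c * f n) \<longlonglongrightarrow> c * a"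
  using tendsto_mult_right_zero[OF assms[unfolded tendsto_absval], of "\<bar>c\<bar>\<^sub>C"]
  unfolding tendsto_absval by (simp flip: dist_mult right_diff_distrib)

lemma tendsto_frob:
  assumes "f \<longlonglongrightarrow> (a::'c)"
  shows "(\<lambda>n. f n ^ (q ^ i)) \<longlonglongrightarrow> a ^ (q ^ i)"
  using tendsto_power[OF assms[unfolded tendsto_absval], of "q ^ i"] q_gt_1
  unfolding tendsto_absval by (simp add: zero_power flip: absval_power frob_diff)

lemma sums_plus: "f sums a \<Longrightarrow> g sums b \<Longrightarrow> (\<lambda>n. f n + g n :: 'c) sums (a + b)"
  unfolding sums_def by (simp add: sum.distrib tendsto_plus)

lemma sums_times: "f sums a \<Longrightarrow> (\<lambda>n. c * f n :: 'c) sums (c * a)"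
  unfolding sums_def by (simp add: tendsto_times flip: sum_distrib_left)

lemma sums_frob: "f sums a \<Longrightarrow> (\<lambda>n. f n ^ (q ^ i) :: 'c) sums (a ^ (q ^ i))"
  unfolding sums_def by (simp add: tendsto_frob flip: frob_sum)

lemma sums_finite_sum:
  "(\<And>i. i \<in> A \<Longrightarrow> f i sums a i) \<Longrightarrow> (\<lambda>n. \<Sum>i\<in>A. f i n :: 'c) sums (\<Sum>i\<in>A. a i)"
proof (induction A rule: infinite_finite_induct)
  case (insert i A)
  then show ?case
    using sums_plus[of "f i" "a i"] by simp
qed (simp_all add: sums_def)

lemma sums_shift:
  assumes "f sums (a::'c)"
  shows "(\<lambda>n. if i \<le> n then f (n - i) else 0) sums a"
proof -
  have "(\<Sum>k<n + i. if i \<le> k then f (k - i) else 0) = (\<Sum>k<n. f k)" for n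
  proof -
    have "(\<Sum>k<n + i. if i \<le> k then f (k - i) else 0) = (\<Sum>k\<in>{i..<n + i}. f (k - i))"
      by (intro sum.mono_neutral_cong_right) auto
    also have "\<dots> = (\<Sum>k<n. f k)"
      by (rule sum.reindex_bij_witness[of _ "\<lambda>k. k + i" "\<lambda>k. k - i"]) auto
    finally show ?thesis .
  qed
  then show ?thesis
    using assms unfolding sums_def by - (rule LIMSEQ_offset[of _ i], simp)
qed

lemma sums_imp_null:
  assumes "f sums (a::'c)"
  shows "(\<lambda>n. \<bar>f n\<bar>\<^sub>C) \<longlonglongrightarrow> 0"
proof -
  have "(\<lambda>n. \<Sum>i<n. f i) \<longlonglongrightarrow> a"
    using assms by (simp add: sums_def)
  from tendsto_plus[OF LIMSEQ_Suc[OF this] tendsto_times[OF this, of "- 1"]] show ?thesis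
    unfolding tendsto_absval by simp
qed

text \<open>
  By the ultrametric inequality a block of consecutive terms is no larger than its largest term, so the
  partial sums form a Cauchy sequence.
\<close>

lemma null_imp_summable:
  assumes "(\<lambda>n. \<bar>f n\<bar>\<^sub>C) \<longlonglongrightarrow> 0"
  shows "summable f"
proof -
  have "Cauchy (\<lambda>n. \<Sum>i<n. f i)"
  proof (rule metric_CauchyI)
    fix e :: real assume e: "0 < e"
    obtain N where N: "\<And>n. N \<le> n \<Longrightarrow> \<bar>f n\<bar>\<^sub>C < e"
      using order_tendstoD(2)[OF assms e] by (auto simp: eventually_sequentially)
    have tail: "\<bar>(\<Sum>i<n. f i) - (\<Sum>i<m. f i)\<bar>\<^sub>C < e" if "N \<le> m" "m \<le> n" for m n
    proof -
      have "(\<Sum>i<n. f i) - (\<Sum>i<m. f i) = (\<Sum>i\<in>{m..<n}. f i)"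
        using that(2) sum_diff_nat_ivl[of 0 m n f] by (simp add: atLeast0LessThan)
      then show ?thesis
        using N that(1) by (auto intro!: absval_sum_less e)
    qed
    have "dist (\<Sum>i<m. f i) (\<Sum>i<n. f i) < e" if "N \<le> m" "N \<le> n" for m n
      using that tail[of m n] tail[of n m] dist_diff dist_commute by (metis le_cases)
    then show "\<exists>M. \<forall>m\<ge>M. \<forall>n\<ge>M. dist (\<Sum>i<m. f i) (\<Sum>i<n. f i) < e"
      by blast
  qed
  then show ?thesis
    unfolding summable_iff_convergent by (rule Cauchy_convergent)
qed

text \<open>
  The coefficient sequences of the everywhere convergent series \<open>\<Sum> a\<^sub>n x\<^bsup>q^n\<^esup>\<close>; by
  \<open>null_imp_summable\<close> it is enough that the terms tend to zero. The closure properties below take the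
  place of growth estimates.
\<close>

definition entire :: "(nat \<Rightarrow> 'c) \<Rightarrow> bool" where
  "entire a \<longleftrightarrow> (\<forall>x. (\<lambda>n. \<bar>a n * x ^ (q ^ n)\<bar>\<^sub>C) \<longlonglongrightarrow> 0)"

lemma null_iff: "(\<lambda>n. \<bar>f n\<bar>\<^sub>C) \<longlonglongrightarrow> 0 \<longleftrightarrow> f \<longlonglongrightarrow> 0"
  by (simp add: tendsto_absval)

lemma entire_add:
  assumes "entire a" "entire b"
  shows "entire (\<lambda>n. a n + b n)"
  unfolding entire_def null_iff
proof
  fix x
  have "(\<lambda>n. a n * x ^ (q ^ n)) \<longlonglongrightarrow> 0" "(\<lambda>n. b n * x ^ (q ^ n)) \<longlonglongrightarrow> 0"
    using assms by (simp_all add: entire_def null_iff)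
  from tendsto_plus[OF this] show "(\<lambda>n. (a n + b n) * x ^ (q ^ n)) \<longlonglongrightarrow> 0"
    by (simp add: distrib_right)
qed

lemma entire_0: "entire (\<lambda>n. 0)"
  by (simp add: entire_def)

lemma entire_sum: "(\<And>i. i \<in> A \<Longrightarrow> entire (f i)) \<Longrightarrow> entire (\<lambda>n. \<Sum>i\<in>A. f i n)"
  by (induction A rule: infinite_finite_induct) (simp_all add: entire_0 entire_add)

lemma entire_times:
  assumes "entire a"
  shows "entire (\<lambda>n. c * a n)"
  unfolding entire_def null_iff
proof
  fix x
  have "(\<lambda>n. a n * x ^ (q ^ n)) \<longlonglongrightarrow> 0"
    using assms by (simp add: entire_def null_iff)
  from tendsto_times[OF this, of c] show "(\<lambda>n. c * a n * x ^ (q ^ n)) \<longlonglongrightarrow> 0"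
    by (simp add: mult.assoc)
qed

lemma entire_scale:
  assumes "entire a"
  shows "entire (\<lambda>n. a n * y ^ (q ^ n))"
  unfolding entire_def
proof
  fix x
  have "(\<lambda>n. \<bar>a n * (y * x) ^ (q ^ n)\<bar>\<^sub>C) \<longlonglongrightarrow> 0"
    using assms by (simp add: entire_def)
  then show "(\<lambda>n. \<bar>a n * y ^ (q ^ n) * x ^ (q ^ n)\<bar>\<^sub>C) \<longlonglongrightarrow> 0"
    by (simp add: power_mult_distrib mult.assoc)
qed

lemma entire_bounded:
  assumes "entire a" "\<And>n. \<bar>s n\<bar>\<^sub>C \<le> 1"
  shows "entire (\<lambda>n. s n * a n)"
  unfolding entire_def
proof
  fix x
  show "(\<lambda>n. \<bar>s n * a n * x ^ (q ^ n)\<bar>\<^sub>C) \<longlonglongrightarrow> 0"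
  proof (rule tendsto_sandwich[OF always_eventually always_eventually tendsto_const])
    show "(\<lambda>n. \<bar>a n * x ^ (q ^ n)\<bar>\<^sub>C) \<longlonglongrightarrow> 0"
      using assms(1) by (simp add: entire_def)
    show "\<forall>n. \<bar>s n * a n * x ^ (q ^ n)\<bar>\<^sub>C \<le> \<bar>a n * x ^ (q ^ n)\<bar>\<^sub>C"
      using mult_right_mono[OF assms(2)] by (simp add: dist_mult mult.assoc)
  qed simp
qed

text \<open>
  The coefficients of \<open>\<tau>\<^sup>i\<close> composed with the series of \<open>a\<close>.
\<close>

lemma entire_frob_shift:
  assumes "entire a"
  shows "entire (\<lambda>n. if i \<le> n then a (n - i) ^ (q ^ i) else 0)"
  unfolding entire_def null_iff
proof
  fix x
  have "(\<lambda>n. a n * x ^ (q ^ n)) \<longlonglongrightarrow> 0"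
    using assms by (simp add: entire_def null_iff)
  from tendsto_frob[OF this, of i] have lim: "(\<lambda>n. (a n * x ^ (q ^ n)) ^ (q ^ i)) \<longlonglongrightarrow> 0"
    by simp
  show "(\<lambda>n. (if i \<le> n then a (n - i) ^ (q ^ i) else 0) * x ^ (q ^ n)) \<longlonglongrightarrow> 0"
  proof (rule LIMSEQ_offset[of _ i])
    have "x ^ (q ^ (n + i)) = (x ^ (q ^ n)) ^ (q ^ i)" for n
      by (simp add: power_add flip: power_mult)
    with lim show "(\<lambda>n. (if i \<le> n + i then a (n + i - i) ^ (q ^ i) else 0) * x ^ (q ^ (n + i))) \<longlonglongrightarrow> 0"
      by (simp add: power_mult_distrib)
  qed
qed

text \<open>
  The component \<open>F\<close> of the exponential that belongs to one biderivation; \<open>A\<close> and \<open>D\<close> are \<open>\<Phi>(t)\<close> and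
  \<open>\<delta>(t)\<close> over \<open>C\<^sub>\<infinity>\<close>. Comparing coefficients in the functional equation gives
  \<open>c\<^sub>n d\<Phi>(t)\<^bsup>(n)\<^esup> = \<theta> c\<^sub>n + b\<^sub>n\<close>, where \<open>b\<^sub>n\<close> are the coefficients of \<open>\<delta>(t) Exp\<close>. In terms of
  \<open>s\<^sub>n = \<theta>\<^bsup>q^n\<^esup> - \<theta>\<close> and the twist \<open>M\<^sub>n = N\<^bsup>(n)\<^esup>\<close> of the nilpotent part this is \<open>c\<^sub>n (s\<^sub>n + M\<^sub>n) = b\<^sub>n\<close>. The
  Neumann series solves it, and it has the same number of terms for all \<open>n\<close>. Multiplying by an entry
  of \<open>M\<^sub>n\<close> is a rescaling of the variable, and \<open>\<bar>s\<^sub>n\<bar> \<ge> 1\<close> for \<open>n > 0\<close>; so the \<open>c\<^sub>n\<close> are again the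
  coefficients of an everywhere convergent series.
\<close>

lemma quasi_periodic_row:
  fixes A :: "'c poly^'d^'d" and D :: "'c poly^'d" and Q :: "nat \<Rightarrow> 'c^'d^'d" and \<theta> :: 'c
  assumes \<theta>: "1 < \<bar>\<theta>\<bar>\<^sub>C"
    and nil: "\<And>n v. ((\<lambda>v. v v* (\<chi> k l. (d_mat A - mat \<theta>) $ k $ l ^ (q ^ n))) ^^ m) v = 0"
    and D0: "d_row D = 0"
    and Q: "\<And>z. (\<lambda>n. Q n *v frob_vec q n z) sums E z"
  obtains c F where "c 0 = (0::'c^'d)"
    and "\<And>z. (\<lambda>n. \<Sum>l\<in>UNIV. c n $ l * (z $ l) ^ (q ^ n)) sums F z"
    and "\<And>z. F (d_mat A *v z) = \<theta> * F z + (\<Sum>k\<in>UNIV. teval q (D $ k) (E z $ k))"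
proof -
  define s where "s n = \<theta> ^ (q ^ n) - \<theta>" for n
  define N where "N = d_mat A - mat \<theta>"
  define M where "M n = (\<chi> k l. N $ k $ l ^ (q ^ n))" for n
  define b :: "nat \<Rightarrow> 'c^'d" where
    "b n = (\<chi> l. \<Sum>k\<in>UNIV. \<Sum>i\<le>Polynomial.degree (D $ k). Polynomial.coeff (D $ k) i *
        (if i \<le> n then (Q (n - i) $ k $ l) ^ (q ^ i) else 0))" for n
  define it where "it n k = ((\<lambda>v. v v* M n) ^^ k) (b n)" for n k
  define c where "c n = (\<Sum>k<m. ((- 1) ^ k * inverse (s n) ^ Suc k) *s it n k)" for n
  have Q_row: "(\<lambda>n. \<Sum>l\<in>UNIV. Q n $ k $ l * (z $ l) ^ (q ^ n)) sums (E z $ k)" for k z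
  proof -
    have "(\<lambda>n. (\<Sum>i<n. Q i *v frob_vec q i z) $ k) \<longlonglongrightarrow> E z $ k"
      using Q[of z] unfolding sums_def by (rule tendsto_vec_nth)
    then show ?thesis
      by (simp add: sums_def matrix_vector_mult_def frob_vec_def)
  qed
  have Q_entire: "entire (\<lambda>n. Q n $ k $ l)" for k l
    unfolding entire_def
  proof
    fix x
    have "(\<Sum>j\<in>UNIV. Q n $ k $ j * (axis l x $ j) ^ (q ^ n)) = Q n $ k $ l * x ^ (q ^ n)" for n
    proof -
      have "(\<Sum>j\<in>UNIV. Q n $ k $ j * (axis l x $ j) ^ (q ^ n)) =
          (\<Sum>j\<in>UNIV. if j = l then Q n $ k $ l * x ^ (q ^ n) else 0)"
        by (rule sum.cong) (auto simp: axis_def)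
      then show ?thesis
        by simp
    qed
    with sums_imp_null[OF Q_row[of k "axis l x"]] show "(\<lambda>n. \<bar>Q n $ k $ l * x ^ (q ^ n)\<bar>\<^sub>C) \<longlonglongrightarrow> 0"
      by simp
  qed
  have b_entire: "entire (\<lambda>n. b n $ l)" for l
    unfolding b_def vec_lambda_beta
    by (intro entire_sum entire_times entire_frob_shift Q_entire)
  have it_entire: "entire (\<lambda>n. it n k $ l)" for k l
  proof (induction k arbitrary: l)
    case 0
    then show ?case
      by (simp add: it_def b_entire)
  next
    case (Suc k)
    have "it n (Suc k) $ l = (\<Sum>j\<in>UNIV. it n k $ j * (N $ j $ l) ^ (q ^ n))" for n
      by (simp add: it_def vector_matrix_mult_def M_def mult.commute)
    then show ?case
      by (simp add: entire_sum entire_scale Suc)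
  qed
  have s_bound: "\<bar>inverse (s n)\<bar>\<^sub>C \<le> 1" for n
  proof (cases "n = 0")
    case False
    have "\<bar>\<theta>\<bar>\<^sub>C ^ 1 < \<bar>\<theta>\<bar>\<^sub>C ^ (q ^ n)"
      using \<theta> one_less_power[OF q_gt_1, of n] False by (intro power_strict_increasing) auto
    moreover have "\<bar>\<theta>\<bar>\<^sub>C ^ (q ^ n) \<le> max \<bar>s n\<bar>\<^sub>C \<bar>\<theta>\<bar>\<^sub>C"
      using dist_add[of "s n" \<theta>] by (simp add: s_def absval_power)
    ultimately have "1 \<le> \<bar>s n\<bar>\<^sub>C"
      using \<theta> by simp
    then show ?thesis
      by (simp add: absval_inverse inverse_le_1_iff)
  qed (simp add: s_def)
  have c_entire: "entire (\<lambda>n. c n $ l)" for l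
  proof -
    have "\<bar>(- 1) ^ k * inverse (s n) ^ Suc k\<bar>\<^sub>C \<le> 1" for k n
    proof -
      have "\<bar>(- 1) ^ k * inverse (s n) ^ Suc k\<bar>\<^sub>C = \<bar>inverse (s n)\<bar>\<^sub>C ^ Suc k"
        unfolding dist_mult absval_power by simp
      also have "\<dots> \<le> 1"
        by (rule power_le_one[OF zero_le_dist s_bound])
      finally show ?thesis .
    qed
    from entire_bounded[OF it_entire this]
    have "entire (\<lambda>n. \<Sum>k<m. ((- 1) ^ k * inverse (s n) ^ Suc k) * it n k $ l)"
      by (rule entire_sum)
    then show ?thesis
      by (simp add: c_def)
  qed
  \<comment> \<open>For \<open>n = 0\<close> both \<open>s\<^sub>0\<close> and \<open>b\<^sub>0\<close> are zero, and the formula for \<open>c\<^sub>0\<close> gives \<open>0\<close> because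
      \<open>inverse 0 = 0\<close>; this is the solution that keeps the linear part of the exponential equal to the
      identity.\<close>
  have b0: "b 0 = 0"
  proof -
    have "(\<Sum>i\<le>Polynomial.degree (D $ k). Polynomial.coeff (D $ k) i *
        (if i \<le> 0 then (Q (0 - i) $ k $ l) ^ (q ^ i) else 0)) = 0" for k l
      using D0 by (intro sum.neutral) (auto simp: d_row_def vec_eq_iff)
    then show ?thesis
      unfolding b_def vec_eq_iff by simp
  qed
  have c0: "c 0 = 0"
    by (simp add: c_def s_def)
  have c_eq: "c n v* (\<chi> k l. d_mat A $ k $ l ^ (q ^ n)) = (\<theta> *s c n) + b n" for n
  proof (cases "n = 0")
    case True
    then show ?thesis
      by (simp add: c0 b0)
  next
    case False
    have "s n \<noteq> 0"
    proof
      assume "s n = 0"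
      moreover have "\<bar>\<theta>\<bar>\<^sub>C ^ 1 < \<bar>\<theta>\<bar>\<^sub>C ^ (q ^ n)"
        using \<theta> one_less_power[OF q_gt_1, of n] False by (intro power_strict_increasing) auto
      ultimately show False
        by (simp add: s_def flip: absval_power)
    qed
    from row_resolvent[OF this, where M = "M n" and b = "b n" and m = m]
    have res: "(s n *s c n) + (c n v* M n) = b n"
      using nil[of n] by (simp add: c_def it_def M_def N_def)
    have "M n = (\<chi> k l. d_mat A $ k $ l ^ (q ^ n)) - mat (\<theta> ^ (q ^ n))"
      by (auto simp: vec_eq_iff M_def N_def mat_def frob_diff)
    then have "c n v* M n = (c n v* (\<chi> k l. d_mat A $ k $ l ^ (q ^ n))) - (\<theta> ^ (q ^ n) *s c n)"
      by (simp only: vector_matrix_mult_diff_mat)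
    with res show ?thesis
      by (simp add: s_def vec_eq_iff algebra_simps)
  qed
  define F where "F z = (\<Sum>l\<in>UNIV. \<Sum>n. c n $ l * (z $ l) ^ (q ^ n))" for z
  have F: "(\<lambda>n. \<Sum>l\<in>UNIV. c n $ l * (z $ l) ^ (q ^ n)) sums F z" for z
  proof -
    have "summable (\<lambda>n. c n $ l * (z $ l) ^ (q ^ n))" for l
      using c_entire[of l] by (intro null_imp_summable) (simp add: entire_def)
    then show ?thesis
      unfolding F_def by (intro sums_finite_sum summable_sums)
  qed
  have "F (d_mat A *v z) = \<theta> * F z + (\<Sum>k\<in>UNIV. teval q (D $ k) (E z $ k))" for z
  proof -
    define R where "R n k = (\<Sum>l\<in>UNIV. Q n $ k $ l * (z $ l) ^ (q ^ n))" for n k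
    have "(\<lambda>n. \<Sum>k\<in>UNIV. \<Sum>i\<le>Polynomial.degree (D $ k). Polynomial.coeff (D $ k) i *
        (if i \<le> n then R (n - i) k ^ (q ^ i) else 0)) sums
        (\<Sum>k\<in>UNIV. \<Sum>i\<le>Polynomial.degree (D $ k). Polynomial.coeff (D $ k) i * (E z $ k) ^ (q ^ i))"
      unfolding R_def by (intro sums_finite_sum sums_times sums_shift sums_frob Q_row)
    moreover have "(\<Sum>k\<in>UNIV. \<Sum>i\<le>Polynomial.degree (D $ k). Polynomial.coeff (D $ k) i *
        (if i \<le> n then R (n - i) k ^ (q ^ i) else 0)) = (\<Sum>l\<in>UNIV. b n $ l * (z $ l) ^ (q ^ n))" for n
    proof -
      have R_pow: "(if i \<le> n then R (n - i) k ^ (q ^ i) else 0) =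
          (\<Sum>l\<in>UNIV. (if i \<le> n then (Q (n - i) $ k $ l) ^ (q ^ i) else 0) * (z $ l) ^ (q ^ n))" for i k
        by (simp add: R_def frob_sum power_mult_distrib flip: power_mult power_add)
      have "(\<Sum>k\<in>UNIV. \<Sum>i\<le>Polynomial.degree (D $ k). Polynomial.coeff (D $ k) i *
          (if i \<le> n then R (n - i) k ^ (q ^ i) else 0)) =
          (\<Sum>k\<in>UNIV. \<Sum>i\<le>Polynomial.degree (D $ k). \<Sum>l\<in>UNIV. Polynomial.coeff (D $ k) i *
            ((if i \<le> n then (Q (n - i) $ k $ l) ^ (q ^ i) else 0) * (z $ l) ^ (q ^ n)))"
        unfolding R_pow sum_distrib_left ..
      also have "\<dots> = (\<Sum>k\<in>UNIV. \<Sum>l\<in>UNIV. \<Sum>i\<le>Polynomial.degree (D $ k). Polynomial.coeff (D $ k) i *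
            ((if i \<le> n then (Q (n - i) $ k $ l) ^ (q ^ i) else 0) * (z $ l) ^ (q ^ n)))"
        by (rule sum.cong[OF refl], rule sum.swap)
      also have "\<dots> = (\<Sum>l\<in>UNIV. \<Sum>k\<in>UNIV. \<Sum>i\<le>Polynomial.degree (D $ k). Polynomial.coeff (D $ k) i *
            ((if i \<le> n then (Q (n - i) $ k $ l) ^ (q ^ i) else 0) * (z $ l) ^ (q ^ n)))"
        by (rule sum.swap)
      also have "\<dots> = (\<Sum>l\<in>UNIV. b n $ l * (z $ l) ^ (q ^ n))"
        unfolding b_def vec_lambda_beta sum_distrib_right mult.assoc ..
      finally show ?thesis .
    qed
    ultimately have b_sums: "(\<lambda>n. \<Sum>l\<in>UNIV. b n $ l * (z $ l) ^ (q ^ n)) sums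
        (\<Sum>k\<in>UNIV. teval q (D $ k) (E z $ k))"
      by (simp add: teval_def)
    have "(\<Sum>l\<in>UNIV. c n $ l * ((d_mat A *v z) $ l) ^ (q ^ n)) =
        \<theta> * (\<Sum>l\<in>UNIV. c n $ l * (z $ l) ^ (q ^ n)) + (\<Sum>l\<in>UNIV. b n $ l * (z $ l) ^ (q ^ n))" for n
    proof -
      have "(\<Sum>l\<in>UNIV. c n $ l * ((d_mat A *v z) $ l) ^ (q ^ n)) =
          (\<Sum>l\<in>UNIV. \<Sum>j\<in>UNIV. c n $ l * (d_mat A $ l $ j ^ (q ^ n) * (z $ j) ^ (q ^ n)))"
        by (simp add: matrix_vector_mult_def frob_sum power_mult_distrib sum_distrib_left)
      also have "\<dots> = (\<Sum>j\<in>UNIV. \<Sum>l\<in>UNIV. c n $ l * (d_mat A $ l $ j ^ (q ^ n) * (z $ j) ^ (q ^ n)))"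
        by (rule sum.swap)
      also have "\<dots> = (\<Sum>j\<in>UNIV. (c n v* (\<chi> k l. d_mat A $ k $ l ^ (q ^ n))) $ j * (z $ j) ^ (q ^ n))"
        by (simp add: vector_matrix_mult_def sum_distrib_right mult.assoc)
      finally show ?thesis
        by (simp add: c_eq distrib_right sum.distrib sum_distrib_left mult.assoc)
    qed
    with sums_plus[OF sums_times[OF F[of z], of \<theta>] b_sums]
    have "(\<lambda>n. \<Sum>l\<in>UNIV. c n $ l * ((d_mat A *v z) $ l) ^ (q ^ n)) sums
        (\<theta> * F z + (\<Sum>k\<in>UNIV. teval q (D $ k) (E z $ k)))"
      by simp
    with F[of "d_mat A *v z"] show ?thesis
      by (rule sums_unique2)
  qed
  with c0 F show ?thesis
    using that by blast
qed

end

section \<open>Field embeddings\<close>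

lemma
  assumes "field_embedding h"
  shows field_embedding_1: "h 1 = 1"
    and field_embedding_add: "h (x + y) = h x + h y"
    and field_embedding_mult: "h (x * y) = h x * h y"
  using assms by (simp_all add: field_embedding_def)

lemma field_embedding_0:
  assumes "field_embedding h"
  shows "h 0 = 0"
  using field_embedding_add[OF assms, of 0 0] by (metis add.right_neutral add_cancel_left_right)

lemma field_embedding_diff:
  assumes "field_embedding h"
  shows "h (x - y) = h x - h y"
  by (metis assms add_diff_cancel_right' diff_add_cancel field_embedding_add)

lemma field_embedding_power:
  assumes "field_embedding h"
  shows "h (x ^ n) = h x ^ n"
  by (induction n) (simp_all add: field_embedding_1[OF assms] field_embedding_mult[OF assms])

lemma field_embedding_eq_0_iff:
  assumes "field_embedding h"
  shows "h x = 0 \<longleftrightarrow> x = 0"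
proof
  assume "h x = 0"
  then have "h (x * inverse x) = 0"
    by (simp add: field_embedding_mult[OF assms])
  then show "x = 0"
    using field_embedding_1[OF assms] by (metis right_inverse zero_neq_one)
qed (simp add: field_embedding_0[OF assms])

lemma field_embedding_eq_iff:
  assumes "field_embedding h"
  shows "h x = h y \<longleftrightarrow> x = y"
  using field_embedding_eq_0_iff[OF assms, of "x - y"] by (simp add: field_embedding_diff[OF assms])

lemma field_embedding_CHAR:
  fixes h :: "'a::field \<Rightarrow> 'b::field"
  assumes "field_embedding h"
  shows "CHAR('a) = CHAR('b)"
proof -
  have h_of_nat: "h (of_nat n) = of_nat n" for n
    by (induction n)
      (simp_all add: field_embedding_0[OF assms] field_embedding_1[OF assms] field_embedding_add[OF assms])
  have "of_nat n = (0::'a) \<longleftrightarrow> of_nat n = (0::'b)" for n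
    using field_embedding_eq_0_iff[OF assms, of "of_nat n"] by (simp add: h_of_nat)
  then show ?thesis
    unfolding of_nat_eq_0_iff_char_dvd by (meson dvd_refl dvd_antisym)
qed

section \<open>The field tower\<close>

lemma field_tower_unfold:
  fixes emb :: "'f::{field,finite} fls alg_closure \<Rightarrow> 'c::{field,complete_space}"
    and incl :: "'l::alg_closed_field \<Rightarrow> 'c" and \<iota> :: "'f poly \<Rightarrow> 'l"
  assumes "field_tower emb incl \<iota>"
  shows "field_embedding emb" and "field_embedding incl"
    and "incl (\<iota> a) = emb (to_ac (poly (map_poly fls_const a) fls_X_inv))"
    and "dist x y = dist (x - y) (0::'c)"
    and "dist (x * y) 0 = dist x 0 * dist y (0::'c)"
    and "dist (x + y) 0 \<le> max (dist x 0) (dist y (0::'c))"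
    and "f \<noteq> 0 \<Longrightarrow> dist (emb (to_ac f)) 0 = real CARD('f) powi (- fls_subdegree f)"
  using assms unfolding field_tower_def is_C_infinity_def by (elim conjE, iprover)+

lemma field_tower_CHAR:
  fixes emb :: "'f::{field,finite} fls alg_closure \<Rightarrow> 'c::{field,complete_space}"
    and incl :: "'l::alg_closed_field \<Rightarrow> 'c"
  assumes "field_tower emb incl \<iota>"
  shows "CHAR('l) = CHAR('f)" and "CHAR('c) = CHAR('f)"
proof -
  from field_tower_unfold(1,2)[OF assms, THEN field_embedding_CHAR]
  show "CHAR('l) = CHAR('f)" and "CHAR('c) = CHAR('f)"
    by simp_all
qed

lemma field_tower_char_power:
  fixes emb :: "'f::{field,finite} fls alg_closure \<Rightarrow> 'c::{field,complete_space}"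
    and incl :: "'l::alg_closed_field \<Rightarrow> 'c"
  assumes "field_tower emb incl \<iota>"
  shows "char_power TYPE('l) CARD('f)" and "char_power TYPE('c) CARD('f)"
  using prime_CHAR_finite_field[where 'f = 'f] card_finite_field_power_CHAR[where 'f = 'f]
  by (simp_all add: char_power_def field_tower_CHAR[OF assms])

lemma field_tower_ultrametric:
  fixes emb :: "'f::{field,finite} fls alg_closure \<Rightarrow> 'c::{field,complete_space}"
    and incl :: "'l::alg_closed_field \<Rightarrow> 'c"
  assumes "field_tower emb incl \<iota>"
  shows "ultrametric TYPE('c) CARD('f)"
  by (intro ultrametric.intro ultrametric_axioms.intro field_tower_char_power(2)[OF assms]
      field_tower_unfold(4-6)[OF assms])

lemma field_tower_iota:
  fixes emb :: "'f::{field,finite} fls alg_closure \<Rightarrow> 'c::{field,complete_space}"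
    and incl :: "'l::alg_closed_field \<Rightarrow> 'c" and \<iota> :: "'f poly \<Rightarrow> 'l"
  assumes tower: "field_tower emb incl \<iota>"
  shows "\<iota> 0 = 0" and "\<iota> (pCons c a) = \<iota> [:c:] + \<iota> tvar * \<iota> a"
    and "\<iota> [:c:] ^ CARD('f) = \<iota> [:c:]" and "dist (incl (\<iota> tvar)) 0 = real CARD('f)"
proof -
  note emb = field_tower_unfold(1)[OF tower] and incl = field_tower_unfold(2)[OF tower]
    and \<iota> = field_tower_unfold(3)[OF tower] and norm = field_tower_unfold(7)[OF tower]
  have pCons: "map_poly fls_const (pCons c a) = pCons (fls_const c) (map_poly fls_const a)" for c :: 'f and a
    by (simp add: map_poly_pCons)
  note incl_simps = field_embedding_eq_iff[OF incl, symmetric] field_embedding_0[OF incl]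
    field_embedding_add[OF incl] field_embedding_mult[OF incl] field_embedding_power[OF incl]
  note emb_simps = field_embedding_0[OF emb] field_embedding_1[OF emb] field_embedding_add[OF emb, symmetric]
    field_embedding_mult[OF emb, symmetric] field_embedding_power[OF emb, symmetric]
  show "\<iota> 0 = 0"
    unfolding incl_simps \<iota> by (simp add: emb_simps)
  show "\<iota> (pCons c a) = \<iota> [:c:] + \<iota> tvar * \<iota> a"
    unfolding incl_simps \<iota> pCons emb_simps by (simp flip: to_ac_add to_ac_mult)
  show "\<iota> [:c:] ^ CARD('f) = \<iota> [:c:]"
    unfolding incl_simps \<iota> pCons emb_simps
    by (simp add: power_card_finite_field flip: to_ac_power fls_const_power)
  show "dist (incl (\<iota> tvar)) 0 = real CARD('f)"
    unfolding \<iota> pCons by (simp add: norm)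
qed

text \<open>
  \<open>\<theta>\<close> is not a root of unity, as its absolute value is \<open>q > 1\<close>.
\<close>

lemma field_tower_theta_powers:
  fixes emb :: "'f::{field,finite} fls alg_closure \<Rightarrow> 'c::{field,complete_space}"
    and incl :: "'l::alg_closed_field \<Rightarrow> 'c"
  assumes tower: "field_tower emb incl \<iota>" and eq: "\<iota> tvar ^ m = \<iota> tvar ^ n"
  shows "m = n"
proof -
  interpret ultrametric "CARD('f)" "TYPE('c)"
    by (rule field_tower_ultrametric[OF tower])
  note incl = field_tower_unfold(2)[OF tower]
  have "real CARD('f) ^ k = \<bar>incl (\<iota> tvar ^ k)\<bar>\<^sub>C" for k
    by (simp add: field_embedding_power[OF incl] absval_power field_tower_iota(4)[OF tower])
  then have "real CARD('f) ^ m = real CARD('f) ^ n"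
    by (simp add: eq)
  then show ?thesis
    using q_gt_1 by (simp add: power_inject_exp)
qed

section \<open>The exponential of a quasi-periodic extension\<close>

text \<open>
  The rows from \<open>quasi_periodic_row\<close> are placed below the exponential of \<open>E\<close>. To reach \<open>(y, w)\<close>, choose
  \<open>z\<close> with \<open>Exp z = y\<close> and take \<open>u = w - F(z)\<close>.
\<close>

lemma uniformizable_quasi_periodic_extension:
  fixes emb :: "'f::{field,finite} fls alg_closure \<Rightarrow> 'c::{field,complete_space}"
    and incl :: "'l::alg_closed_field \<Rightarrow> 'c"
    and \<iota> :: "'f poly \<Rightarrow> 'l"
    and \<Phi> :: "'f poly \<Rightarrow> 'l poly^'d^'d"
    and \<delta> :: "'j::finite \<Rightarrow> 'f poly \<Rightarrow> 'l poly^'d"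
    and \<Psi> :: "'f poly \<Rightarrow> 'l poly^('d + 'j)^('d + 'j)"
  assumes tower: "field_tower emb incl \<iota>"
    and \<Phi>: "t_module \<iota> \<Phi>" and unif: "uniformizable incl \<Phi>"
    and \<delta>: "\<And>i. \<delta> i \<in> biderivations \<iota> \<Phi>"
    and \<Psi>: "quasi_periodic_extension \<iota> \<Phi> \<delta> \<Psi>"
  shows "uniformizable incl \<Psi>"
proof -
  interpret ultrametric "CARD('f)" "TYPE('c)"
    by (rule field_tower_ultrametric[OF tower])
  let ?q = "CARD('f)"
  note incl = field_tower_unfold(2)[OF tower]
  note incl_simps [simp] = field_embedding_0[OF incl] field_embedding_1[OF incl]
    field_embedding_add[OF incl] field_embedding_mult[OF incl] field_embedding_diff[OF incl]
  define A :: "'c poly^'d^'d" where "A = (\<chi> i j. map_poly incl (\<Phi> tvar $ i $ j))"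
  define D :: "'j \<Rightarrow> 'c poly^'d" where "D i = (\<chi> k. map_poly incl (\<delta> i tvar $ k))" for i
  define B :: "'c poly^('d + 'j)^('d + 'j)" where "B = (\<chi> i j. map_poly incl (\<Psi> tvar $ i $ j))"
  define \<theta> where "\<theta> = incl (\<iota> tvar)"
  obtain E Q where surj: "surj E" and Q0: "Q 0 = mat 1"
    and Q: "\<And>z. (\<lambda>n. Q n *v frob_vec ?q n z) sums E z"
    and E: "\<And>z. E (d_mat A *v z) = tmat_act ?q A (E z)"
    using unif unfolding uniformizable_def is_exponential_def Let_def A_def by blast
  have B: "B $ Inl i $ Inl k = A $ i $ k" "B $ Inl i $ Inr j = 0"
      "B $ Inr j $ Inl k = D j $ k" "B $ Inr j $ Inr j' = (if j = j' then [:\<theta>:] else 0)" for i k j j'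
    using \<Psi> by (simp_all add: quasi_periodic_extension_def A_def B_def D_def \<theta>_def map_poly_pCons)
  have \<theta>: "1 < \<bar>\<theta>\<bar>\<^sub>C"
    using q_gt_1 by (simp add: \<theta>_def field_tower_iota(4)[OF tower])
  obtain m where m: "(((**) (nil_part \<iota> \<Phi>)) ^^ m) (mat 1) = 0"
    using \<Phi> by (auto simp: t_module_def nilpotent_mat_def)
  have nil: "((\<lambda>v. v v* (\<chi> k l. (d_mat A - mat \<theta>) $ k $ l ^ (?q ^ n))) ^^ m) v = 0" for n v
  proof (rule nilpotent_rows)
    \<comment> \<open>Entrywise, the twisted nilpotent part is the image of \<open>nil_part \<iota> \<Phi>\<close> under the ring homomorphism \<open>h\<close>.\<close>
    define h where "h x = incl x ^ (?q ^ n)" for x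
    have "(\<chi> k l. (d_mat A - mat \<theta>) $ k $ l ^ (?q ^ n)) = (\<chi> k l. h (nil_part \<iota> \<Phi> $ k $ l))"
      by (auto simp: vec_eq_iff h_def nil_part_def d_mat_def A_def coeff_map_poly mat_def \<theta>_def)
    moreover have "(((**) (\<chi> k l. h (nil_part \<iota> \<Phi> $ k $ l))) ^^ m) (mat 1) = 0"
      by (subst map_matrix_power) (simp_all add: m h_def frob_add power_mult_distrib zero_vec_def)
    ultimately show "(((**) (\<chi> k l. (d_mat A - mat \<theta>) $ k $ l ^ (?q ^ n))) ^^ m) (mat 1) = 0"
      by simp
  qed
  have D0: "d_row (D i) = 0" for i
    using \<delta>[of i] by (simp add: biderivations_def d_row_def D_def vec_eq_iff coeff_map_poly)
  define row where "row i c F \<longleftrightarrow> c 0 = (0::'c^'d) \<and>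
    (\<forall>z. (\<lambda>n. \<Sum>l\<in>UNIV. c n $ l * (z $ l) ^ (?q ^ n)) sums F z) \<and>
    (\<forall>z. F (d_mat A *v z) = \<theta> * F z + (\<Sum>k\<in>UNIV. teval ?q (D i $ k) (E z $ k)))" for i c F
  have "\<exists>c F. row i c F" for i
  proof (rule quasi_periodic_row[OF \<theta> nil D0[of i] Q])
    fix c :: "nat \<Rightarrow> 'c^'d" and F
    assume "c 0 = 0" and "\<And>z. (\<lambda>n. \<Sum>l\<in>UNIV. c n $ l * (z $ l) ^ (?q ^ n)) sums F z"
      and "\<And>z. F (d_mat A *v z) = \<theta> * F z + (\<Sum>k\<in>UNIV. teval ?q (D i $ k) (E z $ k))"
    then have "row i c F"
      by (simp add: row_def)
    then show "\<exists>c F. row i c F"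
      by blast
  qed
  then obtain c F where "\<And>i. row i (c i) (F i)"
    by metis
  then have c0: "c i 0 = 0" and F: "(\<lambda>n. \<Sum>l\<in>UNIV. c i n $ l * (z $ l) ^ (?q ^ n)) sums F i z"
    and F_eq: "F i (d_mat A *v z) = \<theta> * F i z + (\<Sum>k\<in>UNIV. teval ?q (D i $ k) (E z $ k))" for i z
    by (auto simp: row_def)
  define fst_part :: "'c^('d + 'j) \<Rightarrow> 'c^'d" where "fst_part v = (\<chi> k. v $ Inl k)" for v
  define E' :: "'c^('d + 'j) \<Rightarrow> 'c^('d + 'j)" where
    "E' v = (\<chi> s. case s of Inl i \<Rightarrow> E (fst_part v) $ i | Inr j \<Rightarrow> v $ Inr j + F j (fst_part v))" for v
  define Q' :: "nat \<Rightarrow> 'c^('d + 'j)^('d + 'j)" where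
    "Q' n = (\<chi> s r. case s of
        Inl i \<Rightarrow> (case r of Inl k \<Rightarrow> Q n $ i $ k | Inr _ \<Rightarrow> 0)
      | Inr j \<Rightarrow> (case r of Inl k \<Rightarrow> c j n $ k | Inr j' \<Rightarrow> if j = j' then (if n = 0 then 1 else 0) else 0))" for n
  have "Q' 0 = mat 1"
    by (auto simp: Q'_def vec_eq_iff mat_def Q0 c0 split: sum.split)
  moreover have "(\<lambda>n. Q' n *v frob_vec ?q n v) sums E' v" for v
  proof -
    have entry: "(\<lambda>n. (Q' n *v frob_vec ?q n v) $ s) sums (E' v $ s)" for s
    proof (cases s)
      case (Inl i)
      have "(\<lambda>n. (\<Sum>i<n. Q i *v frob_vec ?q i (fst_part v)) $ i) \<longlonglongrightarrow> E (fst_part v) $ i"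
        using Q[of "fst_part v"] unfolding sums_def by (rule tendsto_vec_nth)
      then show ?thesis
        by (simp add: Inl sums_def E'_def Q'_def matrix_vector_mult_def frob_vec_def sum_UNIV_Plus fst_part_def)
    next
      case (Inr j)
      have "(\<lambda>n. if n = 0 then v $ Inr j else 0) sums (v $ Inr j)"
        unfolding sums_def
      proof (rule LIMSEQ_offset[of _ 1])
        have "(\<Sum>i<n + 1. if i = 0 then v $ Inr j else 0) = v $ Inr j" for n :: nat
          by (subst sum.delta) simp_all
        then show "(\<lambda>n. \<Sum>i<n + 1. if i = 0 then v $ Inr j else 0) \<longlonglongrightarrow> v $ Inr j"
          by (simp only: tendsto_const)
      qed
      from sums_plus[OF F[of j "fst_part v"] this] show ?thesis
        by (simp add: Inr E'_def Q'_def matrix_vector_mult_def frob_vec_def sum_UNIV_Plus fst_part_def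
            if_distrib[of "\<lambda>x. x * _"] add.commute cong: if_cong)
    qed
    show ?thesis
      unfolding sums_def
      by (rule vec_tendstoI) (use entry in \<open>simp add: sums_def\<close>)
  qed
  moreover have "E' (d_mat B *v v) = tmat_act ?q B (E' v)" for v
  proof -
    have fst: "fst_part (d_mat B *v v) = d_mat A *v fst_part v"
      by (simp add: fst_part_def vec_eq_iff matrix_vector_mult_def d_mat_def sum_UNIV_Plus B)
    have D0': "Polynomial.coeff (D j $ k) 0 = 0" for j k
      using D0[of j] by (simp add: d_row_def vec_eq_iff)
    have theta: "(\<Sum>j'\<in>UNIV. Polynomial.coeff (if j = j' then [:\<theta>:] else 0) 0 * w j') = \<theta> * w j"
      "(\<Sum>j'\<in>UNIV. teval ?q (if j = j' then [:\<theta>:] else 0) (w j')) = \<theta> * w j" for j :: 'j and w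
      by (simp_all add: if_distrib[of "\<lambda>p. Polynomial.coeff p 0"] if_distrib[of "\<lambda>p. teval ?q p _"]
          if_distrib[of "\<lambda>x. x * _"] cong: if_cong)
    have snd: "(d_mat B *v v) $ Inr j = \<theta> * v $ Inr j" for j
      by (simp add: matrix_vector_mult_def d_mat_def sum_UNIV_Plus B D0' theta)
    have "E' (d_mat B *v v) $ s = tmat_act ?q B (E' v) $ s" for s
    proof (cases s)
      case (Inl i)
      then show ?thesis
        by (simp add: E'_def fst E tmat_act_def sum_UNIV_Plus B)
    next
      case (Inr j)
      then show ?thesis
        by (simp add: E'_def fst snd F_eq tmat_act_def sum_UNIV_Plus B theta algebra_simps)
    qed
    then show ?thesis
      by (simp add: vec_eq_iff)
  qed
  ultimately have "is_exponential incl \<Psi> E'"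
    unfolding is_exponential_def Let_def B_def by blast
  moreover have "surj E'"
    unfolding surj_def
  proof
    fix w :: "'c^('d + 'j)"
    obtain z where z: "fst_part w = E z"
      using surj unfolding surj_def by blast
    define v :: "'c^('d + 'j)" where "v = (\<chi> s. case s of Inl i \<Rightarrow> z $ i | Inr j \<Rightarrow> w $ Inr j - F j z)"
    have fst: "fst_part v = z"
      by (simp add: fst_part_def v_def vec_eq_iff)
    have snd: "v $ Inr j = w $ Inr j - F j z" for j
      by (simp add: v_def)
    have "E z $ i = w $ Inl i" for i
      by (simp add: fst_part_def flip: z)
    then have "E' v $ s = w $ s" for s
      by (cases s) (simp_all add: E'_def fst snd)
    then have "w = E' v"
      by (simp add: vec_eq_iff)
    then show "\<exists>v. w = E' v"
      by blast
  qed
  ultimately show ?thesis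
    unfolding uniformizable_def by blast
qed

section \<open>The equivalence\<close>

theorem proposition3p4p1:
  fixes emb :: "'f::{field,finite} fls alg_closure \<Rightarrow> 'c::{field,complete_space}"
    and incl :: "'l::alg_closed_field \<Rightarrow> 'c"
    and \<iota> :: "'f poly \<Rightarrow> 'l"
    and \<Phi> :: "'f poly \<Rightarrow> 'l poly^'d^'d"
    and \<delta> :: "'j::finite \<Rightarrow> 'f poly \<Rightarrow> 'l poly^'d"
    and \<Psi> :: "'f poly \<Rightarrow> 'l poly^('d + 'j)^('d + 'j)"
  assumes "field_tower emb incl \<iota>"
    and "t_module \<iota> \<Phi>" and "uniformizable incl \<Phi>"
    and "\<And>i. \<delta> i \<in> biderivations \<iota> \<Phi>"
    and "quasi_periodic_extension \<iota> \<Phi> \<delta> \<Psi>"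
  shows "lin_indep_family (H_sr \<iota> \<Phi>) (\<lambda>i. H_sr_class \<iota> \<Phi> (\<delta> i))
         \<longleftrightarrow> minimal_extension \<iota> incl \<Psi> \<Phi> proj_mat"
proof -
  note tower = assms(1)
  note q = field_tower_char_power(1)[OF tower]
  note inf = infinite_alg_closed_field[where 'a = 'l]
  let ?q = "CARD('f)" and ?\<theta> = "\<iota> tvar"
  define combination where "combination c a = (\<Sum>i\<in>UNIV. trow_smult (c i) (\<delta> i a))" for c a
  have blocks: "\<Psi> tvar $ Inl i $ Inl k = \<Phi> tvar $ i $ k" "\<Psi> tvar $ Inl i $ Inr j = 0"
      "\<Psi> tvar $ Inr j $ Inl k = \<delta> j tvar $ k"
      "\<Psi> tvar $ Inr j $ Inr j' = (if j = j' then [:?\<theta>:] else 0)" for i k j j'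
    using assms(5) by (auto simp: quasi_periodic_extension_def)
  have onto: "tmat_act ?q proj_mat ` Y = UNIV \<longleftrightarrow> (\<forall>x. \<exists>v\<in>Y. \<forall>k. v $ Inl k = x $ k)"
    for Y :: "('l^('d + 'j)) set"
  proof -
    have "tmat_act ?q proj_mat ` Y = UNIV \<longleftrightarrow> (\<forall>x. \<exists>v\<in>Y. x = tmat_act ?q proj_mat v)"
      by auto
    then show ?thesis
      by (simp add: vec_eq_iff tmat_act_proj_mat eq_commute)
  qed
  have "surj (tmat_act ?q (proj_mat :: 'l poly^('d + 'j)^'d))"
    unfolding onto
  proof (intro allI bexI)
    fix x :: "'l^'d" and k
    show "(\<chi> s. case s of Inl i \<Rightarrow> x $ i | Inr j \<Rightarrow> 0) $ (Inl k :: 'd + 'j) = x $ k"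
      by simp
  qed simp
  moreover have "t_module \<iota> \<Psi>"
    using assms(5) by (simp add: quasi_periodic_extension_def)
  moreover have "uniformizable incl \<Psi>"
    by (rule uniformizable_quasi_periodic_extension[OF assms])
  moreover have "t_morphism \<Psi> \<Phi> proj_mat"
    by (rule t_morphism_proj_mat[OF assms(5,2)])
  ultimately have minimal_iff: "minimal_extension \<iota> incl \<Psi> \<Phi> proj_mat \<longleftrightarrow>
      \<not> (\<exists>Y. sub_t_module \<Psi> Y \<and> Y \<noteq> UNIV \<and> (\<forall>x. \<exists>v\<in>Y. \<forall>k. v $ Inl k = x $ k))"
    using assms(2,3) by (simp add: minimal_extension_def onto)
  have sub_iff: "(\<exists>Y. sub_t_module \<Psi> Y \<and> Y \<noteq> UNIV \<and> (\<forall>x. \<exists>v\<in>Y. \<forall>k. v $ Inl k = x $ k)) \<longleftrightarrow>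
      (\<exists>c. combination c \<in> inner_biderivations \<iota> \<Phi> \<and> (\<exists>i. c i \<noteq> 0))"
  proof
    assume "\<exists>Y. sub_t_module \<Psi> Y \<and> Y \<noteq> UNIV \<and> (\<forall>x. \<exists>v\<in>Y. \<forall>k. v $ Inl k = x $ k)"
    then obtain Y where Y: "sub_t_module \<Psi> Y" "Y \<noteq> UNIV" "\<And>x. \<exists>v\<in>Y. \<forall>k. v $ Inl k = x $ k"
      by blast
    obtain c V where "\<exists>i. c i \<noteq> 0"
      and V: "trow_mul ?q V (\<Phi> tvar) - trow_smult ?\<theta> V = combination c tvar"
    proof (rule proper_submodule_relation[OF q field_tower_theta_powers[OF tower] _ _ blocks, where Y = Y])
      show "nilpotent_mat (d_mat (\<Phi> tvar) - mat ?\<theta>)"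
        using assms(2) by (simp add: t_module_def nil_part_def)
      show "d_row (\<delta> i tvar) = 0" for i
        using assms(4) by (simp add: biderivations_def)
    qed (use Y in \<open>auto simp: sub_t_module_def combination_def\<close>)
    moreover have "combination c \<in> biderivations \<iota> \<Phi>"
      unfolding combination_def by (rule finsum_H_sr(1)[OF finite assms(4)])
    then have "combination c \<in> inner_biderivations \<iota> \<Phi>"
      by (rule inner_biderivation_at_t[where \<iota> = \<iota> and \<Phi> = \<Phi> and \<eta> = "combination c" and U = V,
            OF q inf assms(2) field_tower_iota(1-3)[OF tower] _ V[symmetric]])
    ultimately show "\<exists>c. combination c \<in> inner_biderivations \<iota> \<Phi> \<and> (\<exists>i. c i \<noteq> 0)"
      by blast
  next
    assume "\<exists>c. combination c \<in> inner_biderivations \<iota> \<Phi> \<and> (\<exists>i. c i \<noteq> 0)"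
    then obtain c i V where "c i \<noteq> 0"
      and "trow_mul ?q V (\<Phi> tvar) - trow_smult ?\<theta> V = combination c tvar"
      unfolding inner_biderivations_def by fastforce
    from relation_proper_submodule[OF q inf blocks this[unfolded combination_def]]
    obtain Y where "closedin zariski Y" "connectedin zariski Y" "0 \<in> Y" "Y \<noteq> UNIV"
      "\<And>x y. x \<in> Y \<Longrightarrow> y \<in> Y \<Longrightarrow> x + y \<in> Y" "\<And>x. x \<in> Y \<Longrightarrow> - x \<in> Y"
      "\<And>x. x \<in> Y \<Longrightarrow> tmat_act ?q (\<Psi> tvar) x \<in> Y" "\<And>x :: 'l^'d. \<exists>v\<in>Y. \<forall>k. v $ Inl k = x $ k"
      by metis
    then show "\<exists>Y. sub_t_module \<Psi> Y \<and> Y \<noteq> UNIV \<and> (\<forall>x. \<exists>v\<in>Y. \<forall>k. v $ Inl k = x $ k)"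
      by (intro exI[of _ Y]) (simp add: sub_t_module_def)
  qed
  have indep_iff: "lin_indep_family (H_sr \<iota> \<Phi>) (\<lambda>i. H_sr_class \<iota> \<Phi> (\<delta> i)) \<longleftrightarrow>
      (\<forall>c. combination c \<in> inner_biderivations \<iota> \<Phi> \<longrightarrow> (\<forall>i. c i = 0))"
    unfolding lin_indep_family_H_sr[OF assms(4)] combination_def[abs_def] ..
  show ?thesis
    unfolding minimal_iff sub_iff indep_iff by simp
qed

end
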